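(* Let $\mathfrak{g}$ be a symmetrizable Kac-Moody algebra with generalized Cartan matrix $(a_{i,j})_{i,j\in I}$, $I=\{1,\dots,n\}$, and let $\iota=(\cdots,i_3,i_2,i_1)$ be a sequence adapted to $(a_{i,j})_{i,j\in I}$. Let $\Xi'_{s,k,\iota}$ and $\Xi'^{+}_{s,k,\iota}$ be the sets of linear forms defined (for $\mathfrak{g}$) in the context, and let $\mathcal{M}_{s,k,\iota}$ be the set of monomials defined in the context for the Langlands dual algebra $\mathfrak{g}^L$. If $$\Xi'^{+}_{s,k,\iota}=\Xi'_{s,k,\iota}\qquad\text{for all } s\in\mathbb{Z}_{\geq 1},\ k\in I,$$ then the image of the embedding of crystals $\Psi_\iota:B(\infty)\hookrightarrow\mathbb{Z}^\infty_\iota$ for $\mathfrak{g}$ is $$\mathrm{Im}(\Psi_\iota)=\Big\{\mathbf{a}\in\mathbb{Z}^\infty\ \Big|\ \varphi(\mathbf{a})\geq 0\ \text{ for all }\ \varphi\in\bigcup_{s\in\mathbb{Z}_{\geq1},\,k\in I}Trop(\mathcal{M}_{s,k,\iota})\Big\}.$$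
   Context: **Setting.** $I=\{1,\dots,n\}$; $\mathfrak{g}$ is a symmetrizable Kac-Moody algebra over $\mathbb{C}$ with generalized Cartan matrix $(a_{i,j})_{i,j\in I}$, simple roots $\alpha_i$ and simple coroots $h_i$, $\langle h_i,\alpha_j\rangle=a_{i,j}$. $\mathfrak{g}^L$ denotes the Kac-Moody algebra whose generalized Cartan matrix is the transpose of $(a_{i,j})$. $B(\infty)$ is the crystal base of $U_q^-(\mathfrak{g})$, with highest weight vector $u_\infty$. **Sequences.** $\iota=(\cdots,i_r,\cdots,i_2,i_1)$ is a sequence of elements of $I$ with $i_r\neq i_{r+1}$ for all $r\geq1$ and in which every $k\in I$ occurs infinitely often. It is *adapted* (to $(a_{i,j})$) if for all $i,j\in I$ with $a_{i,j}<0$ the subsequence of $\iota$ consisting of all $i$'s and $j$'s is either $(\cdots,i,j,i,j,i,j)$ or $(\cdots,j,i,j,i,j,i)$. For adapted $\iota$ and $i,j$ with $a_{i,j}<0$, put $p_{i,j}=1$ if this subsequence is $(\cdots,j,i,j,i,j,i)$ (rightmost entry $i$) and $p_{i,j}=0$ if it is $(\cdots,i,j,i,j,i,j)$ (rightmost entry $j$). **Double indices.** A single index $r\in\mathbb{Z}_{\geq1}$ is identified with $(s,k)\in\mathbb{Z}_{\geq1}\times I$ if $i_r=k$ and $k$ occurs exactly $s$ times among $i_1,\dots,i_r$. Correspondingly $a_r=a_{s,k}$, $x_r=x_{s,k}$, and so on. **The embedding $\Psi_\iota$.** $\mathbb{Z}^\infty=\{(\cdots,a_2,a_1)\mid a_r\in\mathbb{Z},\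 a_r=0 \text{ for } r\gg0\}$, and $\mathbb{Q}^\infty$ is defined similarly. $\mathbb{Z}^\infty_\iota$ is $\mathbb{Z}^\infty$ with the following crystal structure. For $\mathbf{a}\in\mathbb{Z}^\infty$ let $\sigma_r(\mathbf{a})=a_r+\sum_{j>r}\langle h_{i_r},\alpha_{i_j}\rangle a_j$, $\sigma^{(i)}(\mathbf{a})=\max_{r:\,i_r=i}\sigma_r(\mathbf{a})$ and $M^{(i)}(\mathbf{a})=\{r\mid i_r=i,\ \sigma_r(\mathbf{a})=\sigma^{(i)}(\mathbf{a})\}$. Then $\tilde f_i\mathbf{a}$ is obtained from $\mathbf{a}$ by adding $1$ to the entry with index $\min M^{(i)}(\mathbf{a})$; $\tilde e_i\mathbf{a}$ is obtained by subtracting $1$ from the entry with index $\max M^{(i)}(\mathbf{a})$ if $\sigma^{(i)}(\mathbf{a})>0$, and $\tilde e_i\mathbf{a}=0$ otherwise; $\mathrm{wt}(\mathbf{a})=-\sum_j a_j\alpha_{i_j}$, $\varepsilon_i(\mathbf{a})=\sigma^{(i)}(\mathbf{a})$, $\varphi_i(\mathbf{a})=\varepsilon_i(\mathbf{a})+\langle h_i,\mathrm{wt}(\mathbf{a})\rangle$. $\Psi_\iota:B(\infty)\hookrightarrow\mathbb{Z}^\infty_\iota$ is the unique strict embedding of crystals (injective, preserving $\mathrm{wt},\varepsilon_i,\varphi_i$ and commuting with all $\tilde e_i,\tilde f_i$) with $\Psi_\iota(u_\infty)=(\cdots,0,0)$. **The sets $\Xi'$ (for $\mathfrak{g}$).**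 $x_r\in(\mathbb{Q}^\infty)^*$ is the coordinate function $x_r(\cdots,a_2,a_1)=a_r$. For $r\ge1$ let $r^{(+)}=\min\{l>r\mid i_l=i_r\}$ and $r^{(-)}=\max(\{l\mid 1\le l<r,\ i_l=i_r\}\cup\{0\})$. Put $\beta_0=0$ and $$\beta_r=x_r+\sum_{r<j<r^{(+)}}\langle h_{i_r},\alpha_{i_j}\rangle x_j+x_{r^{(+)}}\qquad(r\ge1).$$ For $\varphi=\sum_l c_lx_l\in(\mathbb{Q}^\infty)^*$ set $S'_r(\varphi)=\varphi-\beta_r$ if $c_r>0$, $S'_r(\varphi)=\varphi+\beta_{r^{(-)}}$ if $c_r<0$, and $S'_r(\varphi)=\varphi$ if $c_r=0$. The application of $S'_r$ to $\varphi$ is called a *positive action* if $c_r>0$. For $s\in\mathbb{Z}_{\ge1}$, $k\in I$, $$\Xi'_{s,k,\iota}=\{S'_{j_1}\cdots S'_{j_m}x_{s,k}\mid m\in\mathbb{Z}_{\ge0},\ j_1,\dots,j_m\in\mathbb{Z}_{\ge1}\},$$ and $\Xi'^{+}_{s,k,\iota}\subset\Xi'_{s,k,\iota}$ is the subset of those elements that can be written as $S'_{j_1}\cdots S'_{j_m}x_{s,k}$ with $m\geq 0$ where every one of the operators, at the stage it is applied, acts by a positive action. **The sets $\mathcal{M}_{s,k,\iota}$ (for $\mathfrak{g}^L$).** Let $\mathcal{Y}$ be the set of Laurent monomials $X=\prod_{s\in\mathbb{Z},i\in I}X_{s,i}^{\zeta_{s,i}}$ ($\zeta_{s,i}\in\mathbb{Z}$,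 almost all $0$). Set $\varphi_i(X)=\max\{\sum_{l\le s}\zeta_{l,i}\mid s\in\mathbb{Z}\}$ and, if $\varphi_i(X)>0$, $n_{f_i}=\min\{r\in\mathbb{Z}\mid\varphi_i(X)=\sum_{l\le r}\zeta_{l,i}\}$. For a Kac-Moody algebra with generalized Cartan matrix $(b_{i,j})$ put $$A_{s,k}=X_{s,k}X_{s+1,k}\prod_{j\in I;\,b_{j,k}<0}X_{s+p_{j,k},j}^{\,b_{j,k}},$$ and $\tilde f_iX=A_{n_{f_i},i}^{-1}X$ if $\varphi_i(X)>0$, $\tilde f_iX=0$ if $\varphi_i(X)=0$. Then $\mathcal{M}_{s,k,\iota}=\{\tilde f_{j_m}\cdots\tilde f_{j_1}X_{s,k}\mid m\ge0,\ j_1,\dots,j_m\in I\}\setminus\{0\}$ (it is a realization of the crystal $B(\Lambda_k)$). For $\mathfrak{g}^L$ one uses $b_{i,j}=a_{j,i}$, with the same $\iota$ and the same $p_{i,j}$. **Tropicalization.** For monomials only involving $X_{s,k}$ with $s\ge1$ (this holds for all elements of $\mathcal{M}_{s,k,\iota}$ with $s\geq 1$), $Trop\big(\prod X_{s,k}^{\zeta_{s,k}}\big)=\sum\zeta_{s,k}x_{s,k}\in(\mathbb{Q}^\infty)^*$. *)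

theory Defs
  imports
    "HOL-Library.Poly_Mapping"
    "HOL-Library.Infinite_Set"
    "HOL-Computational_Algebra.Polynomial"
    "HOL-Computational_Algebra.Fraction_Field"
    "HOL-Algebra.QuotRing"
begin

section \<open>Cartan matrices and crystals\<close>

text \<open>The index set is a finite type \<open>'i\<close>, and \<open>a i j\<close> is the pairing of the simple coroot
  \<open>h i\<close> with the simple root \<open>\<alpha> j\<close>.\<close>

definition gen_cartan_matrix :: "('i \<Rightarrow> 'i \<Rightarrow> int) \<Rightarrow> bool" where
  "gen_cartan_matrix a \<longleftrightarrow>
     (\<forall>i. a i i = 2) \<and> (\<forall>i j. i \<noteq> j \<longrightarrow> a i j \<le> 0) \<and> (\<forall>i j. a i j = 0 \<longrightarrow> a j i = 0)"

text \<open>\<open>d i\<close> is half the square length of \<open>\<alpha> i\<close>, with the invariant form scaled so that these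
  numbers are positive integers.\<close>

definition symmetrizer :: "('i \<Rightarrow> 'i \<Rightarrow> int) \<Rightarrow> ('i \<Rightarrow> nat) \<Rightarrow> bool" where
  "symmetrizer a d \<longleftrightarrow> (\<forall>i. d i > 0) \<and> (\<forall>i j. int (d i) * a i j = int (d j) * a j i)"

text \<open>Weights of all crystals below lie in the root lattice; \<open>\<mu> :: 'i \<Rightarrow> int\<close> stands for
  \<open>\<Sum>j. \<mu> j \<cdot> \<alpha> j\<close>. The value \<open>None\<close> of an operator is the element 0 adjoined to a crystal.\<close>

record ('b, 'i) crystal =
  elts :: "'b set"
  wt :: "'b \<Rightarrow> 'i \<Rightarrow> int"
  eps :: "'i \<Rightarrow> 'b \<Rightarrow> int"
  phi :: "'i \<Rightarrow> 'b \<Rightarrow> int"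
  ee :: "'i \<Rightarrow> 'b \<Rightarrow> 'b option"
  ff :: "'i \<Rightarrow> 'b \<Rightarrow> 'b option"

definition coroot_pairing :: "('i::finite \<Rightarrow> 'i \<Rightarrow> int) \<Rightarrow> 'i \<Rightarrow> ('i \<Rightarrow> int) \<Rightarrow> int" where
  "coroot_pairing a i \<mu> = (\<Sum>j\<in>UNIV. a i j * \<mu> j)"

definition strict_embedding :: "('b, 'i) crystal \<Rightarrow> ('c, 'i) crystal \<Rightarrow> ('b \<Rightarrow> 'c) \<Rightarrow> bool" where
  "strict_embedding B C \<Psi> \<longleftrightarrow>
     \<Psi> ` elts B \<subseteq> elts C \<and> inj_on \<Psi> (elts B) \<and>
     (\<forall>b\<in>elts B. wt C (\<Psi> b) = wt B b \<and>
        (\<forall>i. eps C i (\<Psi> b) = eps B i b \<and> phi C i (\<Psi> b) = phi B i b \<and>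
             ee C i (\<Psi> b) = map_option \<Psi> (ee B i b) \<and>
             ff C i (\<Psi> b) = map_option \<Psi> (ff B i b)))"

section \<open>The algebra \<open>U\<^sub>q\<^sup>-\<close>\<close>

type_synonym qfield = "rat poly fract"

definition qq :: qfield where
  "qq = Fract [:0, 1:] 1"

text \<open>The rational functions that are regular at \<open>q = 0\<close>.\<close>

definition reg0 :: "qfield set" where
  "reg0 = {Fract p r |p r. poly r 0 \<noteq> 0}"

definition qi :: "('i \<Rightarrow> nat) \<Rightarrow> 'i \<Rightarrow> qfield" where
  "qi d i = qq ^ d i"

definition qint :: "('i \<Rightarrow> nat) \<Rightarrow> 'i \<Rightarrow> nat \<Rightarrow> qfield" where
  "qint d i m = (qi d i ^ m - inverse (qi d i) ^ m) / (qi d i - inverse (qi d i))"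

definition qfact :: "('i \<Rightarrow> nat) \<Rightarrow> 'i \<Rightarrow> nat \<Rightarrow> qfield" where
  "qfact d i m = (\<Prod>k=1..m. qint d i k)"

text \<open>The free associative algebra on the generators \<open>f i\<close>: the word \<open>[i\<^sub>1, \<dots>, i\<^sub>m]\<close> stands for
  the monomial \<open>f i\<^sub>1 \<cdots> f i\<^sub>m\<close>.\<close>

type_synonym 'i falg = "'i list \<Rightarrow>\<^sub>0 qfield"

definition fmult :: "'i falg \<Rightarrow> 'i falg \<Rightarrow> 'i falg" where
  "fmult x y = (\<Sum>u\<in>Poly_Mapping.keys x. \<Sum>v\<in>Poly_Mapping.keys y.
     Poly_Mapping.single (u @ v) (Poly_Mapping.lookup x u * Poly_Mapping.lookup y v))"

definition free_alg :: "'i falg ring" where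
  "free_alg = \<lparr>carrier = UNIV, mult = fmult, one = Poly_Mapping.single [] 1, zero = 0, add = (+)\<rparr>"

definition serre :: "('i \<Rightarrow> 'i \<Rightarrow> int) \<Rightarrow> ('i \<Rightarrow> nat) \<Rightarrow> 'i \<Rightarrow> 'i \<Rightarrow> 'i falg" where
  "serre a d i j = (let b = nat (1 - a i j) in
     \<Sum>k\<le>b. Poly_Mapping.single (replicate k i @ [j] @ replicate (b - k) i)
              ((-1) ^ k / (qfact d i k * qfact d i (b - k))))"

definition serre_ideal :: "('i \<Rightarrow> 'i \<Rightarrow> int) \<Rightarrow> ('i \<Rightarrow> nat) \<Rightarrow> 'i falg set" where
  "serre_ideal a d = genideal free_alg {serre a d i j |i j. i \<noteq> j}"

text \<open>\<open>U\<^sub>q\<^sup>-\<close> is presented by the generators \<open>f i\<close> and the quantum Serre relations, and the scalars are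
  embedded in it as multiples of the empty word. Its elements are the cosets \<open>Ucls a d x\<close>.\<close>

definition Uqm :: "('i \<Rightarrow> 'i \<Rightarrow> int) \<Rightarrow> ('i \<Rightarrow> nat) \<Rightarrow> 'i falg set ring" where
  "Uqm a d = free_alg Quot (serre_ideal a d)"

definition Ucls :: "('i \<Rightarrow> 'i \<Rightarrow> int) \<Rightarrow> ('i \<Rightarrow> nat) \<Rightarrow> 'i falg \<Rightarrow> 'i falg set" where
  "Ucls a d x = serre_ideal a d +>\<^bsub>free_alg\<^esub> x"

definition Uscale :: "('i \<Rightarrow> 'i \<Rightarrow> int) \<Rightarrow> ('i \<Rightarrow> nat) \<Rightarrow> qfield \<Rightarrow> 'i falg set \<Rightarrow> 'i falg set" where
  "Uscale a d c u = Ucls a d (Poly_Mapping.single [] c) \<otimes>\<^bsub>Uqm a d\<^esub> u"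

definition fdiv :: "('i \<Rightarrow> 'i \<Rightarrow> int) \<Rightarrow> ('i \<Rightarrow> nat) \<Rightarrow> 'i \<Rightarrow> nat \<Rightarrow> 'i falg set" where
  "fdiv a d i m = Ucls a d (Poly_Mapping.single (replicate m i) (1 / qfact d i m))"

text \<open>Kashiwara's operator \<open>e'\<^sub>i\<close>, determined by \<open>e'\<^sub>i 1 = 0\<close> and
  \<open>e'\<^sub>i (f j \<cdot> P) = \<delta>\<^sub>i\<^sub>j P + q\<^sub>i powi (- a i j) \<cdot> f j \<cdot> e'\<^sub>i P\<close>; it preserves the Serre ideal and so acts
  on the quotient.\<close>

fun eder_word :: "('i \<Rightarrow> 'i \<Rightarrow> int) \<Rightarrow> ('i \<Rightarrow> nat) \<Rightarrow> 'i \<Rightarrow> 'i list \<Rightarrow> 'i falg" where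
  "eder_word a d i [] = 0"
| "eder_word a d i (j # w) =
     (if i = j then Poly_Mapping.single w 1 else 0) +
     fmult (Poly_Mapping.single [j] (qi d i powi (- a i j))) (eder_word a d i w)"

definition eder_free :: "('i \<Rightarrow> 'i \<Rightarrow> int) \<Rightarrow> ('i \<Rightarrow> nat) \<Rightarrow> 'i \<Rightarrow> 'i falg \<Rightarrow> 'i falg" where
  "eder_free a d i x =
     (\<Sum>w\<in>Poly_Mapping.keys x.
        fmult (Poly_Mapping.single [] (Poly_Mapping.lookup x w)) (eder_word a d i w))"

definition eder :: "('i \<Rightarrow> 'i \<Rightarrow> int) \<Rightarrow> ('i \<Rightarrow> nat) \<Rightarrow> 'i \<Rightarrow> 'i falg set \<Rightarrow> 'i falg set" where
  "eder a d i u = (\<Union>x\<in>u. Ucls a d (eder_free a d i x))"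

section \<open>The crystal base \<open>B(\<infinity>)\<close> of \<open>U\<^sub>q\<^sup>-\<close>\<close>

text \<open>Every element \<open>u\<close> of \<open>U\<^sub>q\<^sup>-\<close> is uniquely a finite sum of terms \<open>f\<^sub>i\<^sup>(\<^sup>n\<^sup>) \<cdot> c n\<close> with
  \<open>e'\<^sub>i (c n) = 0\<close>; the Kashiwara operators shift the divided powers in this sum.\<close>

definition is_string_dec ::
  "('i \<Rightarrow> 'i \<Rightarrow> int) \<Rightarrow> ('i \<Rightarrow> nat) \<Rightarrow> 'i \<Rightarrow> 'i falg set \<Rightarrow> (nat \<Rightarrow> 'i falg set) \<Rightarrow> bool" where
  "is_string_dec a d i u c \<longleftrightarrow>
     (\<forall>n. c n \<in> carrier (Uqm a d) \<and> eder a d i (c n) = \<zero>\<^bsub>Uqm a d\<^esub>) \<and>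
     finite {n. c n \<noteq> \<zero>\<^bsub>Uqm a d\<^esub>} \<and>
     u = finsum (Uqm a d) (\<lambda>n. fdiv a d i n \<otimes>\<^bsub>Uqm a d\<^esub> c n) {n. c n \<noteq> \<zero>\<^bsub>Uqm a d\<^esub>}"

definition string_dec ::
  "('i \<Rightarrow> 'i \<Rightarrow> int) \<Rightarrow> ('i \<Rightarrow> nat) \<Rightarrow> 'i \<Rightarrow> 'i falg set \<Rightarrow> nat \<Rightarrow> 'i falg set" where
  "string_dec a d i u = (THE c. is_string_dec a d i u c)"

definition Uftil :: "('i \<Rightarrow> 'i \<Rightarrow> int) \<Rightarrow> ('i \<Rightarrow> nat) \<Rightarrow> 'i \<Rightarrow> 'i falg set \<Rightarrow> 'i falg set" where
  "Uftil a d i u = (let c = string_dec a d i u in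
     finsum (Uqm a d) (\<lambda>n. fdiv a d i (n + 1) \<otimes>\<^bsub>Uqm a d\<^esub> c n) {n. c n \<noteq> \<zero>\<^bsub>Uqm a d\<^esub>})"

definition Uetil :: "('i \<Rightarrow> 'i \<Rightarrow> int) \<Rightarrow> ('i \<Rightarrow> nat) \<Rightarrow> 'i \<Rightarrow> 'i falg set \<Rightarrow> 'i falg set" where
  "Uetil a d i u = (let c = string_dec a d i u in
     finsum (Uqm a d) (\<lambda>n. fdiv a d i (n - 1) \<otimes>\<^bsub>Uqm a d\<^esub> c n)
       {n. n \<ge> 1 \<and> c n \<noteq> \<zero>\<^bsub>Uqm a d\<^esub>})"

definition ftil_word :: "('i \<Rightarrow> 'i \<Rightarrow> int) \<Rightarrow> ('i \<Rightarrow> nat) \<Rightarrow> 'i list \<Rightarrow> 'i falg set" where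
  "ftil_word a d w = foldr (Uftil a d) w \<one>\<^bsub>Uqm a d\<^esub>"

text \<open>The lattice \<open>L(\<infinity>)\<close>: the span of all \<open>ftil_word a d w\<close> over the ring \<open>reg0\<close>.\<close>

inductive_set Linf :: "('i \<Rightarrow> 'i \<Rightarrow> int) \<Rightarrow> ('i \<Rightarrow> nat) \<Rightarrow> 'i falg set set"
  for a d where
  zero: "\<zero>\<^bsub>Uqm a d\<^esub> \<in> Linf a d"
| add: "u \<in> Linf a d \<Longrightarrow> c \<in> reg0 \<Longrightarrow>
        u \<oplus>\<^bsub>Uqm a d\<^esub> Uscale a d c (ftil_word a d w) \<in> Linf a d"

definition qLinf :: "('i \<Rightarrow> 'i \<Rightarrow> int) \<Rightarrow> ('i \<Rightarrow> nat) \<Rightarrow> 'i falg set set" where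
  "qLinf a d = Uscale a d qq ` Linf a d"

definition Lcls :: "('i \<Rightarrow> 'i \<Rightarrow> int) \<Rightarrow> ('i \<Rightarrow> nat) \<Rightarrow> 'i falg set \<Rightarrow> 'i falg set set" where
  "Lcls a d u = qLinf a d +>\<^bsub>Uqm a d\<^esub> u"

text \<open>Operators on \<open>L(\<infinity>) / q L(\<infinity>)\<close>, whose elements are the cosets \<open>Lcls a d u\<close> and whose zero
  element is \<open>qLinf a d\<close>.\<close>

definition Letil :: "('i \<Rightarrow> 'i \<Rightarrow> int) \<Rightarrow> ('i \<Rightarrow> nat) \<Rightarrow> 'i \<Rightarrow> 'i falg set set \<Rightarrow> 'i falg set set" where
  "Letil a d i b = (\<Union>u\<in>b. Lcls a d (Uetil a d i u))"

definition Lftil :: "('i \<Rightarrow> 'i \<Rightarrow> int) \<Rightarrow> ('i \<Rightarrow> nat) \<Rightarrow> 'i \<Rightarrow> 'i falg set set \<Rightarrow> 'i falg set set" where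
  "Lftil a d i b = (\<Union>u\<in>b. Lcls a d (Uftil a d i u))"

text \<open>The weight of a coset is that of a homogeneous representative in \<open>L(\<infinity>)\<close>; the generator
  \<open>f j\<close> has weight \<open>- \<alpha> j\<close>.\<close>

definition Lwt :: "('i \<Rightarrow> 'i \<Rightarrow> int) \<Rightarrow> ('i \<Rightarrow> nat) \<Rightarrow> 'i falg set set \<Rightarrow> 'i \<Rightarrow> int" where
  "Lwt a d b = (THE \<mu>. \<exists>x. (\<forall>w\<in>Poly_Mapping.keys x. \<forall>j. \<mu> j = - int (count_list w j)) \<and>
     Ucls a d x \<in> Linf a d \<and> b = Lcls a d (Ucls a d x))"

definition Leps :: "('i \<Rightarrow> 'i \<Rightarrow> int) \<Rightarrow> ('i \<Rightarrow> nat) \<Rightarrow> 'i \<Rightarrow> 'i falg set set \<Rightarrow> int" where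
  "Leps a d i b = int (Max {m. (Letil a d i ^^ m) b \<noteq> qLinf a d})"

definition uinf :: "('i \<Rightarrow> 'i \<Rightarrow> int) \<Rightarrow> ('i \<Rightarrow> nat) \<Rightarrow> 'i falg set set" where
  "uinf a d = Lcls a d \<one>\<^bsub>Uqm a d\<^esub>"

definition Binf :: "('i::finite \<Rightarrow> 'i \<Rightarrow> int) \<Rightarrow> ('i \<Rightarrow> nat) \<Rightarrow> ('i falg set set, 'i) crystal" where
  "Binf a d =
    \<lparr>elts = {Lcls a d (ftil_word a d w) |w. True} - {qLinf a d},
     wt = Lwt a d,
     eps = Leps a d,
     phi = (\<lambda>i b. Leps a d i b + coroot_pairing a i (Lwt a d b)),
     ee = (\<lambda>i b. if Letil a d i b = qLinf a d then None else Some (Letil a d i b)),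
     ff = (\<lambda>i b. if Lftil a d i b = qLinf a d then None else Some (Lftil a d i b))\<rparr>"

section \<open>Sequences\<close>

text \<open>A sequence \<open>\<iota> = (\<dots>, i\<^sub>2, i\<^sub>1)\<close> is a function on \<open>nat\<close> of which only the values at positive
  arguments matter.\<close>

definition index_sequence :: "(nat \<Rightarrow> 'i) \<Rightarrow> bool" where
  "index_sequence \<iota> \<longleftrightarrow> (\<forall>r\<ge>1. \<iota> r \<noteq> \<iota> (r + 1)) \<and> (\<forall>k. infinite {r. r \<ge> 1 \<and> \<iota> r = k})"

text \<open>The subsequence of \<open>\<iota>\<close> of all \<open>i\<close> and \<open>j\<close>, read from the right; its rightmost entry has
  index 0.\<close>

definition subseq2 :: "(nat \<Rightarrow> 'i) \<Rightarrow> 'i \<Rightarrow> 'i \<Rightarrow> nat \<Rightarrow> 'i" where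
  "subseq2 \<iota> i j m = \<iota> (enumerate {r. r \<ge> 1 \<and> \<iota> r \<in> {i, j}} m)"

definition adapted :: "('i \<Rightarrow> 'i \<Rightarrow> int) \<Rightarrow> (nat \<Rightarrow> 'i) \<Rightarrow> bool" where
  "adapted a \<iota> \<longleftrightarrow> (\<forall>i j. a i j < 0 \<longrightarrow>
     (\<forall>m. subseq2 \<iota> i j m = (if even m then j else i)) \<or>
     (\<forall>m. subseq2 \<iota> i j m = (if even m then i else j)))"

definition pnum :: "(nat \<Rightarrow> 'i) \<Rightarrow> 'i \<Rightarrow> 'i \<Rightarrow> int" where
  "pnum \<iota> i j = (if subseq2 \<iota> i j 0 = i then 1 else 0)"

definition pos :: "(nat \<Rightarrow> 'i) \<Rightarrow> nat \<Rightarrow> 'i \<Rightarrow> nat" where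
  "pos \<iota> s k = (THE r. r \<ge> 1 \<and> \<iota> r = k \<and> card {t. 1 \<le> t \<and> t \<le> r \<and> \<iota> t = k} = s)"

section \<open>The crystal \<open>\<int>\<^sup>\<infinity>\<^sub>\<iota>\<close>\<close>

text \<open>Entries are numbered from 1, so the unused entry at 0 is required to vanish.\<close>

definition Zinf :: "(nat \<Rightarrow>\<^sub>0 int) set" where
  "Zinf = {x. Poly_Mapping.lookup x 0 = 0}"

definition sig :: "('i \<Rightarrow> 'i \<Rightarrow> int) \<Rightarrow> (nat \<Rightarrow> 'i) \<Rightarrow> nat \<Rightarrow> (nat \<Rightarrow>\<^sub>0 int) \<Rightarrow> int" where
  "sig a \<iota> r x = Poly_Mapping.lookup x r
     + (\<Sum>j | j \<in> Poly_Mapping.keys x \<and> r < j. a (\<iota> r) (\<iota> j) * Poly_Mapping.lookup x j)"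

definition sigmax :: "('i \<Rightarrow> 'i \<Rightarrow> int) \<Rightarrow> (nat \<Rightarrow> 'i) \<Rightarrow> 'i \<Rightarrow> (nat \<Rightarrow>\<^sub>0 int) \<Rightarrow> int" where
  "sigmax a \<iota> i x = Max {sig a \<iota> r x |r. r \<ge> 1 \<and> \<iota> r = i}"

definition Mset :: "('i \<Rightarrow> 'i \<Rightarrow> int) \<Rightarrow> (nat \<Rightarrow> 'i) \<Rightarrow> 'i \<Rightarrow> (nat \<Rightarrow>\<^sub>0 int) \<Rightarrow> nat set" where
  "Mset a \<iota> i x = {r. r \<ge> 1 \<and> \<iota> r = i \<and> sig a \<iota> r x = sigmax a \<iota> i x}"

definition Zwt :: "(nat \<Rightarrow> 'i) \<Rightarrow> (nat \<Rightarrow>\<^sub>0 int) \<Rightarrow> 'i \<Rightarrow> int" where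
  "Zwt \<iota> x k = - (\<Sum>j | j \<in> Poly_Mapping.keys x \<and> \<iota> j = k. Poly_Mapping.lookup x j)"

text \<open>\<open>Mset a \<iota> i x\<close> may be infinite, but it is finite whenever its maximum is used.\<close>

definition Zcrystal :: "('i::finite \<Rightarrow> 'i \<Rightarrow> int) \<Rightarrow> (nat \<Rightarrow> 'i) \<Rightarrow> (nat \<Rightarrow>\<^sub>0 int, 'i) crystal" where
  "Zcrystal a \<iota> =
    \<lparr>elts = Zinf,
     wt = Zwt \<iota>,
     eps = sigmax a \<iota>,
     phi = (\<lambda>i x. sigmax a \<iota> i x + coroot_pairing a i (Zwt \<iota> x)),
     ee = (\<lambda>i x. if sigmax a \<iota> i x > 0
                  then Some (x - Poly_Mapping.single (Max (Mset a \<iota> i x)) 1) else None),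
     ff = (\<lambda>i x. Some (x + Poly_Mapping.single (LEAST r. r \<in> Mset a \<iota> i x) 1))\<rparr>"

section \<open>Linear forms\<close>

text \<open>The linear form \<open>\<Sum>r. c r \<cdot> x r\<close> is represented by its finitely supported coefficients.\<close>

type_synonym lform = "nat \<Rightarrow>\<^sub>0 rat"

definition lform_eval :: "lform \<Rightarrow> (nat \<Rightarrow>\<^sub>0 int) \<Rightarrow> rat" where
  "lform_eval \<phi> x = (\<Sum>r\<in>Poly_Mapping.keys \<phi>. Poly_Mapping.lookup \<phi> r * of_int (Poly_Mapping.lookup x r))"

definition xcoord :: "nat \<Rightarrow> lform" where
  "xcoord r = Poly_Mapping.single r 1"

definition succ_occ :: "(nat \<Rightarrow> 'i) \<Rightarrow> nat \<Rightarrow> nat" where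
  "succ_occ \<iota> r = (LEAST l. r < l \<and> \<iota> l = \<iota> r)"

definition pred_occ :: "(nat \<Rightarrow> 'i) \<Rightarrow> nat \<Rightarrow> nat" where
  "pred_occ \<iota> r = Max ({l. 1 \<le> l \<and> l < r \<and> \<iota> l = \<iota> r} \<union> {0})"

definition bform :: "('i \<Rightarrow> 'i \<Rightarrow> int) \<Rightarrow> (nat \<Rightarrow> 'i) \<Rightarrow> nat \<Rightarrow> lform" where
  "bform a \<iota> r = (if r = 0 then 0 else
     xcoord r
     + (\<Sum>j | r < j \<and> j < succ_occ \<iota> r. Poly_Mapping.single j (of_int (a (\<iota> r) (\<iota> j))))
     + xcoord (succ_occ \<iota> r))"

definition Sop :: "('i \<Rightarrow> 'i \<Rightarrow> int) \<Rightarrow> (nat \<Rightarrow> 'i) \<Rightarrow> nat \<Rightarrow> lform \<Rightarrow> lform" where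
  "Sop a \<iota> r \<phi> =
     (if Poly_Mapping.lookup \<phi> r > 0 then \<phi> - bform a \<iota> r
      else if Poly_Mapping.lookup \<phi> r < 0 then \<phi> + bform a \<iota> (pred_occ \<iota> r)
      else \<phi>)"

inductive_set Xi :: "('i \<Rightarrow> 'i \<Rightarrow> int) \<Rightarrow> (nat \<Rightarrow> 'i) \<Rightarrow> nat \<Rightarrow> 'i \<Rightarrow> lform set"
  for a \<iota> s k where
  base: "xcoord (pos \<iota> s k) \<in> Xi a \<iota> s k"
| step: "\<phi> \<in> Xi a \<iota> s k \<Longrightarrow> r \<ge> 1 \<Longrightarrow> Sop a \<iota> r \<phi> \<in> Xi a \<iota> s k"

inductive_set Xi_pos :: "('i \<Rightarrow> 'i \<Rightarrow> int) \<Rightarrow> (nat \<Rightarrow> 'i) \<Rightarrow> nat \<Rightarrow> 'i \<Rightarrow> lform set"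
  for a \<iota> s k where
  base: "xcoord (pos \<iota> s k) \<in> Xi_pos a \<iota> s k"
| step: "\<phi> \<in> Xi_pos a \<iota> s k \<Longrightarrow> r \<ge> 1 \<Longrightarrow> Poly_Mapping.lookup \<phi> r > 0 \<Longrightarrow>
         Sop a \<iota> r \<phi> \<in> Xi_pos a \<iota> s k"

section \<open>Monomials\<close>

text \<open>Laurent monomials in the variables \<open>X s i\<close> are represented by their exponents, so that
  multiplication of monomials becomes addition.\<close>

type_synonym 'i monomial = "(int \<times> 'i) \<Rightarrow>\<^sub>0 int"

definition Xvar :: "int \<Rightarrow> 'i \<Rightarrow> 'i monomial" where
  "Xvar s k = Poly_Mapping.single (s, k) 1"

definition psum :: "'i \<Rightarrow> 'i monomial \<Rightarrow> int \<Rightarrow> int" where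
  "psum i X s = (\<Sum>l | l \<le> s \<and> Poly_Mapping.lookup X (l, i) \<noteq> 0. Poly_Mapping.lookup X (l, i))"

definition mphi :: "'i \<Rightarrow> 'i monomial \<Rightarrow> int" where
  "mphi i X = Max (range (psum i X))"

definition nf :: "'i \<Rightarrow> 'i monomial \<Rightarrow> int" where
  "nf i X = (LEAST r. mphi i X = psum i X r)"

text \<open>The matrix \<open>b\<close> is the Cartan matrix of the algebra whose crystals are being realized.\<close>

definition Amon :: "('i::finite \<Rightarrow> 'i \<Rightarrow> int) \<Rightarrow> (nat \<Rightarrow> 'i) \<Rightarrow> int \<Rightarrow> 'i \<Rightarrow> 'i monomial" where
  "Amon b \<iota> s k = Xvar s k + Xvar (s + 1) k
     + (\<Sum>j | b j k < 0. Poly_Mapping.single (s + pnum \<iota> j k, j) (b j k))"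

definition mf :: "('i::finite \<Rightarrow> 'i \<Rightarrow> int) \<Rightarrow> (nat \<Rightarrow> 'i) \<Rightarrow> 'i \<Rightarrow> 'i monomial \<Rightarrow> 'i monomial option"
  where
  "mf b \<iota> i X = (if mphi i X > 0 then Some (X - Amon b \<iota> (nf i X) i) else None)"

inductive_set monomials ::
    "('i::finite \<Rightarrow> 'i \<Rightarrow> int) \<Rightarrow> (nat \<Rightarrow> 'i) \<Rightarrow> int \<Rightarrow> 'i \<Rightarrow> 'i monomial set"
  for b \<iota> s k where
  base: "Xvar s k \<in> monomials b \<iota> s k"
| step: "X \<in> monomials b \<iota> s k \<Longrightarrow> mf b \<iota> i X = Some Y \<Longrightarrow> Y \<in> monomials b \<iota> s k"

text \<open>Only meaningful for monomials in variables \<open>X s k\<close> with \<open>s \<ge> 1\<close>.\<close>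

definition Trop :: "(nat \<Rightarrow> 'i) \<Rightarrow> 'i monomial \<Rightarrow> lform" where
  "Trop \<iota> X = (\<Sum>(s, k)\<in>Poly_Mapping.keys X.
     Poly_Mapping.single (pos \<iota> (nat s) k) (of_int (Poly_Mapping.lookup X (s, k))))"

end

theory Submission
  imports Defs
begin

text \<open>
  The string decomposition in \<open>U\<^sub>q\<^sup>-\<close> is well defined, so the operators on
  \<open>L(\<infinity>) / q L(\<infinity>)\<close> send the class of a word to the class of the extended word, and the
  class of 1 is nonzero because the constant term of an element of \<open>L(\<infinity>)\<close> is regular at
  \<open>q = 0\<close>. A strict embedding therefore has as its image the set of all vectors obtained
  from 0 by the operators \<open>f i\<close> of \<open>\<int>\<^sup>\<infinity>\<^sub>\<iota>\<close>.

  That set is the polyhedral set cut out by \<open>Xi\<close>: the latter is stable under \<open>f i\<close> and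
  \<open>e i\<close>, because \<open>Xi\<close> is closed under \<open>Sop\<close> and \<open>bform\<close> evaluates to a difference of
  consecutive values of \<open>sig\<close>. Positivity of the coefficients at first occurrences is automatic when
  \<open>Xi_pos = Xi\<close>.

  Finally, a step of \<open>monomials\<close> tropicalizes to a positive action. Conversely, write an element of
  \<open>Xi_pos\<close> as \<open>x\<^sub>s\<^sub>k - \<Sum> m\<^sub>r \<beta>\<^sub>r\<close> with \<open>m\<^sub>r \<ge> 0\<close>. The top index \<open>r\<close> of
  \<open>m \<noteq> 0\<close> produces a trailing negative coefficient, so the corresponding monomial is
  \<open>f i Y\<close> for a monomial \<open>Y\<close> obtained by a negative action; the hypothesis
  keeps \<open>Y\<close> in \<open>Xi_pos\<close>, and induction on \<open>\<Sum> m\<^sub>r\<close> applies.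
\<close>

section \<open>The algebra and its crystal lattice\<close>

text \<open>The algebraic half is shaped by two facts. \<open>string_dec\<close> is a definite
  description and the operators on L / q L are unions over cosets, so existence, uniqueness and
  independence of representatives have to be established; all three rest on e'_i preserving the
  Serre ideal. On the other hand, nonvanishing is proved in the algebra for the class of 1 alone:
  the operators f i of the target crystal never return \<open>None\<close>, so strictness carries
  nonvanishing to every word.

  The two combinatorial descriptions meet in one identity: A_{t,k} of the dual algebra tropicalizes
  to the \<beta> of occurrence t of k. Adaptedness puts exactly one occurrence of each neighbour j
  between two consecutive occurrences of k, p_{j,k} is the shift of its number, and the
  transposition of the matrix produces the coefficient a k j.

  The hypothesis on \<open>Xi_pos\<close> works twice: it excludes negative coefficients at first
  occurrences, where no predecessor could compensate for them, and it makes the positive monomials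
  stable under negative actions.\<close>

instantiation list :: (type) monoid_add
begin
definition zero_list :: "'a list" where "zero_list = []"
definition plus_list :: "'a list \<Rightarrow> 'a list \<Rightarrow> 'a list" where "plus_list = (@)"
instance by standard (auto simp: zero_list_def plus_list_def)
end

lemma poly_mapping_eq_sum_single:
  fixes x :: "'a \<Rightarrow>\<^sub>0 'b::comm_monoid_add"
  shows "x = (\<Sum>w\<in>Poly_Mapping.keys x. Poly_Mapping.single w (Poly_Mapping.lookup x w))"
  by (rule poly_mapping_eqI)
     (auto simp: lookup_sum lookup_single when_def sum.delta in_keys_iff)

lemma poly_mapping_single_induct [case_names single add]:
  fixes x :: "'a \<Rightarrow>\<^sub>0 'b::comm_monoid_add"
  assumes "\<And>w c. P (Poly_Mapping.single w c)" "\<And>x y. P x \<Longrightarrow> P y \<Longrightarrow> P (x + y)"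
  shows "P x"
proof -
  have z: "P 0" using assms(1)[of undefined 0] by simp
  have "P (\<Sum>w\<in>A. Poly_Mapping.single w (Poly_Mapping.lookup x w))" for A
    by (induction A rule: infinite_finite_induct) (auto intro: assms z)
  then show ?thesis by (subst poly_mapping_eq_sum_single) 
qed

subsection \<open>The free algebra as a ring\<close>

text \<open>With concatenation as the addition of lists, the convolution product of
  \<open>poly_mapping\<close> is the product of the free algebra. Computations can then use type
  class arithmetic, while the HOL-Algebra record serves for ideals and quotients.\<close>

lemma fmult_eq_times: "fmult x y = x * y"
proof -
  have "x * y = (\<Sum>u\<in>Poly_Mapping.keys x. Poly_Mapping.single u (Poly_Mapping.lookup x u)) *
     (\<Sum>v\<in>Poly_Mapping.keys y. Poly_Mapping.single v (Poly_Mapping.lookup y v))"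
    using poly_mapping_eq_sum_single[of x] poly_mapping_eq_sum_single[of y] by simp
  also have "\<dots> = fmult x y"
    by (simp add: fmult_def sum_product mult_single plus_list_def)
  finally show ?thesis by simp
qed

definition fscal :: "qfield \<Rightarrow> 'i falg" where "fscal c = Poly_Mapping.single [] c"

lemma fscal_0 [simp]: "fscal 0 = 0" by (simp add: fscal_def)
lemma fscal_1 [simp]: "fscal 1 = 1" by (simp add: fscal_def flip: zero_list_def)
lemma fscal_add: "fscal (b + c) = fscal b + fscal c" by (simp add: fscal_def single_add)
lemma fscal_mult: "fscal (b * c) = fscal b * fscal c"
  by (simp add: fscal_def mult_single plus_list_def)
lemma fscal_uminus: "fscal (- c) = - fscal c" by (simp add: fscal_def single_uminus)
lemma fscal_sum: "fscal (sum g A) = (\<Sum>x\<in>A. fscal (g x))"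
  by (induction A rule: infinite_finite_induct) (auto simp: fscal_add)
lemma fscal_single [simp]: "fscal b * Poly_Mapping.single w c = Poly_Mapping.single w (b * c)"
  by (simp add: fscal_def mult_single plus_list_def)

lemma fscal_commute: "x * fscal c = fscal c * (x :: 'i falg)"
  by (induction x rule: poly_mapping_single_induct)
     (simp_all add: fscal_def mult_single plus_list_def mult.commute distrib_left distrib_right)

lemma fscal_left_commute: "x * (fscal c * y) = fscal c * (x * (y :: 'i falg))"
  by (metis fscal_commute mult.assoc)

lemma fscal_fscal: "fscal b * (fscal c * (y :: 'i falg)) = fscal (b * c) * y"
  by (simp add: fscal_mult mult.assoc)

lemma free_alg_simps [simp]:
  "carrier free_alg = UNIV" "mult free_alg = (*)" "one free_alg = 1" "zero free_alg = 0"
  "add free_alg = (+)"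
  by (auto simp: free_alg_def fmult_eq_times fun_eq_iff zero_list_def[symmetric])

lemma ring_free_alg: "ring free_alg"
proof (rule ringI)
  show "abelian_group free_alg"
    by (rule abelian_groupI) (auto simp: add.assoc add.commute intro: exI[of _ "- x" for x] 
        left_minus)
  show "Group.monoid free_alg"
    by (rule Group.monoidI) (auto simp: mult.assoc)
qed (auto simp: distrib_left distrib_right)

text \<open>Linear extension from words, with scalars acting through the central elements
  \<open>fscal c\<close>. Both e'_i and its twisting automorphism have this form, so additivity and
  scaling are proved once for both.\<close>

definition lext :: "('i list \<Rightarrow> 'i falg) \<Rightarrow> 'i falg \<Rightarrow> 'i falg" where
  "lext g x = (\<Sum>w\<in>Poly_Mapping.keys x. fscal (Poly_Mapping.lookup x w) * g w)"

lemma lext_superset: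
  assumes "finite A" "Poly_Mapping.keys x \<subseteq> A"
  shows "lext g x = (\<Sum>w\<in>A. fscal (Poly_Mapping.lookup x w) * g w)"
  unfolding lext_def by (rule sum.mono_neutral_left) (use assms in \<open>auto simp: in_keys_iff\<close>)

lemma lext_single [simp]: "lext g (Poly_Mapping.single w c) = fscal c * g w"
  by (subst lext_superset[of "{w}"]) auto

lemma lext_0 [simp]: "lext g 0 = 0" by (simp add: lext_def)

lemma lext_add: "lext g (x + y) = lext g x + lext g y"
proof -
  let ?A = "Poly_Mapping.keys x \<union> Poly_Mapping.keys y"
  have "Poly_Mapping.keys (x + y) \<subseteq> ?A" by (rule Poly_Mapping.keys_add)
  then show ?thesis
    by (subst (1 2 3) lext_superset[of ?A])
       (auto simp: lookup_add fscal_add distrib_right sum.distrib)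
qed

lemma lext_scal: "lext g (fscal c * x) = fscal c * lext g x"
  by (induction x rule: poly_mapping_single_induct)
     (simp_all add: distrib_left lext_add fscal_mult mult.assoc)

lemma lext_uminus: "lext g (- x) = - lext g x"
  using lext_scal[of g "-1" x] by (simp add: fscal_uminus)

lemma lext_diff: "lext g (x - y) = lext g x - lext g y"
  using lext_add[of g x "- y"] by (simp add: lext_uminus)

lemma lext_sum: "lext g (sum h A) = (\<Sum>x\<in>A. lext g (h x))"
  by (induction A rule: infinite_finite_induct) (auto simp: lext_add)

subsection \<open>Quantum integers\<close>

lemma qq_power: "qq ^ n = Fract (monom 1 n) 1"
  by (induction n) (simp_all add: One_fract_def qq_def monom_Suc one_pCons[symmetric] monom_0 mult.commute)

lemma qq_power_eq_1_iff: "qq ^ n = 1 \<longleftrightarrow> n = 0"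
  by (auto simp: qq_power One_fract_def eq_fract monom_eq_1_iff)

lemma qq_neq_0 [simp]: "qq \<noteq> 0"
  by (simp add: qq_def Zero_fract_def eq_fract)

definition qnum :: "qfield \<Rightarrow> nat \<Rightarrow> qfield" where
  "qnum v m = (v ^ m - inverse v ^ m) / (v - inverse v)"

definition qfac :: "qfield \<Rightarrow> nat \<Rightarrow> qfield" where
  "qfac v m = (\<Prod>k=1..m. qnum v k)"

lemma qfact_eq_qfac: "qfact d i m = qfac (qi d i) m"
  by (simp add: qfact_def qfac_def qint_def qnum_def)

text \<open>What the identities below use of q_i: it is a nonzero scalar of infinite multiplicative
  order, so no quantum factorial vanishes.\<close>

definition nonroot :: "qfield \<Rightarrow> bool" where
  "nonroot v \<longleftrightarrow> v \<noteq> 0 \<and> (\<forall>n>0. v ^ n \<noteq> 1)"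

lemma nonroot_qi: "d i > 0 \<Longrightarrow> nonroot (qi d i)"
  by (auto simp: nonroot_def qi_def power_mult[symmetric] qq_power_eq_1_iff)

lemma qnum_neq_0:
  assumes "nonroot v" "m > 0" shows "qnum v m \<noteq> 0"
proof -
  have v: "v \<noteq> 0" using assms by (simp add: nonroot_def)
  have "v ^ n \<noteq> inverse v ^ n" if "n > 0" for n
  proof
    assume "v ^ n = inverse v ^ n"
    then have "v ^ (n + n) = 1" using v by (simp add: power_add field_simps)
    then show False using assms(1) that by (auto simp: nonroot_def)
  qed
  from this[OF assms(2)] this[of 1] show ?thesis by (simp add: qnum_def)
qed

lemma qfac_0 [simp]: "qfac v 0 = 1" by (simp add: qfac_def)
lemma qfac_Suc: "qfac v (Suc m) = qnum v (Suc m) * qfac v m"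
  by (simp add: qfac_def mult.commute)

lemma qfac_neq_0: "nonroot v \<Longrightarrow> qfac v m \<noteq> 0"
  by (auto simp: qfac_def qnum_neq_0)

text \<open>Passing e'_i through a factor f_i costs q_i^(-2), so the coefficient of f_i^n in e'_i
  f_i^(n+1) arises as this geometric sum; the right-hand side matches it with
  \<open>qfac\<close>.\<close>

lemma qnum_Suc_eq_sum:
  assumes "nonroot v"
  shows "(\<Sum>k<Suc n. (inverse v ^ 2) ^ k) = inverse v ^ n * qnum v (Suc n)"
proof -
  have v: "v \<noteq> 0" using assms by (simp add: nonroot_def)
  have n1: "v ^ 2 \<noteq> 1" using assms by (simp add: nonroot_def)
  then have n2: "v - inverse v \<noteq> 0" using v by (auto simp: power2_eq_square field_simps)
  show ?thesis
  proof (induction n)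
    case 0
    then show ?case using n2 by (simp add: qnum_def)
  next
    case (Suc n)
    have "(\<Sum>k<Suc (Suc n). (inverse v ^ 2) ^ k)
       = inverse v ^ n * qnum v (Suc n) + (inverse v ^ 2) ^ Suc n" using Suc by simp
    also have "\<dots> = inverse v ^ Suc n * qnum v (Suc (Suc n))"
      using v n2 unfolding qnum_def by (simp add: field_simps power2_eq_square power_mult_distrib)
    finally show ?case .
  qed
qed

text \<open>Up to the common factor 1 / [b]!, a q-analogue of the fact that the alternating binomial
  coefficients of b, summed up to m, give (-1)^m times the binomial coefficient of b - 1 over m. A
  closed form for every m is what makes induction possible.\<close>

lemma qbinomial_partial_sum:
  assumes v: "nonroot v" and "m < b"
  shows "(\<Sum>k\<le>m. (-1) ^ k * v ^ (k * (b - 1)) / (qfac v k * qfac v (b - k)))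
    = (-1) ^ m * v ^ (m * b) / (qfac v m * qfac v (b - 1 - m) * qnum v b)"
  using assms(2)
proof (induction m)
  case 0
  then obtain c where "b = Suc c" by (cases b) auto
  then show ?case by (simp add: qfac_Suc mult.commute)
next
  case (Suc m)
  define c where "c = b - 2 - m"
  have b: "b = Suc (Suc (m + c))" using Suc.prems by (simp add: c_def)
  have v0: "v \<noteq> 0" using v by (simp add: nonroot_def)
  have n1: "v ^ 2 \<noteq> 1" using v by (simp add: nonroot_def)
  then have n2: "v - inverse v \<noteq> 0" using v0 by (auto simp: power2_eq_square field_simps)
  note nz = qfac_neq_0[OF v] qnum_neq_0[OF v]
  \<comment> \<open>The addition rule [x + y] = v^(-y) [x] + v^x [y] for x = m + 1 and y = c + 1,
    multiplied by v^y.\<close>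
  have key: "v ^ Suc c * qnum v b - qnum v (Suc m) = v ^ b * qnum v (Suc c)"
  proof -
    define P Q where "P = v ^ Suc c" and "Q = v ^ Suc m"
    have PQ: "v ^ b = P * Q" "P \<noteq> 0" "Q \<noteq> 0"
      using v0 by (simp_all add: P_def Q_def b power_add)
    have "P * (P * Q - 1 / (P * Q)) - (Q - 1 / Q) = P * Q * (P - 1 / P)"
      using PQ by (simp add: field_simps)
    moreover have "inverse v ^ n = 1 / v ^ n" for n by (simp add: field_simps)
    ultimately show ?thesis
      using n2 PQ by (simp add: qnum_def P_def[symmetric] Q_def[symmetric]
          diff_divide_distrib[symmetric] del: power_Suc)
  qed
  have e: "b - 1 - m = Suc c" "b - 1 - Suc m = c" "b - Suc m = Suc c" "b - Suc 0 = Suc (m + c)"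
    using b by auto
  define A where "A = (-1) ^ m * v ^ (m * b) / (qfac v (Suc m) * qfac v (Suc c) * qnum v b)"
  have p: "Suc m * Suc (m + c) = m * b + Suc c" using b by simp
  have "(\<Sum>k\<le>Suc m. (-1) ^ k * v ^ (k * (b - 1)) / (qfac v k * qfac v (b - k)))
     = (-1) ^ m * v ^ (m * b) / (qfac v m * qfac v (Suc c) * qnum v b)
       + (-1) ^ Suc m * v ^ (Suc m * Suc (m + c)) / (qfac v (Suc m) * qfac v (Suc c))"
    using Suc by (simp add: e del: mult_Suc mult_Suc_right power_Suc)
  also have "\<dots> = A * qnum v (Suc m) - A * (v ^ Suc c * qnum v b)"
  proof -
    have "X / (F * G * Q) = X / (N * F * G * Q) * N" if "N \<noteq> 0" for X F G Q N :: qfield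
      using that by simp
    moreover have "(-1) ^ Suc m * (V * P) / (F * G) = - ((-1) ^ m * V / (F * G * Q) * (P * Q))"
      if "Q \<noteq> 0" for V P F G Q :: qfield
      using that by simp
    ultimately show ?thesis
      unfolding p power_add A_def qfac_Suc[of v m] using nz(2)[of "Suc m"] nz(2)[of b] b
      by (simp del: power_Suc)
  qed
  also have "\<dots> = - A * (v ^ b * qnum v (Suc c))" using key by (simp add: algebra_simps)
  also have "\<dots> = (-1) ^ Suc m * v ^ (Suc m * b) / (qfac v (Suc m) * qfac v c * qnum v b)"
    unfolding A_def using nz(1)[of c] nz(2)[of "Suc c"]
    by (simp add: qfac_Suc[of v c] power_add power_Suc[of "-1" m] divide_simps mult_ac del: power_Suc)
  finally show ?case by (simp add: e)
qed

text \<open>The partial sum up to b - 1 is the negative of the last summand. The vanishing is what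
  annihilates a Serre element under e'_j.\<close>

lemma qbinomial_alternating_sum:
  assumes v: "nonroot v" and "b > 0"
  shows "(\<Sum>k\<le>b. (-1) ^ k * v ^ (k * (b - 1)) / (qfac v k * qfac v (b - k))) = 0"
proof -
  obtain c where b: "b = Suc c" using assms by (cases b) auto
  show ?thesis using qbinomial_partial_sum[OF v, of c b]
    by (simp add: b qfac_Suc mult.commute)
qed

definition fgen :: "'i \<Rightarrow> 'i falg" where "fgen i = Poly_Mapping.single [i] 1"

lemma single_Nil_1 [simp]: "Poly_Mapping.single [] 1 = (1 :: 'i falg)"
  by (simp flip: zero_list_def)

lemma single_Cons: "Poly_Mapping.single (j # w) c = fgen j * (Poly_Mapping.single w c :: 'i falg)"
  by (simp add: fgen_def mult_single plus_list_def)

lemma single_append: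
  "Poly_Mapping.single (u @ w) (b * c) = Poly_Mapping.single u b * (Poly_Mapping.single w c :: 'i falg)"
  by (simp add: mult_single plus_list_def)

lemma single_eq_scal: "Poly_Mapping.single w c = fscal c * (Poly_Mapping.single w 1 :: 'i falg)"
  by simp

lemma fgen_fscal: "fgen j * (fscal c * y) = fscal c * (fgen j * y)"
  by (rule fscal_left_commute)

lemma fgen_power_fscal: "fgen j ^ n * (fscal c * y) = fscal c * (fgen j ^ n * y)"
  by (rule fscal_left_commute)

lemmas fscal_simps = fgen_fscal fgen_power_fscal fscal_fscal mult.assoc

lemma single_replicate: "Poly_Mapping.single (replicate n i) 1 = (fgen i ^ n :: 'i falg)"
  by (induction n) (simp_all add: single_Cons)

lemma fscal_mult_power: "(fscal c * x) ^ n = fscal (c ^ n) * (x :: 'i falg) ^ n"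
proof (induction n)
  case (Suc n)
  have "(fscal c * x) ^ Suc n = fscal c * (x * (fscal (c ^ n) * x ^ n))"
    by (simp add: Suc mult.assoc)
  also have "\<dots> = fscal (c ^ Suc n) * x ^ Suc n"
    by (simp add: fscal_left_commute[of x] fscal_fscal)
  finally show ?case .
qed simp

lemma ideal_free_algI:
  assumes "0 \<in> K" "\<And>x y. x \<in> K \<Longrightarrow> y \<in> K \<Longrightarrow> x + y \<in> K"
    "\<And>x y. x \<in> K \<Longrightarrow> y * x \<in> K" "\<And>x y. x \<in> K \<Longrightarrow> x * y \<in> K"
  shows "ideal K (free_alg :: 'i falg ring)"
proof (rule idealI[OF ring_free_alg])
  have n: "- x \<in> K" if "x \<in> K" for x using assms(3)[OF that, of "-1"] by simp
  have inv: "inv\<^bsub>add_monoid free_alg\<^esub> x = - x" for x :: "'i falg"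
  proof -
    interpret A: abelian_group "free_alg :: 'i falg ring"
      using ring_free_alg ring.is_abelian_group by blast
    have "\<ominus>\<^bsub>free_alg\<^esub> x = - x" by (rule A.minus_equality) auto
    then show ?thesis by (simp add: a_inv_def)
  qed
  show "subgroup K (add_monoid free_alg)"
    by (rule subgroup.intro) (use assms n inv in auto)
qed (use assms in auto)

section \<open>Kashiwara's skew derivations on the free algebra\<close>

locale cartan_datum =
  fixes a :: "'i \<Rightarrow> 'i \<Rightarrow> int" and d :: "'i \<Rightarrow> nat"
  assumes gcm: "gen_cartan_matrix a" and sym: "symmetrizer a d"
begin

abbreviation E :: "'i \<Rightarrow> 'i falg \<Rightarrow> 'i falg" where "E \<equiv> eder_free a d"
abbreviation J :: "'i falg set" where "J \<equiv> serre_ideal a d"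
abbreviation qv :: "'i \<Rightarrow> qfield" where "qv \<equiv> qi d"

definition qpair :: "'i \<Rightarrow> 'i \<Rightarrow> qfield" where "qpair i j = qv i powi (- a i j)"

text \<open>The diagonal automorphism that arises when e'_i passes a whole word: a word of weight
  -\<mu> is multiplied by q to the power -(\<alpha> i, \<mu>).\<close>

definition twist :: "'i \<Rightarrow> 'i falg \<Rightarrow> 'i falg" where
  "twist i = lext (\<lambda>w. Poly_Mapping.single w (\<Prod>j\<leftarrow>w. qpair i j))"

lemma nonroot_qv: "nonroot (qv i)"
  using sym by (intro nonroot_qi) (simp add: symmetrizer_def)

lemma E_eq_lext: "E i = lext (eder_word a d i)"
  by (rule ext) (simp add: eder_free_def lext_def fmult_eq_times fscal_def)

lemmas E_0 [simp] = lext_0[of "eder_word a d i" for i, folded E_eq_lext]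
lemmas E_add = lext_add[of "eder_word a d i" for i, folded E_eq_lext]
lemmas E_diff = lext_diff[of "eder_word a d i" for i, folded E_eq_lext]
lemmas E_scal = lext_scal[of "eder_word a d i" for i, folded E_eq_lext]
lemmas E_sum = lext_sum[of "eder_word a d i" for i, folded E_eq_lext]
lemmas twist_add = lext_add[of "\<lambda>w. Poly_Mapping.single w (\<Prod>j\<leftarrow>w. qpair i j)" for i, folded twist_def]
lemmas twist_scal = lext_scal[of "\<lambda>w. Poly_Mapping.single w (\<Prod>j\<leftarrow>w. qpair i j)" for i, folded twist_def]
lemmas twist_sum = lext_sum[of "\<lambda>w. Poly_Mapping.single w (\<Prod>j\<leftarrow>w. qpair i j)" for i, folded twist_def]

lemma E_1 [simp]: "E i 1 = 0"
  unfolding E_eq_lext using lext_single[of "eder_word a d i" "[]" 1] by simp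

lemma E_gen_mult:
  "E i (fgen j * x) = (if i = j then x else 0) + fscal (qpair i j) * (fgen j * E i x)"
proof (induction x rule: poly_mapping_single_induct)
  case (single w c)
  have "E i (fgen j * Poly_Mapping.single w c) = fscal c * eder_word a d i (j # w)"
    by (simp add: E_eq_lext flip: single_Cons)
  also have "eder_word a d i (j # w) = (if i = j then Poly_Mapping.single w 1 else 0) +
    fscal (qpair i j) * (fgen j * eder_word a d i w)"
    by (simp add: fmult_eq_times qpair_def fgen_def flip: mult.assoc)
  finally show ?case
    by (simp add: E_eq_lext distrib_left fscal_simps)
       (simp add: mult.commute)
qed (auto simp: E_add distrib_left)

lemma E_gen: "E i (fgen j) = (if i = j then 1 else 0)"
  using E_gen_mult[of i j 1] by simp

lemma twist_single [simp]:
  "twist i (Poly_Mapping.single w c) = Poly_Mapping.single w (c * (\<Prod>j\<leftarrow>w. qpair i j))"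
  by (simp add: twist_def)

lemma twist_1 [simp]: "twist i 1 = 1"
  using twist_single[of i "[]" 1] by simp

lemma twist_gen [simp]: "twist i (fgen j) = fscal (qpair i j) * fgen j"
  by (simp add: fgen_def)

lemma twist_mult: "twist i (x * y) = twist i x * twist i y"
proof (induction x rule: poly_mapping_single_induct)
  case (single w c)
  show ?case
  proof (induction y rule: poly_mapping_single_induct)
    case (single u b)
    then show ?case by (simp add: mult_single plus_list_def mult_ac)
  qed (simp add: twist_add distrib_left)
qed (simp add: twist_add distrib_right)

lemma twist_power: "twist i (x ^ n) = twist i x ^ n"
  by (induction n) (simp_all add: twist_mult)

text \<open>The skew Leibniz rule, by induction on the word of the left factor. It reduces the
  stability of the Serre ideal to its generators.\<close>

lemma E_mult: "E i (x * y) = E i x * y + twist i x * E i y"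
proof (induction x rule: poly_mapping_single_induct)
  case (single w c)
  have "E i (Poly_Mapping.single w 1 * y) =
      E i (Poly_Mapping.single w 1) * y + twist i (Poly_Mapping.single w 1) * E i y"
  proof (induction w)
    case Nil
    then show ?case by simp
  next
    case (Cons j w)
    have t: "twist i (Poly_Mapping.single (j # w) 1)
       = fscal (qpair i j) * (fgen j * twist i (Poly_Mapping.single w 1))"
      by (simp add: single_Cons twist_mult mult.assoc)
    show ?case unfolding t unfolding single_Cons
      by (simp add: mult.assoc E_gen_mult Cons.IH distrib_left distrib_right)
  qed
  then show ?case
    by (subst (1 2 3) single_eq_scal)
       (simp add: E_scal twist_scal mult.assoc distrib_left del: fscal_single)
qed (auto simp: E_add twist_add distrib_right algebra_simps)

lemma qpair_self: "qpair i i = (inverse (qv i))\<^sup>2"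
  using gcm by (simp add: qpair_def gen_cartan_matrix_def power_int_minus power_inverse)

definition qsum :: "'i \<Rightarrow> nat \<Rightarrow> qfield" where
  "qsum i n = (\<Sum>k<n. ((inverse (qv i))\<^sup>2) ^ k)"

lemma qsum_Suc: "qsum i (Suc n) = inverse (qv i) ^ n * qnum (qv i) (Suc n)"
  unfolding qsum_def by (rule qnum_Suc_eq_sum[OF nonroot_qv])

lemma qv_neq_0 [simp]: "qv i \<noteq> 0"
  using nonroot_qv[of i] by (simp add: nonroot_def)

lemma qsum_Suc_neq_0: "qsum i (Suc n) \<noteq> 0"
  by (simp add: qsum_Suc qnum_neq_0 nonroot_qv)

lemma E_gen_power_mult:
  "E i (fgen i ^ Suc n * x) = fscal (qsum i (Suc n)) * (fgen i ^ n * x)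
     + fscal (((inverse (qv i))\<^sup>2) ^ Suc n) * (fgen i ^ Suc n * E i x)"
proof (induction n)
  case 0
  then show ?case by (simp add: E_gen_mult qpair_self qsum_def)
next
  case (Suc n)
  let ?w = "(inverse (qv i))\<^sup>2"
  have "qsum i (Suc (Suc n)) = 1 + ?w * qsum i (Suc n)"
    unfolding qsum_def by (subst sum.lessThan_Suc_shift) (simp add: sum_distrib_left distrib_left)
  then have *: "fscal (qsum i (Suc (Suc n))) = 1 + fscal (?w * qsum i (Suc n))"
    by (simp add: fscal_add)
  show ?case
    by (subst power_Suc, simp only: mult.assoc E_gen_mult Suc.IH qpair_self *)
       (simp add: distrib_left distrib_right fscal_simps add.assoc)
qed

lemma E_other_power_mult:
  assumes "i \<noteq> j"
  shows "E j (fgen i ^ n * x) = fscal (qpair j i ^ n) * (fgen i ^ n * E j x)"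
  using assms by (induction n)
    (simp_all add: mult.assoc E_gen_mult fscal_simps mult.commute)

subsection \<open>The Serre ideal\<close>

lemma ideal_J: "ideal J free_alg"
  unfolding serre_ideal_def by (rule ring.genideal_ideal[OF ring_free_alg]) simp

lemma J_add: "x \<in> J \<Longrightarrow> y \<in> J \<Longrightarrow> x + y \<in> J"
  using additive_subgroup.a_closed[OF ideal.axioms(1)[OF ideal_J]] by simp

lemma J_0 [simp]: "0 \<in> J"
  using additive_subgroup.zero_closed[OF ideal.axioms(1)[OF ideal_J]] by simp

lemma J_left: "x \<in> J \<Longrightarrow> y * x \<in> J" using ideal.I_l_closed[OF ideal_J] by simp
lemma J_right: "x \<in> J \<Longrightarrow> x * y \<in> J" using ideal.I_r_closed[OF ideal_J] by simp

lemma J_uminus: "x \<in> J \<Longrightarrow> - x \<in> J" using J_left[of x "-1"] by simp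
lemma J_diff: "x \<in> J \<Longrightarrow> y \<in> J \<Longrightarrow> x - y \<in> J" using J_add[of x "-y"] J_uminus by simp

lemma J_sum: "(\<And>k. k \<in> A \<Longrightarrow> g k \<in> J) \<Longrightarrow> sum g A \<in> J"
  by (induction A rule: infinite_finite_induct) (auto intro: J_add)

lemma serre_in_J: "i \<noteq> j \<Longrightarrow> serre a d i j \<in> J"
  unfolding serre_ideal_def using ring.genideal_self[OF ring_free_alg] by fastforce

lemma serre_eq:
  assumes "b = nat (1 - a i j)"
  shows "serre a d i j = (\<Sum>k\<le>b. fscal ((-1) ^ k / (qfac (qv i) k * qfac (qv i) (b - k))) *
     (fgen i ^ k * (fgen j * fgen i ^ (b - k))))"
proof -
  have "Poly_Mapping.single (replicate k i @ [j] @ replicate m i) c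
     = fscal c * (fgen i ^ k * (fgen j * fgen i ^ m))" for k m c
    by (subst single_eq_scal)
      (simp add: single_append[of _ _ 1 1, simplified] single_Cons single_replicate del: fscal_single)
  then show ?thesis by (simp add: serre_def Let_def qfact_eq_qfac assms)
qed

text \<open>A Serre element is homogeneous: every summand contains b letters i and one letter j, so
  the automorphism acts on it by a scalar.\<close>

lemma twist_serre:
  "twist l (serre a d i j) = fscal (qpair l i ^ nat (1 - a i j) * qpair l j) * serre a d i j"
proof -
  define b where "b = nat (1 - a i j)"
  have "twist l (fgen i ^ k * (fgen j * fgen i ^ (b - k)))
     = fscal (qpair l i ^ b * qpair l j) * (fgen i ^ k * (fgen j * fgen i ^ (b - k)))" if "k \<le> b" for k
  proof -
    have "qpair l i ^ b = qpair l i ^ k * qpair l i ^ (b - k)"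
      using that by (simp flip: power_add)
    then show ?thesis
      by (simp add: twist_mult twist_power fscal_mult_power fscal_simps mult_ac(2,3))
  qed
  then show ?thesis unfolding serre_eq[OF b_def] b_def[symmetric]
    by (simp add: twist_sum twist_scal sum_distrib_left fscal_fscal mult.commute)
qed

text \<open>Only l = j and l = i can contribute. For l = j all summands become multiples of f_i^b,
  and the total coefficient is the alternating quantum binomial sum. For l = i the derivation hits
  the left or the right power of f_i, and after a shift of k the two contributions cancel
  termwise.\<close>

lemma E_serre: "i \<noteq> j \<Longrightarrow> E l (serre a d i j) = 0"
proof -
  assume ij: "i \<noteq> j"
  define b where "b = nat (1 - a i j)"
  define v where "v = qv i"
  have aij: "a i j \<le> 0" using gcm ij by (simp add: gen_cartan_matrix_def)
  then obtain c where b: "b = Suc c" "- a i j = int c" unfolding b_def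
    by (metis Suc_nat_eq_nat_zadd1 add.commute diff_conv_add_uminus nat_0_le neg_0_le_iff_le)
  define e where "e k = (-1) ^ k / (qfac v k * qfac v (b - k))" for k
  have S: "E l (serre a d i j) = (\<Sum>k\<le>b. fscal (e k) * E l (fgen i ^ k * (fgen j * fgen i ^ (b - k))))"
    by (simp add: serre_eq[OF b_def] E_sum E_scal e_def v_def)
  have Ei: "E m (fgen i ^ k) = 0" if "m \<noteq> i" for m k
    using E_other_power_mult[of i m k 1] that by simp
  have nv: "nonroot v" by (simp add: v_def nonroot_qv)
  then have v0: "v \<noteq> 0" by (simp add: nonroot_def)
  consider "l \<noteq> i" "l \<noteq> j" | "l = j" | "l = i" by auto
  then show ?thesis
  proof cases
    case 1
    then show ?thesis by (simp add: S E_other_power_mult E_gen_mult Ei)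
  next
    case 2
    \<comment> \<open>Symmetrizability turns q_j^(-a j i) into q_i^(-a i j), which is the base
      required by the alternating sum.\<close>
    have q: "qpair j i = v ^ c"
    proof -
      have "a i j = - int c" using b(2) by simp
      moreover have "int (d i) * a i j = int (d j) * a j i"
        using sym by (simp add: symmetrizer_def)
      ultimately have "int (d j) * (- a j i) = int (d i * c)" by simp
      moreover have aji: "- a j i \<ge> 0" using gcm ij by (simp add: gen_cartan_matrix_def)
      ultimately have "d j * nat (- a j i) = d i * c"
        by (metis nat_0_le nat_int nat_mult_distrib of_nat_0_le_iff)
      then show ?thesis using aji
        by (simp add: qpair_def v_def qi_def power_int_def power_mult[symmetric])
    qed
    have "E l (fgen i ^ k * (fgen j * fgen i ^ (b - k))) = fscal (v ^ (k * c)) * fgen i ^ b"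
      if "k \<le> b" for k
    proof -
      have "fgen i ^ b = fgen i ^ k * fgen i ^ (b - k)" using that by (simp flip: power_add)
      then show ?thesis using 2 ij
        by (simp add: E_other_power_mult E_gen_mult Ei q power_mult[symmetric] mult.commute)
    qed
    then have "E l (serre a d i j) = fscal (\<Sum>k\<le>b. e k * v ^ (k * c)) * fgen i ^ b"
      by (simp add: S fscal_sum sum_distrib_right fscal_fscal)
    also have "(\<Sum>k\<le>b. e k * v ^ (k * c)) = 0"
      using qbinomial_alternating_sum[OF nv, of b] by (simp add: e_def b)
    finally show ?thesis by simp
  next
    case 3
    let ?u = "inverse v"
    define M where "M k = fgen i ^ k * (fgen j * fgen i ^ (c - k))" for k
    have pw: "qpair i j = v ^ c" using b by (simp add: qpair_def v_def)
    \<comment> \<open>\<open>g\<close> is the contribution of the left power and \<open>h\<close>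
      that of the right one. Since \<open>g\<close> vanishes at 0 and \<open>h\<close> at b,
      \<open>g (Suc k)\<close> can be paired with \<open>h k\<close>.\<close>
    define g h where "g k = (case k of 0 \<Rightarrow> 0 | Suc k' \<Rightarrow> fscal (e k * qsum i k) * M k')"
      and "h k = (if k \<le> c then fscal (e k * ((?u\<^sup>2) ^ k * v ^ c * qsum i (b - k))) * M k else 0)" for k
    have E2: "E i (fgen j * fgen i ^ m) = (case m of 0 \<Rightarrow> 0 |
        Suc m' \<Rightarrow> fscal (v ^ c * qsum i m) * (fgen j * fgen i ^ m'))" for m
      using ij E_gen_power_mult[of i "m - 1" 1]
      by (cases m) (simp_all add: E_gen_mult E_gen pw fscal_simps del: power_Suc)
    have "fscal (e k) * E i (fgen i ^ k * (fgen j * fgen i ^ (b - k))) = g k + h k" if "k \<le> b" for k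
    proof -
      have h: "fscal (e k) * fscal ((?u\<^sup>2) ^ k) * (fgen i ^ k * E i (fgen j * fgen i ^ (b - k))) = h k"
      proof (cases "k = b")
        case False
        then have "b - k = Suc (c - k)" "k \<le> c" using that b by auto
        then show ?thesis by (simp add: E2 h_def M_def fscal_simps fscal_mult[symmetric] del: power_Suc)
      qed (use ij in \<open>simp add: E_gen h_def b\<close>)
      show ?thesis
      proof (cases k)
        case 0
        then show ?thesis using h by (simp add: g_def)
      next
        case (Suc k')
        then have "b - k = c - k'" using b by simp
        with h Suc show ?thesis
          by (simp add: E_gen_power_mult g_def M_def distrib_left fscal_fscal v_def mult.assoc del: power_Suc)
      qed
    qed
    then have "E l (serre a d i j) = (\<Sum>k\<le>b. g k + h k)"
      unfolding 3 S[unfolded 3] by (intro sum.cong) auto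
    also have "\<dots> = (\<Sum>k\<le>b. g k) + (\<Sum>k\<le>b. h k)"
      by (rule sum.distrib)
    also have "(\<Sum>k\<le>b. g k) = (\<Sum>k\<le>c. g (Suc k))"
      unfolding b(1) by (subst sum.atMost_Suc_shift) (simp add: g_def)
    also have "(\<Sum>k\<le>b. h k) = (\<Sum>k\<le>c. h k)"
      by (simp add: b(1) h_def)
    also have "(\<Sum>k\<le>c. g (Suc k)) + (\<Sum>k\<le>c. h k) = (\<Sum>k\<le>c. g (Suc k) + h k)"
      by (simp add: sum.distrib)
    also have "\<dots> = 0"
    proof (rule sum.neutral, rule)
      fix k assume "k \<in> {..c}"
      then have k: "k \<le> c" "b - k = Suc (c - k)" using b by auto
      note nz = qfac_neq_0[OF nv] qnum_neq_0[OF nv]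
      have 1: "e (Suc k) * qsum i (Suc k) = - ((-1) ^ k * ?u ^ k / (qfac v k * qfac v (c - k)))"
        using nz(2)[of "Suc k"] by (simp add: e_def b qsum_Suc v_def[symmetric] qfac_Suc)
      have p: "(?u\<^sup>2) ^ k * v ^ c * ?u ^ (c - k) = ?u ^ k"
      proof -
        have "v ^ c = v ^ k * v ^ (c - k)" using k by (simp flip: power_add)
        then show ?thesis using v0 by (simp add: field_simps power2_eq_square power_mult_distrib)
      qed
      have "e k * ((?u\<^sup>2) ^ k * v ^ c * qsum i (b - k)) = 
         (?u\<^sup>2) ^ k * v ^ c * ?u ^ (c - k) * ((-1) ^ k / (qfac v k * qfac v (c - k)))"
        unfolding k(2) qsum_Suc v_def[symmetric] e_def 
        using nz(2)[of "Suc (c - k)"] by (simp add: qfac_Suc)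
      then have 2: "e k * ((?u\<^sup>2) ^ k * v ^ c * qsum i (b - k)) = (-1) ^ k * ?u ^ k / (qfac v k * qfac v (c - k))"
        unfolding p by simp
      show "g (Suc k) + h k = 0"
        unfolding g_def h_def nat.case if_P[OF k(1)] 1 2 by (simp add: fscal_uminus)
    qed
    finally show ?thesis .
  qed
qed

text \<open>The elements of J whose images under e'_i and under the twist stay in J form an ideal.
  The twist has to be included because the rule for x * y contains \<open>twist i x\<close>.\<close>

lemma E_J: "x \<in> J \<Longrightarrow> E i x \<in> J"
proof -
  let ?K = "{x \<in> J. E i x \<in> J \<and> twist i x \<in> J}"
  have "ideal ?K free_alg"
    by (rule ideal_free_algI)
       (auto simp: E_mult twist_mult E_add twist_add J_add J_left J_right, simp add: twist_def)
  moreover have "{serre a d i j |i j. i \<noteq> j} \<subseteq> ?K"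
    using serre_in_J by (auto simp: E_serre twist_serre J_left)
  ultimately have "J \<subseteq> ?K"
    unfolding serre_ideal_def[of a d] by (intro ring.genideal_minimal[OF ring_free_alg])
  then show "x \<in> J \<Longrightarrow> E i x \<in> J" by blast
qed

end

section \<open>Regularity at q = 0 and constant terms\<close>

lemma one_notin_qq_reg0: "r \<in> reg0 \<Longrightarrow> qq * r \<noteq> 1"
proof
  assume "r \<in> reg0" "qq * r = 1"
  then obtain p s where s: "r = Fract p s" "poly s 0 \<noteq> 0" by (auto simp: reg0_def)
  then have "s \<noteq> 0" by auto
  with s \<open>qq * r = 1\<close> have "[:0, 1:] * p = s"
    by (simp add: qq_def One_fract_def eq_fract)
  then have "poly s 0 = 0" by auto
  with s show False by simp
qed

lemma reg0_add: "r \<in> reg0 \<Longrightarrow> s \<in> reg0 \<Longrightarrow> r + s \<in> reg0"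
  unfolding reg0_def by clarsimp (metis add_fract mult_eq_0_iff poly_0 poly_mult)

lemma reg0_mult: "r \<in> reg0 \<Longrightarrow> s \<in> reg0 \<Longrightarrow> r * s \<in> reg0"
  unfolding reg0_def by clarsimp (metis mult_fract mult_eq_0_iff poly_mult)

lemma reg0_const: "0 \<in> reg0" "1 \<in> reg0" "- 1 \<in> reg0"
proof -
  have "Fract [:c:] 1 \<in> reg0" for c unfolding reg0_def by force
  from this[of 0] this[of 1] this[of "-1"]
  show "0 \<in> reg0" "1 \<in> reg0" "- 1 \<in> reg0"
    by (simp_all add: Zero_fract_def One_fract_def one_pCons)
qed

text \<open>The character sending every generator to 0. It kills the Serre ideal, hence descends to
  the quotient, where it separates 1 from q L(\<infinity>).\<close>

definition counit :: "'i falg \<Rightarrow> qfield" where "counit x = Poly_Mapping.lookup x []"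

lemma counit_add: "counit (x + y) = counit x + counit y" by (simp add: counit_def lookup_add)
lemma counit_scal: "counit (fscal c * x) = c * counit x"
  by (induction x rule: poly_mapping_single_induct)
     (simp_all add: counit_add distrib_left, simp add: counit_def lookup_single when_def)
lemma counit_mult: "counit (x * y) = counit x * counit y"
proof (induction x rule: poly_mapping_single_induct)
  case (single w c)
  show ?case
    by (induction y rule: poly_mapping_single_induct)
       (auto simp: counit_add distrib_left, auto simp: counit_def mult_single plus_list_def lookup_single when_def)
qed (simp add: counit_add distrib_right)
lemma counit_1 [simp]: "counit 1 = 1" by (simp add: counit_def flip: single_Nil_1)
lemma counit_0 [simp]: "counit 0 = 0" by (simp add: counit_def)
lemma counit_gen [simp]: "counit (fgen i) = 0" by (simp add: counit_def fgen_def lookup_single)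
lemma counit_sum: "counit (sum g A) = (\<Sum>x\<in>A. counit (g x))"
  by (induction A rule: infinite_finite_induct) (auto simp: counit_add)

context cartan_datum
begin

subsection \<open>The string decomposition\<close>

lemma J_scal: "x \<in> J \<Longrightarrow> fscal c * x \<in> J" by (rule J_left)

lemma J_cancel: "c \<noteq> 0 \<Longrightarrow> fscal c * x \<in> J \<Longrightarrow> x \<in> J"
  using J_scal[of "fscal c * x" "inverse c"] by (simp add: fscal_fscal)

lemma J_trans: "x - y \<in> J \<Longrightarrow> y - z \<in> J \<Longrightarrow> x - z \<in> J"
  using J_add[of "x - y" "y - z"] by simp

lemma J_sym: "x - y \<in> J \<Longrightarrow> y - x \<in> J"
  using J_uminus[of "x - y"] by simp

lemma J_diff_in: "x - y \<in> J \<Longrightarrow> y \<in> J \<Longrightarrow> x \<in> J"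
  using J_add[of "x - y" y] by simp

lemma J_add_cancel: "x + y \<in> J \<Longrightarrow> x \<in> J \<Longrightarrow> y \<in> J"
  using J_diff[of "x + y" x] by simp

lemma E_pow_0 [simp]: "(E i ^^ n) 0 = 0" by (induction n) simp_all
lemma E_pow_add: "(E i ^^ n) (x + y) = (E i ^^ n) x + (E i ^^ n) y"
  by (induction n) (simp_all add: E_add)
lemma E_pow_diff: "(E i ^^ n) (x - y) = (E i ^^ n) x - (E i ^^ n) y"
  by (induction n) (simp_all add: E_diff)
lemma E_pow_scal: "(E i ^^ n) (fscal c * x) = fscal c * (E i ^^ n) x"
  by (induction n) (simp_all add: E_scal)
lemma E_pow_sum: "(E i ^^ n) (sum g A) = (\<Sum>x\<in>A. (E i ^^ n) (g x))"
  by (induction A rule: infinite_finite_induct) (auto simp: E_pow_add)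
lemma E_pow_J: "x \<in> J \<Longrightarrow> (E i ^^ n) x \<in> J"
  by (induction n) (simp_all add: E_J)
lemma E_pow_mono: "(E i ^^ m) x \<in> J \<Longrightarrow> m \<le> n \<Longrightarrow> (E i ^^ n) x \<in> J"
  using E_pow_J[where x = "(E i ^^ m) x" and i = i and n = "n - m"] by (simp flip: funpow_add[THEN fun_cong, unfolded comp_def])

text \<open>Each letter of a word raises the nilpotency bound by one, since e'_i (f j x) consists of
  x, if i = j, and a multiple of f j e'_i x. For sums the maximum of the bounds serves.\<close>

lemma E_nilpotent: "\<exists>n. (E i ^^ n) x \<in> J"
proof (induction x rule: poly_mapping_single_induct)
  case (single w c)
  have gen: "(E i ^^ Suc n) (fgen j * x) = 0" if "(E i ^^ n) x = 0" for n j x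
    using that
  proof (induction n arbitrary: x)
    case (Suc n)
    have "(E i ^^ Suc n) (E i x) = 0" if "(E i ^^ n) (E i x) = 0"
      using that by simp
    moreover have "(E i ^^ n) (E i x) = 0" using Suc.prems by (simp add: funpow_swap1)
    ultimately have "(E i ^^ Suc n) (E i (fgen j * x)) = 0"
      using Suc.IH[of "E i x"] Suc.prems
      by (auto simp add: E_gen_mult E_pow_add E_pow_scal simp del: funpow.simps)
    then show ?case by (simp only: funpow_Suc_right comp_apply)
  qed simp
  have "\<exists>n. (E i ^^ n) (Poly_Mapping.single w 1) = 0"
  proof (induction w)
    case Nil
    show ?case by (rule exI[of _ 1]) simp
  next
    case (Cons j w)
    then show ?case using gen by (metis single_Cons)
  qed
  then obtain n where "(E i ^^ n) (Poly_Mapping.single w 1) = 0" by blast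
  then have "(E i ^^ n) (Poly_Mapping.single w c) \<in> J"
    by (subst single_eq_scal) (simp add: E_pow_scal del: fscal_single)
  then show ?case by blast
next
  case (add x y)
  then obtain m n where "(E i ^^ m) x \<in> J" "(E i ^^ n) y \<in> J" by blast
  then have "(E i ^^ max m n) (x + y) \<in> J"
    unfolding E_pow_add by (intro J_add; elim E_pow_mono) auto
  then show ?case by blast
qed

definition qsumprod :: "'i \<Rightarrow> nat \<Rightarrow> qfield" where
  "qsumprod i n = (\<Prod>k<n. qsum i (Suc k))"

lemma qsumprod_neq_0: "qsumprod i n \<noteq> 0"
  by (simp add: qsumprod_def qsum_Suc_neq_0)

text \<open>On the kernel of e'_i modulo J, multiplication by f_i^n is, up to a nonzero scalar, a
  section of the n-th power of e'_i. Existence and uniqueness of string decompositions both rest on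
  this.\<close>

lemma E_pow_gen_power:
  assumes "E i u \<in> J"
  shows "(E i ^^ n) (fgen i ^ n * u) - fscal (qsumprod i n) * u \<in> J"
proof (induction n)
  case (Suc n)
  have "E i (fgen i ^ Suc n * u) - fscal (qsum i (Suc n)) * (fgen i ^ n * u) \<in> J"
    using assms by (simp add: E_gen_power_mult J_left del: power_Suc)
  from E_pow_J[OF this, where i = i and n = n]
  have "(E i ^^ Suc n) (fgen i ^ Suc n * u) - fscal (qsum i (Suc n)) * (E i ^^ n) (fgen i ^ n * u) \<in> J"
    by (simp add: E_pow_diff E_pow_scal funpow_swap1)
  moreover have "fscal (qsum i (Suc n)) * (E i ^^ n) (fgen i ^ n * u)
      - fscal (qsumprod i (Suc n)) * u \<in> J"
    using J_scal[OF Suc.IH, of "qsum i (Suc n)"]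
    by (simp add: qsumprod_def right_diff_distrib fscal_fscal mult.commute)
  ultimately show ?case by (rule J_trans)
qed (simp add: qsumprod_def)

definition fdp :: "'i \<Rightarrow> nat \<Rightarrow> 'i falg" where
  "fdp i n = fscal (1 / qfac (qv i) n) * fgen i ^ n"

lemma qfac_qv_neq_0 [simp]: "qfac (qv i) n \<noteq> 0"
  by (rule qfac_neq_0[OF nonroot_qv])

text \<open>Peeling from the top: the n-th derivative u of x lies in the kernel, and subtracting a
  suitable multiple of f_i^n u lowers the nilpotency order of x. Demanding \<open>c m = 0\<close>
  from n on makes the family finitely supported, as \<open>is_string_dec\<close> requires.\<close>

lemma string_dec_exists_mod:
  assumes "(E i ^^ n) x \<in> J"
  shows "\<exists>c. (\<forall>m. E i (c m) \<in> J) \<and> (\<forall>m\<ge>n. c m = 0) \<and> x - (\<Sum>m<n. fdp i m * c m) \<in> J"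
  using assms
proof (induction n arbitrary: x)
  case 0
  then show ?case by (intro exI[of _ "\<lambda>_. 0"]) simp
next
  case (Suc n)
  define u where "u = (E i ^^ n) x"
  have Eu: "E i u \<in> J" using Suc.prems by (simp add: u_def)
  define y where "y = x - fscal (1 / qsumprod i n) * (fgen i ^ n * u)"
  have "(E i ^^ n) y = - (fscal (1 / qsumprod i n) * ((E i ^^ n) (fgen i ^ n * u) - fscal (qsumprod i n) * u))"
    using qsumprod_neq_0[of i n]
    by (simp add: y_def E_pow_diff E_pow_scal right_diff_distrib fscal_fscal u_def)
  then have "(E i ^^ n) y \<in> J" using E_pow_gen_power[OF Eu] by (simp add: J_uminus J_scal)
  from Suc.IH[OF this] obtain c where c: "\<And>m. E i (c m) \<in> J" "\<And>m. m \<ge> n \<Longrightarrow> c m = 0"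
    "y - (\<Sum>m<n. fdp i m * c m) \<in> J" by blast
  define c' where "c' = c(n := fscal (qfac (qv i) n / qsumprod i n) * u)"
  have "fdp i n * c' n = fscal (1 / qsumprod i n) * (fgen i ^ n * u)"
    by (simp add: fdp_def c'_def fscal_simps)
  then have "x - (\<Sum>m<Suc n. fdp i m * c' m) = y - (\<Sum>m<n. fdp i m * c m)"
    by (simp add: y_def c'_def)
  moreover have "\<forall>m. E i (c' m) \<in> J"
    using c(1) Eu by (simp add: c'_def E_scal J_scal)
  moreover have "\<forall>m\<ge>Suc n. c' m = 0" using c(2) by (simp add: c'_def)
  ultimately show ?case using c(3) by (intro exI[of _ c']) (simp del: sum.lessThan_Suc)
qed

text \<open>The n-th power of e'_i kills the terms below n and turns term n into a nonzero multiple
  of \<open>c n\<close>. So the top component lies in J, and the argument descends.\<close>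

lemma string_dec_unique_mod:
  assumes "\<And>m. E i (c m) \<in> J" "(\<Sum>m<n. fdp i m * c m) \<in> J" "m < n"
  shows "c m \<in> J"
  using assms(2,3)
proof (induction n arbitrary: m)
  case (Suc n)
  have pw: "(E i ^^ m) (fdp i m * c m) - fscal (qsumprod i m / qfac (qv i) m) * c m \<in> J" for m
    using J_scal[OF E_pow_gen_power[OF assms(1)[of m], of m], of "1 / qfac (qv i) m"]
    by (simp add: fdp_def right_diff_distrib fscal_simps E_pow_scal)
  have low: "(E i ^^ n) (fdp i m * c m) \<in> J" if "m < n" for m
  proof -
    have "E i ((E i ^^ m) (fdp i m * c m)) - fscal (qsumprod i m / qfac (qv i) m) * E i (c m) \<in> J"
      using E_J[OF pw, of i m] by (simp add: E_diff E_scal)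
    then have "(E i ^^ Suc m) (fdp i m * c m) \<in> J"
      using J_diff_in[OF _ J_scal[OF assms(1)]] by simp
    then show ?thesis by (rule E_pow_mono) (use that in simp)
  qed
  have "(E i ^^ n) (\<Sum>m<Suc n. fdp i m * c m) \<in> J" using Suc.prems(1) by (rule E_pow_J)
  then have "(\<Sum>m<n. (E i ^^ n) (fdp i m * c m)) + (E i ^^ n) (fdp i n * c n) \<in> J"
    by (simp add: E_pow_sum E_pow_add)
  moreover have "(\<Sum>m<n. (E i ^^ n) (fdp i m * c m)) \<in> J"
    by (rule J_sum) (use low in auto)
  ultimately have "(E i ^^ n) (fdp i n * c n) \<in> J" by (rule J_add_cancel)
  then have "fscal (qsumprod i n / qfac (qv i) n) * c n \<in> J"
    by (rule J_diff_in[OF J_sym[OF pw]])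
  then have n: "c n \<in> J" using qsumprod_neq_0[of i n] by (intro J_cancel[of "qsumprod i n / qfac (qv i) n" "c n"]) auto
  then have "(\<Sum>m<n. fdp i m * c m) \<in> J"
    using J_diff[OF Suc.prems(1) J_left[OF n, of "fdp i n"]] by simp
  with Suc.IH[of m] n Suc.prems(2) show ?case by (cases "m = n") auto
qed simp

subsection \<open>Passage to the quotient\<close>

abbreviation cl :: "'i falg \<Rightarrow> 'i falg set" where "cl \<equiv> Ucls a d"
abbreviation U :: "'i falg set ring" where "U \<equiv> Uqm a d"

lemma ring_U: "ring U" unfolding Uqm_def by (rule ideal.quotient_is_ring[OF ideal_J])

sublocale U: ring U by (rule ring_U)

lemma cl_hom: "cl \<in> ring_hom free_alg U"
  using ideal.rcos_ring_hom[OF ideal_J] by (simp add: Uqm_def Ucls_def[abs_def])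

lemma cl_add: "cl (x + y) = cl x \<oplus>\<^bsub>U\<^esub> cl y" using ring_hom_add[OF cl_hom, of x y] by simp
lemma cl_mult: "cl (x * y) = cl x \<otimes>\<^bsub>U\<^esub> cl y" using ring_hom_mult[OF cl_hom, of x y] by simp
lemma cl_1: "cl 1 = \<one>\<^bsub>U\<^esub>" using ring_hom_one[OF cl_hom] by simp
lemma cl_carrier [simp]: "cl x \<in> carrier U" using ring_hom_closed[OF cl_hom, of x] by simp
lemma carrier_U: "carrier U = range cl"
  by (auto simp: Uqm_def FactRing_def A_RCOSETS_def' Ucls_def)

lemma cl_eq: "cl x = {y. y - x \<in> J}"
proof -
  have "cl x = (\<lambda>h. h + x) ` J" by (auto simp: Ucls_def a_r_coset_def')
  also have "\<dots> = {y. y - x \<in> J}" by (auto simp: image_iff intro!: bexI[of _ "_ - x"])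
  finally show ?thesis .
qed

lemma cl_eq_iff: "cl x = cl y \<longleftrightarrow> x - y \<in> J"
proof
  assume "cl x = cl y"
  moreover have "x \<in> cl x" by (simp add: cl_eq)
  ultimately show "x - y \<in> J" by (auto simp: cl_eq)
next
  assume "x - y \<in> J"
  then show "cl x = cl y"
    by (auto simp: cl_eq intro: J_trans[of _ x y] J_trans[of _ y x] J_sym)
qed

lemma cl_0: "\<zero>\<^bsub>U\<^esub> = cl 0"
  by (auto simp: cl_eq Uqm_def FactRing_def)

lemma cl_eq_0_iff: "cl x = \<zero>\<^bsub>U\<^esub> \<longleftrightarrow> x \<in> J" by (simp add: cl_0 cl_eq_iff)

lemma cl_finsum: "finite A \<Longrightarrow> finsum U (\<lambda>n. cl (g n)) A = cl (sum g A)"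
  by (induction A rule: finite_induct) (simp_all add: cl_0 cl_add Pi_def)

lemma Uscale_cl: "Uscale a d c (cl x) = cl (fscal c * x)"
  by (simp add: Uscale_def cl_mult fscal_def)

text \<open>The union in \<open>eder\<close> ranges over all representatives, and by
  \<open>E_J\<close> they all yield the same coset.\<close>

lemma eder_cl: "eder a d i (cl x) = cl (E i x)"
  unfolding eder_def
proof (rule UN_constant_eq[of x], goal_cases)
  case 2
  show ?case
  proof
    fix y assume "y \<in> cl x"
    then show "cl (E i y) = cl (E i x)" using E_J[of "y - x" i] unfolding cl_eq_iff by (simp add: cl_eq[of x] E_diff)
  qed
qed (simp add: cl_eq)

lemma fdiv_cl: "fdiv a d i m = cl (fdp i m)"
  by (simp add: fdiv_def fdp_def qfact_eq_qfac flip: single_replicate)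

text \<open>Evaluates the definite description: any competing family in the quotient is lifted to
  the free algebra, where uniqueness modulo J identifies it with \<open>c\<close>.\<close>

lemma string_dec_cl:
  assumes c: "\<And>m. E i (c m) \<in> J" "\<And>m. m \<ge> n \<Longrightarrow> c m = 0" and x: "x - (\<Sum>m<n. fdp i m * c m) \<in> J"
  shows "string_dec a d i (cl x) = (\<lambda>m. cl (c m))"
  unfolding string_dec_def
proof (rule the_equality)
  have sub: "{m. cl (c m) \<noteq> \<zero>\<^bsub>U\<^esub>} \<subseteq> {..<n}"
    using c(2) by (force simp: cl_eq_0_iff not_less[symmetric])
  then have fin: "finite {m. cl (c m) \<noteq> \<zero>\<^bsub>U\<^esub>}" by (rule finite_subset) simp
  have "(\<Sum>m<n. fdp i m * c m) - (\<Sum>m | cl (c m) \<noteq> \<zero>\<^bsub>U\<^esub>. fdp i m * c m)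
     = (\<Sum>m\<in>{..<n} - {m. cl (c m) \<noteq> \<zero>\<^bsub>U\<^esub>}. fdp i m * c m)"
    using sub by (subst sum_diff) auto
  also have "\<dots> \<in> J" by (rule J_sum) (auto simp: cl_eq_0_iff J_left)
  finally have "x - (\<Sum>m | cl (c m) \<noteq> \<zero>\<^bsub>U\<^esub>. fdp i m * c m) \<in> J" by (rule J_trans[OF x])
  then have "cl x = finsum U (\<lambda>m. fdiv a d i m \<otimes>\<^bsub>U\<^esub> cl (c m)) {m. cl (c m) \<noteq> \<zero>\<^bsub>U\<^esub>}"
    using fin by (simp add: fdiv_cl cl_finsum cl_eq_iff flip: cl_mult)
  then show "is_string_dec a d i (cl x) (\<lambda>m. cl (c m))"
    using fin c(1) by (simp add: is_string_dec_def eder_cl cl_eq_0_iff)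
next
  fix b assume b: "is_string_dec a d i (cl x) b"
  then have "\<forall>m. \<exists>y. b m = cl y \<and> E i y \<in> J"
    by (auto simp: is_string_dec_def carrier_U image_iff) (metis eder_cl cl_eq_0_iff)
  then obtain y where y: "\<And>m. b m = cl (y m)" "\<And>m. E i (y m) \<in> J" by metis
  have b': "b = (\<lambda>m. cl (y m))" using y(1) by blast
  have fin: "finite {m. cl (y m) \<noteq> \<zero>\<^bsub>U\<^esub>}" using b by (simp add: is_string_dec_def b')
  then obtain k where k: "{m. cl (y m) \<noteq> \<zero>\<^bsub>U\<^esub>} \<subseteq> {..<k}" using finite_nat_bounded by blast
  \<comment> \<open>The two families may have different supports; their sums are padded to a common
    length before they are subtracted.\<close>
  define N where "N = max k n"
  have "cl x = cl (\<Sum>m | cl (y m) \<noteq> \<zero>\<^bsub>U\<^esub>. fdp i m * y m)"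
    using b fin by (simp add: is_string_dec_def b' fdiv_cl cl_finsum flip: cl_mult)
  then have "x - (\<Sum>m | cl (y m) \<noteq> \<zero>\<^bsub>U\<^esub>. fdp i m * y m) \<in> J" by (simp add: cl_eq_iff)
  moreover have "(\<Sum>m<N. fdp i m * y m) - (\<Sum>m | cl (y m) \<noteq> \<zero>\<^bsub>U\<^esub>. fdp i m * y m) \<in> J"
  proof -
    have "(\<Sum>m<N. fdp i m * y m) - (\<Sum>m | cl (y m) \<noteq> \<zero>\<^bsub>U\<^esub>. fdp i m * y m)
       = (\<Sum>m\<in>{..<N} - {m. cl (y m) \<noteq> \<zero>\<^bsub>U\<^esub>}. fdp i m * y m)"
      using k by (subst sum_diff) (auto simp: N_def)
    also have "\<dots> \<in> J" by (rule J_sum) (auto simp: cl_eq_0_iff J_left)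
    finally show ?thesis .
  qed
  ultimately have "x - (\<Sum>m<N. fdp i m * y m) \<in> J" by (rule J_trans[OF _ J_sym])
  moreover have "(\<Sum>m<n. fdp i m * c m) = (\<Sum>m<N. fdp i m * c m)"
    by (rule sum.mono_neutral_left) (auto simp: N_def c(2))
  ultimately have "(\<Sum>m<N. fdp i m * y m) - (\<Sum>m<N. fdp i m * c m) \<in> J"
    using J_trans[OF J_sym x] by simp
  then have s: "(\<Sum>m<N. fdp i m * (y m - c m)) \<in> J"
    by (simp add: right_diff_distrib sum_subtractf)
  have "y m - c m \<in> J" for m
  proof (cases "m < N")
    case True
    with string_dec_unique_mod[of i "\<lambda>m. y m - c m" N m] s y(2) c(1) show ?thesis
      by (simp add: E_diff J_diff)
  next
    case False
    then show ?thesis using k c(2)[of m] by (force simp: N_def cl_eq_0_iff)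
  qed
  then show "b = (\<lambda>m. cl (c m))" by (simp add: b' cl_eq_iff fun_eq_iff)
qed

text \<open>The lift of the operator to the free algebra, as a relation because x determines its
  string components only modulo J. Such pairs can be added and scaled, which yields linearity of the
  operator without unfolding \<open>string_dec\<close> again.\<close>

definition shift_rep :: "'i \<Rightarrow> 'i falg \<Rightarrow> 'i falg \<Rightarrow> bool" where
  "shift_rep i x y \<longleftrightarrow> (\<exists>n c. (\<forall>m. E i (c m) \<in> J) \<and> (\<forall>m\<ge>n. c m = 0) \<and>
     x - (\<Sum>m<n. fdp i m * c m) \<in> J \<and> y = (\<Sum>m<n. fdp i (m + 1) * c m))"

lemma shift_rep_exists: "\<exists>y. shift_rep i x y"
proof -
  obtain n where "(E i ^^ n) x \<in> J" using E_nilpotent by blast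
  from string_dec_exists_mod[OF this] show ?thesis unfolding shift_rep_def by blast
qed

lemma Uftil_cl:
  assumes "shift_rep i x y" shows "Uftil a d i (cl x) = cl y"
proof -
  obtain n c where c: "\<And>m. E i (c m) \<in> J" "\<And>m. m \<ge> n \<Longrightarrow> c m = 0"
     "x - (\<Sum>m<n. fdp i m * c m) \<in> J" and y: "y = (\<Sum>m<n. fdp i (m + 1) * c m)"
    using assms unfolding shift_rep_def by blast
  have sub: "{m. cl (c m) \<noteq> \<zero>\<^bsub>U\<^esub>} \<subseteq> {..<n}"
    using c(2) by (force simp: cl_eq_0_iff not_less[symmetric])
  then have fin: "finite {m. cl (c m) \<noteq> \<zero>\<^bsub>U\<^esub>}" by (rule finite_subset) simp
  have "y - (\<Sum>m | cl (c m) \<noteq> \<zero>\<^bsub>U\<^esub>. fdp i (m + 1) * c m)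
     = (\<Sum>m\<in>{..<n} - {m. cl (c m) \<noteq> \<zero>\<^bsub>U\<^esub>}. fdp i (m + 1) * c m)"
    unfolding y using sub by (subst sum_diff) auto
  also have "\<dots> \<in> J" by (rule J_sum) (auto simp: cl_eq_0_iff J_left)
  finally have "cl (\<Sum>m | cl (c m) \<noteq> \<zero>\<^bsub>U\<^esub>. fdp i (m + 1) * c m) = cl y"
    using J_sym by (simp add: cl_eq_iff)
  then show ?thesis
    using string_dec_cl[OF c] fin
    by (simp add: Uftil_def fdiv_cl cl_finsum flip: cl_mult)
qed

lemma shift_rep_add:
  assumes "shift_rep i x y" "shift_rep i x' y'"
  shows "shift_rep i (x + x') (y + y')"
proof -
  obtain n c where c: "\<And>m. E i (c m) \<in> J" "\<And>m. m \<ge> n \<Longrightarrow> c m = 0"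
     "x - (\<Sum>m<n. fdp i m * c m) \<in> J" and y: "y = (\<Sum>m<n. fdp i (m + 1) * c m)"
    using assms(1) unfolding shift_rep_def by blast
  obtain n' c' where c': "\<And>m. E i (c' m) \<in> J" "\<And>m. m \<ge> n' \<Longrightarrow> c' m = 0"
     "x' - (\<Sum>m<n'. fdp i m * c' m) \<in> J" and y': "y' = (\<Sum>m<n'. fdp i (m + 1) * c' m)"
    using assms(2) unfolding shift_rep_def by blast
  define N where "N = max n n'"
  have ext: "(\<Sum>m<n. g m * c m) = (\<Sum>m<N. g m * c m)" "(\<Sum>m<n'. g m * c' m) = (\<Sum>m<N. g m * c' m)" for g
    by (rule sum.mono_neutral_left; auto simp: N_def c(2) c'(2))+
  show ?thesis unfolding shift_rep_def
  proof (intro exI[of _ N] exI[of _ "\<lambda>m. c m + c' m"] conjI)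
    show "x + x' - (\<Sum>m<N. fdp i m * (c m + c' m)) \<in> J"
      using J_add[OF c(3) c'(3)] by (simp add: ext distrib_left sum.distrib algebra_simps)
    show "y + y' = (\<Sum>m<N. fdp i (m + 1) * (c m + c' m))"
      by (simp add: y y' ext distrib_left sum.distrib)
  qed (use c c' in \<open>auto simp: E_add J_add N_def\<close>)
qed

lemma shift_rep_scal:
  assumes "shift_rep i x y"
  shows "shift_rep i (fscal r * x) (fscal r * y)"
proof -
  obtain n c where c: "\<And>m. E i (c m) \<in> J" "\<And>m. m \<ge> n \<Longrightarrow> c m = 0"
     "x - (\<Sum>m<n. fdp i m * c m) \<in> J" and y: "y = (\<Sum>m<n. fdp i (m + 1) * c m)"
    using assms(1) unfolding shift_rep_def by blast
  show ?thesis unfolding shift_rep_def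
  proof (intro exI[of _ n] exI[of _ "\<lambda>m. fscal r * c m"] conjI)
    show "fscal r * x - (\<Sum>m<n. fdp i m * (fscal r * c m)) \<in> J"
      using J_scal[OF c(3), of r] by (simp add: right_diff_distrib sum_distrib_left fscal_left_commute[of "fdp i _" r])
    show "fscal r * y = (\<Sum>m<n. fdp i (m + 1) * (fscal r * c m))"
      by (simp add: y sum_distrib_left fscal_left_commute[of "fdp i _" r])
  qed (use c in \<open>auto simp: E_scal J_scal\<close>)
qed

lemma counit_shift_rep: "shift_rep i x y \<Longrightarrow> counit y = 0"
  by (auto simp: shift_rep_def counit_sum counit_mult fdp_def counit_scal)

lemma counit_J: "x \<in> J \<Longrightarrow> counit x = 0"
proof -
  have "ideal {x :: 'i falg. counit x = 0} free_alg"
    by (rule ideal_free_algI) (auto simp: counit_add counit_mult)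
  moreover have "{serre a d i j |i j. i \<noteq> j} \<subseteq> {x. counit x = 0}"
    by (auto simp: serre_eq counit_sum counit_scal counit_mult)
  ultimately have "J \<subseteq> {x. counit x = 0}"
    unfolding serre_ideal_def[of a d] by (intro ring.genideal_minimal[OF ring_free_alg])
  then show "x \<in> J \<Longrightarrow> counit x = 0" by blast
qed

subsection \<open>The crystal lattice\<close>

lemma ftil_word_Nil: "ftil_word a d [] = cl 1" by (simp add: ftil_word_def cl_1)
lemma ftil_word_Cons: "ftil_word a d (i # w) = Uftil a d i (ftil_word a d w)"
  by (simp add: ftil_word_def)

text \<open>The constant term is 1 for the empty word and 0 for all others, since every term of a
  shifted string has a factor f_i.\<close>

lemma ftil_word_cl: "\<exists>x. ftil_word a d w = cl x \<and> counit x \<in> reg0"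
proof (induction w)
  case Nil
  then show ?case using reg0_const counit_1 ftil_word_Nil by metis
next
  case (Cons i w)
  then show ?case using shift_rep_exists counit_shift_rep Uftil_cl ftil_word_Cons reg0_const(1) by metis
qed

lemma Linf_cl: "u \<in> Linf a d \<Longrightarrow> \<exists>x. u = cl x \<and> counit x \<in> reg0"
proof (induction rule: Linf.induct)
  case zero
  then show ?case using cl_0 counit_0 reg0_const(1) by metis
next
  case (add u c w)
  then obtain x where x: "u = cl x" "counit x \<in> reg0" by blast
  obtain y where y: "ftil_word a d w = cl y" "counit y \<in> reg0" using ftil_word_cl by blast
  have "u \<oplus>\<^bsub>U\<^esub> Uscale a d c (ftil_word a d w) = cl (x + fscal c * y)"
    by (simp add: x y Uscale_cl cl_add)
  moreover have "counit (x + fscal c * y) \<in> reg0"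
    using x y add by (simp add: counit_add counit_scal reg0_add reg0_mult)
  ultimately show ?case by blast
qed

lemma Linf_add:
  assumes "cl y \<in> Linf a d" "cl x \<in> Linf a d" shows "cl (x + y) \<in> Linf a d"
proof -
  have "cl x \<oplus>\<^bsub>U\<^esub> v \<in> Linf a d" if "v \<in> Linf a d" for v
    using that
  proof (induction rule: Linf.induct)
    case zero
    then show ?case using assms by simp
  next
    case (add u c w)
    obtain y where y: "u = cl y" using Linf_cl add(1) by blast
    obtain z where z: "ftil_word a d w = cl z" using ftil_word_cl by blast
    have "cl x \<oplus>\<^bsub>U\<^esub> (u \<oplus>\<^bsub>U\<^esub> Uscale a d c (ftil_word a d w)) =
       (cl x \<oplus>\<^bsub>U\<^esub> u) \<oplus>\<^bsub>U\<^esub> Uscale a d c (ftil_word a d w)"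
      by (simp add: y z Uscale_cl add.assoc flip: cl_add)
    then show ?case using Linf.add add by metis
  qed
  with assms show ?thesis by (simp add: cl_add)
qed

lemma Linf_scal: "cl x \<in> Linf a d \<Longrightarrow> r \<in> reg0 \<Longrightarrow> cl (fscal r * x) \<in> Linf a d"
proof -
  assume r: "r \<in> reg0"
  have "Uscale a d r v \<in> Linf a d" if "v \<in> Linf a d" for v
    using that
  proof (induction rule: Linf.induct)
    case zero
    then show ?case using Linf.zero[of a d] by (simp add: cl_0 Uscale_cl)
  next
    case (add u c w)
    obtain y where y: "u = cl y" using Linf_cl add(1) by blast
    obtain z where z: "ftil_word a d w = cl z" using ftil_word_cl by blast
    have "Uscale a d r (u \<oplus>\<^bsub>U\<^esub> Uscale a d c (ftil_word a d w)) =
       Uscale a d r u \<oplus>\<^bsub>U\<^esub> Uscale a d (r * c) (ftil_word a d w)"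
      by (simp add: y z Uscale_cl distrib_left fscal_fscal flip: cl_add)
    then show ?case using Linf.add add r reg0_mult by metis
  qed
  then show "cl x \<in> Linf a d \<Longrightarrow> cl (fscal r * x) \<in> Linf a d" by (metis Uscale_cl)
qed

text \<open>The operator is linear and sends a generator of the lattice to the generator of the
  longer word.\<close>

lemma Uftil_Linf: "v \<in> Linf a d \<Longrightarrow> Uftil a d i v \<in> Linf a d"
proof (induction rule: Linf.induct)
  case zero
  have "shift_rep i 0 0" unfolding shift_rep_def by (intro exI[of _ 0] exI[of _ "\<lambda>_. 0"]) simp
  then show ?case using Uftil_cl Linf.zero by (metis cl_0)
next
  case (add u c w)
  obtain x where x: "u = cl x" using Linf_cl add(1) by blast
  obtain z where z: "ftil_word a d w = cl z" using ftil_word_cl by blast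
  obtain x' z' where s: "shift_rep i x x'" "shift_rep i z z'" using shift_rep_exists by metis
  have "Uftil a d i (u \<oplus>\<^bsub>U\<^esub> Uscale a d c (ftil_word a d w)) = cl (x' + fscal c * z')"
    using Uftil_cl[OF shift_rep_add[OF s(1) shift_rep_scal[OF s(2)]]]
    by (simp add: x z Uscale_cl cl_add)
  also have "\<dots> = Uftil a d i u \<oplus>\<^bsub>U\<^esub> Uscale a d c (ftil_word a d (i # w))"
    by (simp add: cl_add ftil_word_Cons x z Uftil_cl[OF s(1)] Uftil_cl[OF s(2)] Uscale_cl)
  finally show ?case using Linf.add add by metis
qed

lemma qLinf_cl_iff: "cl z \<in> qLinf a d \<longleftrightarrow> (\<exists>x. cl x \<in> Linf a d \<and> z - fscal qq * x \<in> J)"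
proof
  assume "cl z \<in> qLinf a d"
  then obtain u where "u \<in> Linf a d" "cl z = Uscale a d qq u" by (auto simp: qLinf_def)
  with Linf_cl[of u] show "\<exists>x. cl x \<in> Linf a d \<and> z - fscal qq * x \<in> J"
    by (metis Uscale_cl cl_eq_iff)
next
  assume "\<exists>x. cl x \<in> Linf a d \<and> z - fscal qq * x \<in> J"
  then obtain x where "cl x \<in> Linf a d" "cl z = Uscale a d qq (cl x)" by (metis Uscale_cl cl_eq_iff)
  then show "cl z \<in> qLinf a d" by (auto simp: qLinf_def)
qed

lemma qLinf_carrier: "u \<in> qLinf a d \<Longrightarrow> \<exists>z. u = cl z"
  unfolding qLinf_def using Linf_cl by (fastforce simp: Uscale_cl)

lemma qLinf_add: "cl x \<in> qLinf a d \<Longrightarrow> cl y \<in> qLinf a d \<Longrightarrow> cl (x + y) \<in> qLinf a d"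
proof -
  assume "cl x \<in> qLinf a d" "cl y \<in> qLinf a d"
  then obtain x' y' where "cl x' \<in> Linf a d" "x - fscal qq * x' \<in> J" "cl y' \<in> Linf a d" "y - fscal qq * y' \<in> J"
    by (auto simp: qLinf_cl_iff)
  then have "cl (x' + y') \<in> Linf a d" "x + y - fscal qq * (x' + y') \<in> J"
    using J_add[of "x - fscal qq * x'" "y - fscal qq * y'"] by (auto simp: Linf_add algebra_simps)
  then show "cl (x + y) \<in> qLinf a d" by (auto simp: qLinf_cl_iff)
qed

lemma qLinf_uminus: "cl x \<in> qLinf a d \<Longrightarrow> cl (- x) \<in> qLinf a d"
proof -
  assume "cl x \<in> qLinf a d"
  then obtain x' where x': "cl x' \<in> Linf a d" "x - fscal qq * x' \<in> J" by (auto simp: qLinf_cl_iff)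
  then have "cl (- x') \<in> Linf a d"
    using Linf_scal[OF x'(1) reg0_const(3)] by (simp add: fscal_uminus)
  moreover have "- x - fscal qq * (- x') \<in> J" using J_uminus[OF x'(2)] by simp
  ultimately show "cl (- x) \<in> qLinf a d" by (auto simp: qLinf_cl_iff)
qed

lemma Uftil_qLinf: "cl z \<in> qLinf a d \<Longrightarrow> shift_rep i z y \<Longrightarrow> cl y \<in> qLinf a d"
proof -
  assume z: "cl z \<in> qLinf a d" and y: "shift_rep i z y"
  from z obtain x where x: "cl x \<in> Linf a d" "z - fscal qq * x \<in> J" by (auto simp: qLinf_cl_iff)
  obtain x' where x': "shift_rep i x x'" using shift_rep_exists by blast
  have "cl x' \<in> Linf a d" using Uftil_Linf[OF x(1), of i] by (simp add: Uftil_cl[OF x'])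
  moreover have "cl y = cl (fscal qq * x')"
    using Uftil_cl[OF y] Uftil_cl[OF shift_rep_scal[OF x']] x(2) by (metis cl_eq_iff)
  ultimately show "cl y \<in> qLinf a d" by (auto simp: qLinf_cl_iff cl_eq_iff)
qed

lemma Lcls_cl: "Lcls a d (cl x) = {cl (z + x) |z. cl z \<in> qLinf a d}"
  unfolding Lcls_def a_r_coset_def' using qLinf_carrier by (fastforce simp: cl_add)

lemma Lcls_eqI: assumes "cl (x - y) \<in> qLinf a d" shows "Lcls a d (cl x) = Lcls a d (cl y)"
proof -
  have "Lcls a d (cl x) \<subseteq> Lcls a d (cl y)" if "cl (x - y) \<in> qLinf a d" for x y
  proof
    fix u assume "u \<in> Lcls a d (cl x)"
    then obtain z where z: "u = cl (z + x)" "cl z \<in> qLinf a d" by (auto simp: Lcls_cl)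
    then have "u = cl ((z + (x - y)) + y)" "cl (z + (x - y)) \<in> qLinf a d"
      using qLinf_add that by auto
    then show "u \<in> Lcls a d (cl y)" unfolding Lcls_cl by blast
  qed
  from this[OF assms] this[of y x] qLinf_uminus[OF assms] show ?thesis by auto
qed

lemma zero_qLinf: "cl 0 \<in> qLinf a d"
  unfolding qLinf_cl_iff using Linf.zero[of a d] by (intro exI[of _ 0]) (simp add: cl_0)

text \<open>Representatives differ by elements of q L(\<infinity>), which the linear operator
  preserves; so the union in \<open>Lftil\<close> is a single coset.\<close>

lemma Lftil_Lcls: "Lftil a d i (Lcls a d (cl x)) = Lcls a d (Uftil a d i (cl x))"
proof -
  obtain x' where x': "shift_rep i x x'" using shift_rep_exists by blast
  have "Lcls a d (Uftil a d i (cl (z + x))) = Lcls a d (cl x')" if "cl z \<in> qLinf a d" for z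
  proof -
    obtain z' where z': "shift_rep i z z'" using shift_rep_exists by blast
    show ?thesis unfolding Uftil_cl[OF shift_rep_add[OF z' x']]
      by (rule Lcls_eqI) (use Uftil_qLinf[OF that z'] in simp)
  qed
  then have "Lftil a d i (Lcls a d (cl x)) = Lcls a d (cl x')"
    unfolding Lftil_def Lcls_cl[of x] using zero_qLinf by (intro UN_constant_eq[of "cl (0 + x)"]) blast+
  then show ?thesis by (simp add: Uftil_cl[OF x'])
qed

lemma Lftil_ftil_word:
  "Lftil a d i (Lcls a d (ftil_word a d w)) = Lcls a d (ftil_word a d (i # w))"
  using ftil_word_cl[of w] Lftil_Lcls by (auto simp: ftil_word_Cons)

lemma uinf_neq_qLinf: "uinf a d \<noteq> qLinf a d"
proof
  assume "uinf a d = qLinf a d"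
  moreover have "cl (0 + 1) \<in> uinf a d"
    unfolding uinf_def cl_1[symmetric] Lcls_cl using zero_qLinf by blast
  ultimately have "cl 1 \<in> qLinf a d" by simp
  then obtain u where u: "u \<in> Linf a d" "cl 1 = Uscale a d qq u" by (auto simp: qLinf_def)
  then obtain x where x: "u = cl x" "counit x \<in> reg0" using Linf_cl by blast
  have "1 - fscal qq * x \<in> J" using u by (simp add: x Uscale_cl cl_eq_iff)
  then have "counit (1 + fscal (- qq) * x) = 0" using counit_J by (simp add: fscal_uminus)
  then have "qq * counit x = 1" unfolding counit_add counit_scal by (simp add: algebra_simps)
  then show False using one_notin_qq_reg0 x(2) by blast
qed

end

lemma embedded_image_eq_words:
  assumes "gen_cartan_matrix a" "symmetrizer a d"
    and emb: "strict_embedding (Binf a d) (Zcrystal a \<iota>) \<Psi>" and u: "\<Psi> (uinf a d) = 0"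
  shows "\<Psi> ` elts (Binf a d) =
    range (\<lambda>w. foldr (\<lambda>i x. the (ff (Zcrystal a \<iota>) i x)) w 0)"
proof -
  interpret cartan_datum a d using assms by unfold_locales
  let ?b = "\<lambda>w. Lcls a d (ftil_word a d w)"
  let ?z = "\<lambda>w. foldr (\<lambda>i x. the (ff (Zcrystal a \<iota>) i x)) w 0"
  have ff_emb: "ff (Zcrystal a \<iota>) i (\<Psi> b) = map_option \<Psi> (ff (Binf a d) i b)"
    if "b \<in> elts (Binf a d)" for i b
    using emb that unfolding strict_embedding_def by blast
  have "?b w \<in> elts (Binf a d) \<and> \<Psi> (?b w) = ?z w" for w
  proof (induction w)
    case Nil
    have "?b [] = uinf a d" by (simp add: uinf_def ftil_word_def)
    with uinf_neq_qLinf u show ?case by (auto simp: Binf_def)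
  next
    case (Cons i w)
    have "ff (Zcrystal a \<iota>) i (\<Psi> (?b w)) = map_option \<Psi> (ff (Binf a d) i (?b w))"
      by (rule ff_emb) (use Cons in simp)
    \<comment> \<open>This excludes that the class of the extended word is 0: otherwise strictness
      would make the left-hand side \<open>None\<close>.\<close>
    moreover have "ff (Zcrystal a \<iota>) i (\<Psi> (?b w)) \<noteq> None" by (simp add: Zcrystal_def)
    moreover have "ff (Binf a d) i (?b w) = (if ?b (i # w) = qLinf a d then None else Some (?b (i # w)))"
      by (simp add: Binf_def Lftil_ftil_word)
    ultimately have "?b (i # w) \<noteq> qLinf a d"
      "ff (Zcrystal a \<iota>) i (\<Psi> (?b w)) = Some (\<Psi> (?b (i # w)))" by (auto split: if_splits)
    then show ?case using Cons by (auto simp: Binf_def)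
  qed
  moreover have "elts (Binf a d) \<subseteq> range ?b" by (auto simp: Binf_def)
  ultimately show ?thesis by (auto simp: image_iff subset_iff) metis+
qed

section \<open>Adapted sequences\<close>

lemma card_le_enumerate:
  assumes "infinite (A :: nat set)" shows "card {t \<in> A. t \<le> enumerate A m} = Suc m"
proof -
  have "{t \<in> A. t \<le> enumerate A m} = enumerate A ` {..m}" (is "?L = ?R")
  proof
    show "?L \<subseteq> ?R"
    proof
      fix t assume t: "t \<in> ?L"
      then obtain n where "t = enumerate A n" using enumerate_Ex[of A t] assms by auto
      then show "t \<in> ?R" using t assms by auto
    qed
  qed (use assms in \<open>auto simp: enumerate_in_set\<close>)
  moreover have "inj_on (enumerate A) {..m}"
    using inj_enumerate[OF assms] by (auto intro: inj_on_subset)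
  ultimately show ?thesis by (simp add: card_image)
qed

locale index_seq =
  fixes \<iota> :: "nat \<Rightarrow> 'i::finite"
  assumes index_sequence: "index_sequence \<iota>"
begin

abbreviation occ :: "'i \<Rightarrow> nat set" where "occ k \<equiv> {r. r \<ge> 1 \<and> \<iota> r = k}"

lemma infinite_occ: "infinite (occ k)"
  using index_sequence unfolding index_sequence_def by blast

lemma occ_enumerate: "r \<in> occ k \<Longrightarrow> \<exists>n. r = enumerate (occ k) n"
  using enumerate_Ex[OF infinite_occ, of r k] by metis

lemma card_le_eq: "{t. 1 \<le> t \<and> t \<le> r \<and> \<iota> t = k} = {t \<in> occ k. t \<le> r}" by auto

text \<open>Occurrences are counted from 1, while \<open>enumerate\<close> starts at 0.\<close>

lemma pos_eq_enumerate: "pos \<iota> (Suc m) k = enumerate (occ k) m"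
  unfolding pos_def card_le_eq
proof (rule the_equality)
  show "1 \<le> enumerate (occ k) m \<and> \<iota> (enumerate (occ k) m) = k \<and> card {t \<in> occ k. t \<le> enumerate (occ k) m} = Suc m"
    using enumerate_in_set[OF infinite_occ, of k m] card_le_enumerate[OF infinite_occ] by auto
next
  fix r assume r: "1 \<le> r \<and> \<iota> r = k \<and> card {t \<in> occ k. t \<le> r} = Suc m"
  then obtain n where n: "r = enumerate (occ k) n" using occ_enumerate[of r k] by auto
  then show "r = enumerate (occ k) m" using r card_le_enumerate[OF infinite_occ, of k n] by auto
qed

lemma pos_unique:
  assumes "1 \<le> r" "\<iota> r = k" "card {t. 1 \<le> t \<and> t \<le> r \<and> \<iota> t = k} = Suc m"
  shows "pos \<iota> (Suc m) k = r"
proof -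
  obtain n where n: "r = enumerate (occ k) n" using assms occ_enumerate[of r k] by auto
  then have "n = m" using assms(3) card_le_enumerate[OF infinite_occ, of k n] unfolding card_le_eq by simp
  then show ?thesis by (simp add: n pos_eq_enumerate)
qed

lemma pos_props:
  assumes "s \<ge> 1" shows "pos \<iota> s k \<ge> 1" "\<iota> (pos \<iota> s k) = k"
proof -
  obtain m where "s = Suc m" using assms by (cases s) auto
  then have "pos \<iota> s k \<in> occ k" using enumerate_in_set[OF infinite_occ] by (simp only: pos_eq_enumerate)
  then show "pos \<iota> s k \<ge> 1" "\<iota> (pos \<iota> s k) = k" by auto
qed

lemma pos_less_iff: "s \<ge> 1 \<Longrightarrow> t \<ge> 1 \<Longrightarrow> pos \<iota> s k < pos \<iota> t k \<longleftrightarrow> s < t"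
  using infinite_occ[of k] by (cases s; cases t) (auto simp: pos_eq_enumerate)

lemma pos_le_iff: "s \<ge> 1 \<Longrightarrow> t \<ge> 1 \<Longrightarrow> pos \<iota> s k \<le> pos \<iota> t k \<longleftrightarrow> s \<le> t"
  using infinite_occ[of k] by (cases s; cases t) (auto simp: pos_eq_enumerate)

lemma pos_eq_iff: "s \<ge> 1 \<Longrightarrow> t \<ge> 1 \<Longrightarrow> pos \<iota> s k = pos \<iota> t j \<longleftrightarrow> s = t \<and> k = j"
  using pos_props(2)[of s k] pos_props(2)[of t j] pos_le_iff[of s t k] pos_le_iff[of t s k]
  by (cases "k = j") auto

lemma pos_surj: assumes "r \<ge> 1" shows "\<exists>s\<ge>1. r = pos \<iota> s (\<iota> r)"
proof -
  obtain n where "enumerate (occ (\<iota> r)) n = r"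
    using assms enumerate_Ex[of "occ (\<iota> r)" r] infinite_occ by auto
  then show ?thesis by (intro exI[of _ "Suc n"]) (simp add: pos_eq_enumerate)
qed

lemma succ_occ_pos: assumes "s \<ge> 1" shows "succ_occ \<iota> (pos \<iota> s k) = pos \<iota> (Suc s) k"
  unfolding succ_occ_def pos_props(2)[OF assms]
proof (rule Least_equality)
  show "pos \<iota> s k < pos \<iota> (Suc s) k \<and> \<iota> (pos \<iota> (Suc s) k) = k"
    using assms by (simp add: pos_less_iff pos_props)
next
  fix y assume y: "pos \<iota> s k < y \<and> \<iota> y = k"
  then obtain t where t: "t \<ge> 1" "y = pos \<iota> t k" using pos_surj[of y] by auto
  then show "pos \<iota> (Suc s) k \<le> y" using y assms by (simp add: pos_less_iff pos_le_iff)
qed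

lemma pred_occ_pos: assumes "s \<ge> 1" shows "pred_occ \<iota> (pos \<iota> (Suc s) k) = pos \<iota> s k"
proof -
  let ?A = "{l. 1 \<le> l \<and> l < pos \<iota> (Suc s) k \<and> \<iota> l = \<iota> (pos \<iota> (Suc s) k)} \<union> {0}"
  have "Max ?A = pos \<iota> s k"
  proof (rule Max_eqI)
    show "finite ?A" by simp
    show "pos \<iota> s k \<in> ?A" using assms pos_props(1)[OF assms, of k] by (simp add: pos_props pos_less_iff)
    fix y assume "y \<in> ?A"
    then show "y \<le> pos \<iota> s k"
    proof
      assume y: "y \<in> {l. 1 \<le> l \<and> l < pos \<iota> (Suc s) k \<and> \<iota> l = \<iota> (pos \<iota> (Suc s) k)}"
      then obtain t where "t \<ge> 1" "y = pos \<iota> t k" using pos_surj[of y] by (auto simp: pos_props)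
      then show ?thesis using y assms by (simp add: pos_less_iff pos_le_iff)
    qed simp
  qed
  then show ?thesis by (simp add: pred_occ_def)
qed

text \<open>In the subsequence, which starts with j, occurrence m + 1 of j has index 2 m and that of
  k has index 2 m + 1. The separate pair i, i' lets one statement serve both orders in which the two
  letters may be named.\<close>

lemma pos_alternating:
  assumes "j \<noteq> k" and alt: "\<And>m. subseq2 \<iota> i i' m = (if even m then j else k)" and "{i, i'} = {j, k}"
  shows "pos \<iota> (Suc m) j < pos \<iota> (Suc m) k" "pos \<iota> (Suc m) k < pos \<iota> (Suc (Suc m)) j"
proof -
  define T where "T = {r. r \<ge> 1 \<and> \<iota> r \<in> {j, k}}"
  define e where "e = enumerate T"
  have T: "infinite T"
    using infinite_occ[of j] by (rule contrapos_nn) (auto elim: rev_finite_subset simp: T_def)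
  have e: "\<iota> (e m) = (if even m then j else k)" for m
    using alt[of m] assms(3) by (simp add: subseq2_def e_def T_def)
  have le: "e m \<le> e n \<longleftrightarrow> m \<le> n" for m n using T by (simp add: e_def)
  have inj: "inj e" using inj_enumerate[OF T] by (simp add: e_def)
  have T1: "e m \<ge> 1" for m using enumerate_in_set[OF T, of m] by (simp add: e_def T_def)
  have T1': "Suc 0 \<le> e m" for m using T1[of m] by simp
  have ex: "\<exists>n. t = e n" if "1 \<le> t" "\<iota> t \<in> {j, k}" for t
    using enumerate_Ex[OF T, of t] that by (force simp: e_def T_def)
  have j: "pos \<iota> (Suc m) j = e (2 * m)" for m
  proof (rule pos_unique)
    have "{t. 1 \<le> t \<and> t \<le> e (2 * m) \<and> \<iota> t = j} = (\<lambda>l. e (2 * l)) ` {..m}" (is "?L = ?R")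
    proof
      show "?L \<subseteq> ?R"
      proof
        fix t assume t: "t \<in> ?L"
        then obtain n where n: "t = e n" using ex[of t] by auto
        then have "even n" "n \<le> 2 * m" using t e[of n] assms(1) by (auto simp: le split: if_splits)
        then show "t \<in> ?R" using n by (auto elim!: evenE)
      qed
    qed (auto simp: e T1' le)
    moreover have "inj_on (\<lambda>l. e (2 * l)) {..m}" by (rule inj_onI) (use injD[OF inj] in fastforce)
    ultimately show "card {t. 1 \<le> t \<and> t \<le> e (2 * m) \<and> \<iota> t = j} = Suc m"
      by (simp add: card_image)
  qed (auto simp: T1' e)
  have k: "pos \<iota> (Suc m) k = e (2 * m + 1)" for m
  proof (rule pos_unique)
    have "{t. 1 \<le> t \<and> t \<le> e (2 * m + 1) \<and> \<iota> t = k} = (\<lambda>l. e (2 * l + 1)) ` {..m}" (is "?L = ?R")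
    proof
      show "?L \<subseteq> ?R"
      proof
        fix t assume t: "t \<in> ?L"
        then obtain n where n: "t = e n" using ex[of t] by auto
        then have "odd n" "n \<le> 2 * m + 1" using t e[of n] assms(1) by (auto simp: le split: if_splits)
        then show "t \<in> ?R" using n by (auto elim!: oddE)
      qed
    qed (auto simp: e T1' le)
    moreover have "inj_on (\<lambda>l. e (2 * l + 1)) {..m}" by (rule inj_onI) (use injD[OF inj] in fastforce)
    ultimately show "card {t. 1 \<le> t \<and> t \<le> e (2 * m + 1) \<and> \<iota> t = k} = Suc m"
      by (simp add: card_image)
  qed (auto simp: T1' e)
  have lt: "e m < e n \<longleftrightarrow> m < n" for m n using le by (simp flip: not_le)
  show "pos \<iota> (Suc m) j < pos \<iota> (Suc m) k" "pos \<iota> (Suc m) k < pos \<iota> (Suc (Suc m)) j"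
    unfolding j k lt by auto
qed

end

section \<open>Tropicalization along an adapted sequence\<close>

lemma pnum_cases: "pnum \<iota> i j = 0 \<or> pnum \<iota> i j = 1" by (simp add: pnum_def)

lemma pnum_bounds: "0 \<le> pnum \<iota> i j" "pnum \<iota> i j \<le> 1" by (simp_all add: pnum_def)

definition supp_pos :: "'i monomial \<Rightarrow> bool" where
  "supp_pos X \<longleftrightarrow> (\<forall>t i. Poly_Mapping.lookup X (t, i) \<noteq> 0 \<longrightarrow> t \<ge> 1)"

lemma supp_pos_add: "supp_pos X \<Longrightarrow> supp_pos Y \<Longrightarrow> supp_pos (X + Y)"
  unfolding supp_pos_def lookup_add by (metis add_0)
lemma supp_pos_diff: "supp_pos X \<Longrightarrow> supp_pos Y \<Longrightarrow> supp_pos (X - Y)"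
  unfolding supp_pos_def lookup_minus by (metis diff_0_right)
lemma supp_pos_Xvar: "s \<ge> 1 \<Longrightarrow> supp_pos (Xvar s k)"
  by (auto simp: supp_pos_def Xvar_def lookup_single when_def)

locale adapted_seq = index_seq \<iota> for \<iota> :: "nat \<Rightarrow> 'i::finite" +
  fixes a :: "'i \<Rightarrow> 'i \<Rightarrow> int"
  assumes gcm: "gen_cartan_matrix a" and adapted: "adapted a \<iota>"
begin

lemma a_diag [simp]: "a i i = 2" using gcm by (simp add: gen_cartan_matrix_def)
lemma a_neg_sym: "a i j < 0 \<Longrightarrow> a j i < 0"
  using gcm unfolding gen_cartan_matrix_def by (metis less_le not_less zero_less_numeral)
lemma a_nonpos: "i \<noteq> j \<Longrightarrow> a i j \<le> 0" using gcm by (simp add: gen_cartan_matrix_def)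

text \<open>The meaning of p_{j,k}: the occurrence of j between occurrences t and t + 1 of k has
  number t if k comes first in the sequence, and t + 1 if j does.\<close>

lemma pos_pnum:
  assumes "a k j < 0" "t \<ge> 1"
  shows "pos \<iota> t k < pos \<iota> (t + nat (pnum \<iota> j k)) j" 
        "pos \<iota> (t + nat (pnum \<iota> j k)) j < pos \<iota> (Suc t) k"
proof -
  have jk: "j \<noteq> k" using assms by auto
  obtain m where t: "t = Suc m" using assms by (cases t) auto
  have "a j k < 0" using assms a_neg_sym by blast
  then consider "\<forall>m. subseq2 \<iota> j k m = (if even m then k else j)"
    | "\<forall>m. subseq2 \<iota> j k m = (if even m then j else k)"
    using adapted unfolding adapted_def by meson
  then have "pos \<iota> t k < pos \<iota> (t + nat (pnum \<iota> j k)) j \<and>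
     pos \<iota> (t + nat (pnum \<iota> j k)) j < pos \<iota> (Suc t) k"
  proof cases
    case 1
    then have "pnum \<iota> j k = 0" using jk by (simp add: pnum_def)
    then show ?thesis using pos_alternating[of k j j k m] 1 jk by (simp add: t insert_commute)
  next
    case 2
    then have "pnum \<iota> j k = 1" by (simp add: pnum_def)
    then show ?thesis using pos_alternating[of j k j k] 2 jk by (simp add: t)
  qed
  then show "pos \<iota> t k < pos \<iota> (t + nat (pnum \<iota> j k)) j" 
        "pos \<iota> (t + nat (pnum \<iota> j k)) j < pos \<iota> (Suc t) k" by auto
qed

lemma pos_pnum_first:
  assumes "a k j < 0" "pnum \<iota> j k = 1" shows "pos \<iota> 1 j < pos \<iota> 1 k"
proof -
  have jk: "j \<noteq> k" using assms by auto
  have "a j k < 0" using assms a_neg_sym by blast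
  then have "\<forall>m. subseq2 \<iota> j k m = (if even m then j else k)"
    using adapted assms(2) jk unfolding adapted_def pnum_def by (metis even_zero zero_neq_one)
  then show ?thesis using pos_alternating(1)[of j k j k 0] jk by simp
qed

text \<open>Monotonicity of \<open>pos\<close> excludes every other occurrence of j from the gap,
  since its neighbours lie in the adjacent gaps.\<close>

lemma between_iff:
  assumes "a k j < 0" "t \<ge> 1" "l \<ge> 1"
  shows "pos \<iota> t k < pos \<iota> l j \<and> pos \<iota> l j < pos \<iota> (Suc t) k \<longleftrightarrow> int l = int t + pnum \<iota> j k"
proof -
  have jk: "j \<noteq> k" using assms by auto
  define p where "p = nat (pnum \<iota> j k)"
  have p: "int p = pnum \<iota> j k" by (simp add: p_def pnum_def)
  have "l = t + p" if l: "pos \<iota> t k < pos \<iota> l j" "pos \<iota> l j < pos \<iota> (Suc t) k"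
  proof (rule linorder_cases[of l "t + p"])
    assume lt: "l < t + p"
    have "pos \<iota> l j < pos \<iota> t k"
    \<comment> \<open>Before the first k there is no gap to compare with. Here p = 1, so j precedes
      k in the sequence.\<close>
    proof (cases "t = 1")
      case True
      then have "p = 1" "l = 1" using lt assms(3) p pnum_cases[of \<iota> j k] by auto
      then show ?thesis using pos_pnum_first[OF assms(1)] p True by simp
    next
      case False
      then have "pos \<iota> l j \<le> pos \<iota> (t - 1 + p) j" using lt assms by (subst pos_le_iff) auto
      also have "t - 1 \<ge> 1" using False assms(2) by simp
      from pos_pnum(2)[OF assms(1) this] have "pos \<iota> (t - 1 + p) j < pos \<iota> t k"
        using assms(2) by (simp add: p_def)
      finally show ?thesis .
    qed
    then show ?thesis using l by simp
  next
    assume "l > t + p"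
    then have "pos \<iota> (Suc t + p) j \<le> pos \<iota> l j" using assms by (simp add: pos_le_iff)
    then show ?thesis using pos_pnum(1)[OF assms(1), of "Suc t"] l by (simp add: p_def)
  qed
  then have "pos \<iota> t k < pos \<iota> l j \<and> pos \<iota> l j < pos \<iota> (Suc t) k \<longleftrightarrow> l = t + p"
    using pos_pnum[OF assms(1,2)] unfolding p_def by blast
  then show ?thesis using p by (metis of_nat_add of_nat_eq_iff)
qed

abbreviation Am :: "int \<Rightarrow> 'i \<Rightarrow> 'i monomial" where "Am \<equiv> Amon (\<lambda>i j. a j i) \<iota>"

lemma lookup_Am:
  "Poly_Mapping.lookup (Am s k) (l, j) = (if j = k then (if l = s \<or> l = s + 1 then 1 else 0)
     else if a k j < 0 \<and> l = s + pnum \<iota> j k then a k j else 0)"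
proof -
  have "Poly_Mapping.lookup (\<Sum>j | a k j < 0. Poly_Mapping.single (s + pnum \<iota> j k, j) (a k j)) (l, j)
     = (\<Sum>j' | a k j' < 0. if j' = j then (if l = s + pnum \<iota> j k then a k j else 0) else 0)"
    unfolding lookup_sum by (rule sum.cong) (auto simp: lookup_single when_def)
  also have "\<dots> = (if a k j < 0 \<and> l = s + pnum \<iota> j k then a k j else 0)"
    by (subst sum.delta) auto
  finally show ?thesis
    by (auto simp: Amon_def lookup_add Xvar_def lookup_single when_def)
qed

lemma supp_pos_Am: "s \<ge> 1 \<Longrightarrow> supp_pos (Am s k)"
  using pnum_bounds[of \<iota>] by (auto simp: supp_pos_def lookup_Am add_increasing2 split: if_splits)

lemma lookup_Trop:
  assumes "supp_pos X"
  shows "t \<ge> 1 \<Longrightarrow> Poly_Mapping.lookup (Trop \<iota> X) (pos \<iota> t k) = of_int (Poly_Mapping.lookup X (int t, k))"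
    and "Poly_Mapping.lookup (Trop \<iota> X) 0 = 0"
proof -
  have ge: "s \<ge> 1" if "(s, j) \<in> Poly_Mapping.keys X" for s j
    using assms that by (auto simp: supp_pos_def in_keys_iff)
  assume t: "t \<ge> 1"
  have "Poly_Mapping.lookup (Trop \<iota> X) (pos \<iota> t k) =
    (\<Sum>p\<in>Poly_Mapping.keys X. if p = (int t, k) then of_int (Poly_Mapping.lookup X (int t, k)) else 0)"
    unfolding Trop_def lookup_sum
  proof (rule sum.cong[OF refl], clarify)
    fix s j assume "(s, j) \<in> Poly_Mapping.keys X"
    from ge[OF this] have "pos \<iota> (nat s) j = pos \<iota> t k \<longleftrightarrow> (s, j) = (int t, k)"
      using t by (subst pos_eq_iff) auto
    then show "Poly_Mapping.lookup (Poly_Mapping.single (pos \<iota> (nat s) j)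
        (of_int (Poly_Mapping.lookup X (s, j)))) (pos \<iota> t k) =
        (if (s, j) = (int t, k) then rat_of_int (Poly_Mapping.lookup X (int t, k)) else 0)"
      by (auto simp: lookup_single when_def)
  qed
  then show "Poly_Mapping.lookup (Trop \<iota> X) (pos \<iota> t k) = of_int (Poly_Mapping.lookup X (int t, k))"
    by (simp add: in_keys_iff)
next
  have "pos \<iota> (nat s) j \<noteq> 0" if "(s, j) \<in> Poly_Mapping.keys X" for s j
  proof -
    have "s \<ge> 1" using assms that unfolding supp_pos_def in_keys_iff by blast
    then have "pos \<iota> (nat s) j \<ge> 1" by (intro pos_props) simp
    then show ?thesis by simp
  qed
  then show "Poly_Mapping.lookup (Trop \<iota> X) 0 = 0"
    unfolding Trop_def lookup_sum
    by (intro sum.neutral ballI) (force simp: lookup_single when_def)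
qed

lemma lform_eqI:
  assumes "Poly_Mapping.lookup \<phi> 0 = Poly_Mapping.lookup \<psi> 0"
    "\<And>t k. t \<ge> 1 \<Longrightarrow> Poly_Mapping.lookup \<phi> (pos \<iota> t k) = Poly_Mapping.lookup \<psi> (pos \<iota> t k)"
  shows "\<phi> = (\<psi> :: lform)"
proof (rule poly_mapping_eqI)
  fix r show "Poly_Mapping.lookup \<phi> r = Poly_Mapping.lookup \<psi> r"
  proof (cases "r = 0")
    case False
    then obtain t where "t \<ge> 1" "r = pos \<iota> t (\<iota> r)" using pos_surj[of r] by auto
    then show ?thesis using assms(2)[of t "\<iota> r"] by simp
  qed (simp add: assms)
qed

lemma Trop_add: "supp_pos X \<Longrightarrow> supp_pos Y \<Longrightarrow> Trop \<iota> (X + Y) = Trop \<iota> X + Trop \<iota> Y"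
  by (rule lform_eqI) (simp_all add: lookup_Trop lookup_add supp_pos_add)

lemma Trop_diff: "supp_pos X \<Longrightarrow> supp_pos Y \<Longrightarrow> Trop \<iota> (X - Y) = Trop \<iota> X - Trop \<iota> Y"
  by (rule lform_eqI) (simp_all add: lookup_Trop lookup_minus supp_pos_diff)

lemma Trop_inj: "supp_pos X \<Longrightarrow> supp_pos Y \<Longrightarrow> Trop \<iota> X = Trop \<iota> Y \<Longrightarrow> X = Y"
proof (rule poly_mapping_eqI)
  fix p :: "int \<times> 'i" assume X: "supp_pos X" "supp_pos Y" "Trop \<iota> X = Trop \<iota> Y"
  obtain s k where p: "p = (s, k)" by (cases p)
  show "Poly_Mapping.lookup X p = Poly_Mapping.lookup Y p"
  proof (cases "s \<ge> 1")
    case True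
    then show ?thesis using X(3) lookup_Trop(1)[OF X(1), of "nat s" k] lookup_Trop(1)[OF X(2), of "nat s" k]
      by (simp add: p)
  next
    case False
    then have "Poly_Mapping.lookup X p = 0" "Poly_Mapping.lookup Y p = 0"
      using X(1,2) unfolding supp_pos_def p by blast+
    then show ?thesis by simp
  qed
qed

lemma Trop_Xvar:
  assumes "s \<ge> 1" shows "Trop \<iota> (Xvar (int s) k) = xcoord (pos \<iota> s k)"
proof -
  have sp: "supp_pos (Xvar (int s) k)" using assms by (intro supp_pos_Xvar) simp
  show ?thesis
  proof (rule lform_eqI)
    show "Poly_Mapping.lookup (Trop \<iota> (Xvar (int s) k)) 0 = Poly_Mapping.lookup (xcoord (pos \<iota> s k)) 0"
      using pos_props(1)[OF assms, of k]
      unfolding lookup_Trop(2)[OF sp] by (simp add: xcoord_def lookup_single when_def)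
    fix t j assume t: "(t::nat) \<ge> 1"
    show "Poly_Mapping.lookup (Trop \<iota> (Xvar (int s) k)) (pos \<iota> t j) = Poly_Mapping.lookup (xcoord (pos \<iota> s k)) (pos \<iota> t j)"
      unfolding lookup_Trop(1)[OF sp t]
      using t assms by (auto simp: Xvar_def xcoord_def lookup_single when_def pos_eq_iff)
  qed
qed

lemma lookup_bform:
  assumes "r \<ge> 1"
  shows "Poly_Mapping.lookup (bform a \<iota> r) l = (if l = r then 1 else 0)
    + (if r < l \<and> l < succ_occ \<iota> r then of_int (a (\<iota> r) (\<iota> l)) else 0) + (if l = succ_occ \<iota> r then 1 else 0)"
proof -
  have "Poly_Mapping.lookup (\<Sum>j | r < j \<and> j < succ_occ \<iota> r. Poly_Mapping.single j (rat_of_int (a (\<iota> r) (\<iota> j)))) l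
    = (\<Sum>j | r < j \<and> j < succ_occ \<iota> r. if j = l then rat_of_int (a (\<iota> r) (\<iota> l)) else 0)"
    unfolding lookup_sum by (rule sum.cong) (auto simp: lookup_single when_def)
  then show ?thesis using assms by (auto simp: bform_def lookup_add xcoord_def lookup_single when_def)
qed

text \<open>By \<open>between_iff\<close> the sum over the gap in \<open>bform\<close> has one term
  for each neighbour j, exactly where \<open>Amon\<close> places it. The coefficient is a k j on
  both sides because \<open>Am\<close> is formed with the transposed matrix.\<close>

lemma Trop_Am: assumes "t \<ge> 1" shows "Trop \<iota> (Am (int t) k) = bform a \<iota> (pos \<iota> t k)"
proof (rule lform_eqI)
  note pt = pos_props[OF assms, of k] succ_occ_pos[OF assms, of k] pos_props[of "Suc t" k]
  have sp: "supp_pos (Am (int t) k)" using assms by (intro supp_pos_Am) simp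
  show "Poly_Mapping.lookup (Trop \<iota> (Am (int t) k)) 0 = Poly_Mapping.lookup (bform a \<iota> (pos \<iota> t k)) 0"
    using pt by (simp add: lookup_Trop(2)[OF sp] lookup_bform)
  fix l j assume l: "(l::nat) \<ge> 1"
  show "Poly_Mapping.lookup (Trop \<iota> (Am (int t) k)) (pos \<iota> l j) = Poly_Mapping.lookup (bform a \<iota> (pos \<iota> t k)) (pos \<iota> l j)"
  proof (cases "j = k")
    case True
    then show ?thesis using l assms pt
      by (auto simp: lookup_Trop(1)[OF sp l] lookup_bform lookup_Am pos_eq_iff pos_less_iff)
  next
    case False
    have "a k j = 0 \<or> a k j < 0" using a_nonpos[of k j] False by auto
    then show ?thesis using l assms pt False between_iff[of k j t l]
      by (auto simp: lookup_Trop(1)[OF sp l] lookup_bform lookup_Am pos_eq_iff pos_props)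
  qed
qed

end

section \<open>Tropicalized monomials\<close>

subsection \<open>Partial sums of exponents\<close>

lemma finite_color_support: "finite {l. Poly_Mapping.lookup X (l, i) \<noteq> 0}"
proof -
  have "{l. Poly_Mapping.lookup X (l, i) \<noteq> 0} \<subseteq> fst ` Poly_Mapping.keys X"
    by (force simp: in_keys_iff)
  then show ?thesis by (rule finite_subset) simp
qed

lemma psum_superset:
  assumes "finite F" "{l. Poly_Mapping.lookup X (l, i) \<noteq> 0} \<subseteq> F"
  shows "psum i X s = (\<Sum>l | l \<in> F \<and> l \<le> s. Poly_Mapping.lookup X (l, i))"
  unfolding psum_def by (rule sum.mono_neutral_left) (use assms in auto)

lemma psum_add: "psum i (X + Y) s = psum i X s + psum i Y s"
proof -
  let ?F = "{l. Poly_Mapping.lookup X (l, i) \<noteq> 0} \<union> {l. Poly_Mapping.lookup Y (l, i) \<noteq> 0}"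
  have "finite ?F" by (simp add: finite_color_support)
  then show ?thesis
    by (subst (1 2 3) psum_superset[of ?F]) (auto simp: lookup_add sum.distrib)
qed

lemma psum_step: "psum i X s = psum i X (s - 1) + Poly_Mapping.lookup X (s, i)"
proof -
  let ?F = "insert s {l. Poly_Mapping.lookup X (l, i) \<noteq> 0}"
  have F: "finite ?F" by (simp add: finite_color_support)
  have "{l. l \<in> ?F \<and> l \<le> s} = insert s {l. l \<in> ?F \<and> l \<le> s - 1}" by auto
  then show ?thesis
    using F by (subst (1 2) psum_superset[of ?F]) auto
qed

lemma psum_eq_0: "supp_pos X \<Longrightarrow> s < 1 \<Longrightarrow> psum i X s = 0"
  unfolding psum_def supp_pos_def by (rule sum.neutral) (metis (mono_tags, lifting) mem_Collect_eq not_less order_trans)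

lemma psum_stable:
  assumes "\<forall>l>s. Poly_Mapping.lookup X (l, i) = 0" "s \<le> s'" shows "psum i X s' = psum i X s"
  unfolding psum_def by (rule sum.cong) (use assms in \<open>auto simp: not_less[symmetric]\<close>)

lemma finite_range_psum: "finite (range (psum i X))"
proof -
  have "range (psum i X) \<subseteq> (\<lambda>A. \<Sum>l\<in>A. Poly_Mapping.lookup X (l, i)) ` Pow {l. Poly_Mapping.lookup X (l, i) \<noteq> 0}"
    by (auto simp: psum_def)
  then show ?thesis by (rule finite_subset) (simp add: finite_color_support)
qed

lemma psum_le_mphi: "psum i X s \<le> mphi i X"
  unfolding mphi_def by (rule Max_ge[OF finite_range_psum]) simp

lemma mphi_attained: "\<exists>s. psum i X s = mphi i X"
  using Max_in[OF finite_range_psum[of i X]] unfolding mphi_def by auto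

lemma mphi_nonneg: "supp_pos X \<Longrightarrow> mphi i X \<ge> 0"
  using psum_le_mphi[of i X 0] psum_eq_0[of X 0 i] by simp

text \<open>\<open>LEAST\<close> over the integers needs a lower bound; shifting by it reduces the
  claim to natural numbers.\<close>

lemma int_least_exists:
  assumes "P r" "\<And>y. P y \<Longrightarrow> c \<le> (y::int)" shows "\<exists>r. P r \<and> (\<forall>y. P y \<longrightarrow> r \<le> y)"
proof -
  define Q where "Q n = P (c + int n)" for n
  have Q: "Q (nat (y - c))" if "P y" for y using assms(2)[OF that] that by (simp add: Q_def)
  then have *: "Q (LEAST n. Q n)" using assms(1) by (auto intro: LeastI)
  have "c + int (LEAST n. Q n) \<le> y" if "P y" for y
    using Least_le[of Q, OF Q[OF that]] assms(2)[OF that] by linarith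
  with * show ?thesis unfolding Q_def by blast
qed

lemma int_greatest_exists:
  assumes "P r" "\<And>y. P y \<Longrightarrow> y \<le> (c::int)" shows "\<exists>r. P r \<and> (\<forall>y. P y \<longrightarrow> y \<le> r)"
proof -
  obtain n where n: "P (- n)" "\<And>y. P (- y) \<Longrightarrow> n \<le> y"
    using int_least_exists[of "\<lambda>y. P (- y)" "- r" "- c"] assms by force
  have "y \<le> - n" if "P y" for y using n(2)[of "- y"] that by simp
  with n(1) show ?thesis by blast
qed

text \<open>At the first index where the maximum is attained, the partial sum has just increased, so
  the exponent there is positive. Hence a crystal step on monomials is a positive action.\<close>

lemma nf_props:
  assumes "supp_pos X" "mphi i X > 0"
  shows "psum i X (nf i X) = mphi i X" "Poly_Mapping.lookup X (nf i X, i) > 0" "nf i X \<ge> 1"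
proof -
  let ?P = "\<lambda>r. mphi i X = psum i X r"
  obtain s where s: "?P s" using mphi_attained by metis
  have "1 \<le> y" if "?P y" for y
    using psum_eq_0[OF assms(1), of y i] assms(2) that by (cases "y < 1") auto
  then obtain r where r: "?P r" "\<forall>y. ?P y \<longrightarrow> r \<le> y" and r1: "r \<ge> 1"
    using int_least_exists[of ?P s 1] s by blast
  then have nf: "nf i X = r" unfolding nf_def by (intro Least_equality) auto
  have "psum i X (r - 1) \<noteq> mphi i X" using spec[OF r(2), of "r - 1"] by auto
  then have "psum i X (r - 1) < psum i X r" using psum_le_mphi[of i X "r - 1"] r(1) by linarith
  then show "psum i X (nf i X) = mphi i X" "Poly_Mapping.lookup X (nf i X, i) > 0" "nf i X \<ge> 1"
    using psum_step[of i X r] r r1 by (auto simp: nf)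
qed

text \<open>The monomial counterpart of \<open>Xi_pos\<close>: a factor A may be divided out at any
  variable with positive exponent, not only at \<open>nf\<close>.\<close>

inductive_set pos_monomials ::
    "('i::finite \<Rightarrow> 'i \<Rightarrow> int) \<Rightarrow> (nat \<Rightarrow> 'i) \<Rightarrow> int \<Rightarrow> 'i \<Rightarrow> 'i monomial set"
  for b \<iota> s k where
  base: "Xvar s k \<in> pos_monomials b \<iota> s k"
| step: "X \<in> pos_monomials b \<iota> s k \<Longrightarrow> t \<ge> 1 \<Longrightarrow> Poly_Mapping.lookup X (t, i) > 0 \<Longrightarrow>
         X - Amon b \<iota> t i \<in> pos_monomials b \<iota> s k"

context adapted_seq
begin

abbreviation PM :: "int \<Rightarrow> 'i \<Rightarrow> 'i monomial set" where "PM \<equiv> pos_monomials (\<lambda>i j. a j i) \<iota>"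
abbreviation MM :: "int \<Rightarrow> 'i \<Rightarrow> 'i monomial set" where "MM \<equiv> monomials (\<lambda>i j. a j i) \<iota>"

lemma supp_pos_PM: "X \<in> PM s k \<Longrightarrow> s \<ge> 1 \<Longrightarrow> supp_pos X"
  by (induction rule: pos_monomials.induct) (auto simp: supp_pos_Xvar supp_pos_diff supp_pos_Am)

text \<open>Among the factors A with t \<ge> 1, only A_{1,i} has a positive exponent at X_{1,i}.
  That exponent is 1, and the factor is divided out only if the integer exponent present is at least
  1.\<close>

lemma first_exponent_nonneg: "X \<in> PM s k \<Longrightarrow> Poly_Mapping.lookup X (1, i) \<ge> 0"
proof (induction rule: pos_monomials.induct)
  case base
  then show ?case by (simp add: Xvar_def lookup_single when_def)
next
  case (step X t j)
  then show ?case by (auto simp: lookup_minus lookup_Am)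
qed

lemma MM_subset_PM: assumes "s \<ge> 1" shows "MM s k \<subseteq> PM s k"
proof
  fix X assume "X \<in> MM s k"
  then show "X \<in> PM s k"
  proof (induction rule: monomials.induct)
    case (step X i Y)
    then have "mphi i X > 0" "Y = X - Am (nf i X) i" by (auto simp: mf_def split: if_splits)
    then show ?case
      using step.IH nf_props[OF supp_pos_PM[OF step.IH assms], of i] by (auto intro: pos_monomials.step)
  qed (rule pos_monomials.base)
qed

lemma Trop_PM: assumes s: "s \<ge> 1" shows "Trop \<iota> ` PM (int s) k = Xi_pos a \<iota> s k"
proof
  have s': "int s \<ge> 1" using s by simp
  show "Trop \<iota> ` PM (int s) k \<subseteq> Xi_pos a \<iota> s k"
  proof clarify
    fix X assume "X \<in> PM (int s) k"
    then show "Trop \<iota> X \<in> Xi_pos a \<iota> s k"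
    proof (induction rule: pos_monomials.induct)
      case base
      then show ?case using s by (simp add: Trop_Xvar Xi_pos.base)
    next
      case (step X t i)
      note sp = supp_pos_PM[OF step(1) s']
      obtain n where n: "t = int n" "n \<ge> 1" using step(2) by (metis int_one_le_iff_zero_less less_eq_Suc_le One_nat_def zero_less_imp_eq_int of_nat_0_less_iff)
      have "Poly_Mapping.lookup (Trop \<iota> X) (pos \<iota> n i) > 0"
        using step(3) lookup_Trop(1)[OF sp n(2)] by (simp add: n)
      moreover from this have "Trop \<iota> (X - Am t i) = Sop a \<iota> (pos \<iota> n i) (Trop \<iota> X)"
        using n by (simp add: Trop_diff sp supp_pos_Am Trop_Am Sop_def)
      ultimately show ?case using Xi_pos.step[OF step.IH pos_props(1)[OF n(2)]] by simp
    qed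
  qed
  show "Xi_pos a \<iota> s k \<subseteq> Trop \<iota> ` PM (int s) k"
  proof
    fix \<phi> assume "\<phi> \<in> Xi_pos a \<iota> s k"
    then show "\<phi> \<in> Trop \<iota> ` PM (int s) k"
    proof (induction rule: Xi_pos.induct)
      case base
      then show ?case using pos_monomials.base Trop_Xvar[OF s] by (metis image_eqI)
    next
      case (step \<phi> r)
      then obtain X where X: "X \<in> PM (int s) k" "\<phi> = Trop \<iota> X" by blast
      note sp = supp_pos_PM[OF X(1) s']
      obtain n where n: "n \<ge> 1" "r = pos \<iota> n (\<iota> r)" using pos_surj[OF step(2)] by blast
      then have "Poly_Mapping.lookup X (int n, \<iota> r) > 0"
        using step(3) lookup_Trop(1)[OF sp n(1), of "\<iota> r"] X(2) by simp
      then have "X - Am (int n) (\<iota> r) \<in> PM (int s) k" using n X(1) by (intro pos_monomials.step) auto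
      moreover have "Trop \<iota> (X - Am (int n) (\<iota> r)) = Sop a \<iota> r \<phi>"
        using step(3) n X(2) by (simp add: Trop_diff sp supp_pos_Am Trop_Am[OF n(1)] Sop_def)
      ultimately show ?case by (metis image_eqI)
    qed
  qed
qed

subsection \<open>Combinations of the monomials A\<close>

text \<open>The product of the A_{t,i} with exponents m, written additively. As a
  \<open>frag_extend\<close> it is additive in m.\<close>

definition comb :: "(int \<times> 'i \<Rightarrow>\<^sub>0 int) \<Rightarrow> 'i monomial" where
  "comb m = frag_extend (\<lambda>(t, i). Am t i) m"

text \<open>The sum of the coefficients of m, obtained by collapsing all basis elements to
  \<open>()\<close>.\<close>

definition mdeg :: "(int \<times> 'i \<Rightarrow>\<^sub>0 int) \<Rightarrow> int" where
  "mdeg m = Poly_Mapping.lookup (frag_extend (\<lambda>_. frag_of ()) m) ()"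

lemma comb_simps: "comb 0 = 0" "comb (m + m') = comb m + comb m'" "comb (m - m') = comb m - comb m'"
    "comb (frag_of (t, i)) = Am t i"
  by (simp_all add: comb_def frag_extend_add frag_extend_diff)

lemma mdeg_simps: "mdeg 0 = 0" "mdeg (m + m') = mdeg m + mdeg m'" "mdeg (frag_of p) = 1"
  by (simp_all add: mdeg_def frag_extend_add lookup_add)

lemma lookup_comb:
  "Poly_Mapping.lookup (comb m) p =
     (\<Sum>(t, j)\<in>Poly_Mapping.keys m. Poly_Mapping.lookup m (t, j) * Poly_Mapping.lookup (Am t j) p)"
  unfolding comb_def frag_extend_def lookup_sum by (rule sum.cong) auto

text \<open>In the top layer, an index whose first occurrence in the sequence comes last only meets its
  own contribution.\<close>

lemma comb_top:
  assumes "m \<noteq> 0"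
  shows "\<exists>T i. Poly_Mapping.lookup m (T, i) \<noteq> 0 \<and> (\<forall>(t, j)\<in>Poly_Mapping.keys m. t \<le> T) \<and>
    Poly_Mapping.lookup (comb m) (T + 1, i) = Poly_Mapping.lookup m (T, i) \<and>
    (\<forall>l>T + 1. Poly_Mapping.lookup (comb m) (l, i) = 0)"
proof -
  define T where "T = Max (fst ` Poly_Mapping.keys m)"
  have ne: "Poly_Mapping.keys m \<noteq> {}" using assms by simp
  then have "T \<in> fst ` Poly_Mapping.keys m" unfolding T_def by (intro Max_in) auto
  then obtain i0 where i0: "(T, i0) \<in> Poly_Mapping.keys m" by auto
  have T: "t \<le> T" if "(t, j) \<in> Poly_Mapping.keys m" for t j
    unfolding T_def by (rule Max_ge) (use that in force)+
  define I where "I = {i. (T, i) \<in> Poly_Mapping.keys m}"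
  define i where "i = (ARG_MAX (pos \<iota> 1) i. i \<in> I)"
  have "finite I" "i0 \<in> I" using i0 by (auto simp: I_def)
  have i: "i \<in> I \<and> (\<forall>j\<in>I. pos \<iota> 1 j \<le> pos \<iota> 1 i)"
  proof -
    have "Max (pos \<iota> 1 ` I) \<in> pos \<iota> 1 ` I" using \<open>i0 \<in> I\<close> by (intro Max_in) auto
    then obtain i' where i': "i' \<in> I" "pos \<iota> 1 i' = Max (pos \<iota> 1 ` I)" by auto
    then have "\<forall>j\<in>I. pos \<iota> 1 j \<le> pos \<iota> 1 i'" by simp
    then show ?thesis unfolding i_def using i'(1)
      by (intro arg_maxI[where Q = "\<lambda>i. i \<in> I \<and> (\<forall>j\<in>I. pos \<iota> 1 j \<le> pos \<iota> 1 i)"]) (auto simp: not_less)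
  qed
  have "Poly_Mapping.lookup (Am t j) (l, i) = (if (t, j) = (T, i) \<and> l = T + 1 then 1 else 0)"
    if k: "(t, j) \<in> Poly_Mapping.keys m" and l: "l \<ge> T + 1" for t j l
  proof (cases "j = i")
    case True
    then show ?thesis using T[OF k] l by (auto simp: lookup_Am)
  next
    case False
    \<comment> \<open>A neighbour j reaches level T + 1 in colour i only from the top layer, and
      only if i first occurs before j, against the choice of i.\<close>
    have "\<not> (a j i < 0 \<and> l = t + pnum \<iota> i j)"
    proof
      assume h: "a j i < 0 \<and> l = t + pnum \<iota> i j"
      then have "t = T" "pnum \<iota> i j = 1" using T[OF k] l pnum_bounds[of \<iota> i j] by auto
      then have "pos \<iota> 1 i < pos \<iota> 1 j" "j \<in> I" using pos_pnum_first[of j i] h k by (auto simp: I_def)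
      then show False using i by (meson not_less)
    qed
    then show ?thesis using False by (auto simp: lookup_Am)
  qed
  note Am_l = this
  have "Poly_Mapping.lookup (comb m) (l, i) = 
     (\<Sum>p\<in>Poly_Mapping.keys m. if p = (T, i) then (if l = T + 1 then Poly_Mapping.lookup m (T, i) else 0) else 0)"
    if "l \<ge> T + 1" for l
    unfolding lookup_comb
  proof (rule sum.cong[OF refl], clarify)
    fix t j assume "(t, j) \<in> Poly_Mapping.keys m"
    from Am_l[OF this that] show "Poly_Mapping.lookup m (t, j) * Poly_Mapping.lookup (Am t j) (l, i) =
      (if (t, j) = (T, i) then (if l = T + 1 then Poly_Mapping.lookup m (T, i) else 0) else 0)" by auto
  qed
  then have "Poly_Mapping.lookup (comb m) (l, i) = (if l = T + 1 then Poly_Mapping.lookup m (T, i) else 0)"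
    if "l \<ge> T + 1" for l
    using that i by (simp add: I_def)
  then show ?thesis using i T by (intro exI[of _ T] exI[of _ i]) (auto simp: I_def in_keys_iff)
qed

text \<open>Linear independence of the A: m, and with it the degree driving the later induction, is
  determined by the monomial.\<close>

lemma comb_inj: "comb m = comb m' \<Longrightarrow> m = m'"
proof (rule ccontr)
  assume "comb m = comb m'" "m \<noteq> m'"
  then have "comb (m - m') = 0" "m - m' \<noteq> 0" by (simp_all add: comb_simps)
  with comb_top[of "m - m'"] show False by auto
qed

text \<open>The last clause holds because the first step away from X_{s,k} can only divide out
  A_{s,k}. It forces the top level T of m to satisfy s \<le> T, so that X_{s,k} cannot disturb the
  exponents above T.\<close>

lemma PM_comb:
  assumes "X \<in> PM s k"
  shows "\<exists>m. X = Xvar s k - comb m \<and> mdeg m \<ge> 0 \<and> (\<forall>p. Poly_Mapping.lookup m p \<ge> 0) \<and>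
     (X = Xvar s k \<or> Poly_Mapping.lookup m (s, k) > 0)"
  using assms
proof (induction rule: pos_monomials.induct)
  case base
  show ?case by (rule exI[of _ 0]) (simp add: comb_simps mdeg_simps)
next
  case (step X t i)
  then obtain m where m: "X = Xvar s k - comb m" "mdeg m \<ge> 0" "\<forall>p. Poly_Mapping.lookup m p \<ge> 0"
     "X = Xvar s k \<or> Poly_Mapping.lookup m (s, k) > 0" by blast
  have "(t, i) = (s, k)" if "X = Xvar s k"
    using step(3) that by (auto simp: Xvar_def lookup_single when_def split: if_splits)
  moreover have l: "Poly_Mapping.lookup (m + frag_of (t, i)) p = Poly_Mapping.lookup m p + (if p = (t, i) then 1 else 0)" for p
    by (simp add: lookup_add lookup_single when_def eq_commute)
  ultimately have "Poly_Mapping.lookup (m + frag_of (t, i)) (s, k) > 0"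
    using m(4) m(3)[rule_format, of "(s, k)"] unfolding l by (cases "X = Xvar s k") auto
  moreover have "Poly_Mapping.lookup (m + frag_of (t, i)) p \<ge> 0" for p
    using m(3)[rule_format, of p] unfolding l by simp
  ultimately show ?case using m(1,2)
    by (intro exI[of _ "m + frag_of (t, i)"]) (simp add: comb_simps mdeg_simps)
qed

lemma PM_subset_MM:
  assumes s: "s \<ge> 1" and closed: "\<And>X t i. X \<in> PM s k \<Longrightarrow> t \<ge> 1 \<Longrightarrow>
      Poly_Mapping.lookup X (t + 1, i) < 0 \<Longrightarrow> X + Am t i \<in> PM s k"
  shows "PM s k \<subseteq> MM s k"
proof -
  have "X \<in> MM s k" if "X \<in> PM s k" "X = Xvar s k - comb m" for X m
    using that
  proof (induction "nat (mdeg m)" arbitrary: X m rule: less_induct)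
    case less
    note sp = supp_pos_PM[OF less.prems(1) s]
    show ?case
    proof (cases "X = Xvar s k")
      case False
      obtain m' where m': "X = Xvar s k - comb m'" "\<forall>p. Poly_Mapping.lookup m' p \<ge> 0"
        "Poly_Mapping.lookup m' (s, k) > 0"
        using PM_comb[OF less.prems(1)] False by blast
      then have "m' = m" using less.prems(2) comb_inj by simp
      then have m: "\<forall>p. Poly_Mapping.lookup m p \<ge> 0" "Poly_Mapping.lookup m (s, k) > 0" using m' by auto
      then have "m \<noteq> 0" by auto
      then obtain T i where T: "Poly_Mapping.lookup m (T, i) \<noteq> 0" "\<forall>(t, j)\<in>Poly_Mapping.keys m. t \<le> T"
        "Poly_Mapping.lookup (comb m) (T + 1, i) = Poly_Mapping.lookup m (T, i)"
        "\<forall>l>T + 1. Poly_Mapping.lookup (comb m) (l, i) = 0"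
        using comb_top by blast
      have sT: "s \<le> T" using bspec[OF T(2), of "(s, k)"] m(2) by (simp add: in_keys_iff)
      have neg: "Poly_Mapping.lookup X (T + 1, i) < 0"
        using T(1,3) m(1)[rule_format, of "(T, i)"] sT
        by (simp add: less.prems(2) lookup_minus Xvar_def lookup_single when_def)
      have zero: "\<forall>l>T + 1. Poly_Mapping.lookup X (l, i) = 0"
        using T(4) sT by (simp add: less.prems(2) lookup_minus Xvar_def lookup_single when_def)
      \<comment> \<open>Beyond T the partial sums stay at their value at T + 1, which is below the
        one at T.\<close>
      have "psum i X r < mphi i X" if "r \<ge> T + 1" for r
        using psum_stable[OF zero that] psum_step[of i X "T + 1"] neg psum_le_mphi[of i X T] by simp
      then have bd: "y \<le> T" if "psum i X y = mphi i X" for y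
        using that by (metis add.commute less_irrefl linorder_not_le zless_imp_add1_zle)
      obtain r0 where "psum i X r0 = mphi i X" using mphi_attained[of i X] by blast
      \<comment> \<open>The step to be undone sits at the last maximum n, which need not be T.
        Multiplying by A_{n,i} raises the partial sums by 1 at n and by 2 beyond n, where they were
        strictly smaller; so n becomes the first maximum of the new monomial, and \<open>mf\<close>
        leads back to X.\<close>
      then have "\<exists>n. psum i X n = mphi i X \<and> (\<forall>y. psum i X y = mphi i X \<longrightarrow> y \<le> n)"
        using bd by (rule int_greatest_exists)
      then obtain n where n: "psum i X n = mphi i X" "\<And>y. psum i X y = mphi i X \<Longrightarrow> y \<le> n"
        by blast
      have gt: "psum i X r < mphi i X" if "r > n" for r
        using n(2)[of r] psum_le_mphi[of i X r] that by (force simp: less_le)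
      have "Poly_Mapping.lookup X (n + 1, i) < 0" using psum_step[of i X "n + 1"] gt[of "n + 1"] n(1) by simp
      moreover have "n + 1 \<ge> 1" using calculation sp unfolding supp_pos_def by (metis less_irrefl)
      \<comment> \<open>The exponent at level n + 1 is negative, whereas exponents at level 1 never
        are.\<close>
      moreover have "n \<noteq> 0" using first_exponent_nonneg[OF less.prems(1), of i] calculation(1) by auto
      ultimately have n1: "n \<ge> 1" and Y: "X + Am n i \<in> PM s k" using closed[OF less.prems(1), of n i] by auto
      define Y where "Y = X + Am n i"
      have pA: "psum i (Am n i) r = (if r < n then 0 else if r = n then 1 else 2)" for r
      proof -
        have "psum i (Am n i) r = (\<Sum>l | l \<in> {n, n + 1} \<and> l \<le> r. 1)"
          by (subst psum_superset[of "{n, n + 1}"]) (auto simp: lookup_Am intro!: sum.cong split: if_splits)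
        also have "{l. l \<in> {n, n + 1} \<and> l \<le> r} = (if r < n then {} else if r = n then {n} else {n, n + 1})" by auto
        finally show ?thesis by (simp split: if_splits)
      qed
      have pY: "psum i Y r \<le> mphi i X + 1" for r
        using psum_le_mphi[of i X r] gt[of r] by (auto simp: Y_def psum_add pA)
      have pYn: "psum i Y n = mphi i X + 1" using n(1) by (simp add: Y_def psum_add pA)
      have phiY: "mphi i Y = mphi i X + 1"
        unfolding mphi_def[of i Y] using pY pYn finite_range_psum by (intro Max_eqI) (auto intro: range_eqI[of _ _ n])
      have nfY: "nf i Y = n"
        unfolding nf_def
      proof (rule Least_equality)
        fix y assume "mphi i Y = psum i Y y"
        then have "psum i X y + psum i (Am n i) y = mphi i X + 1"
          unfolding phiY unfolding Y_def psum_add by simp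
        then show "n \<le> y" using psum_le_mphi[of i X y] by (cases "y < n") (auto simp: pA)
      qed (simp add: phiY pYn)
      have mf: "mf (\<lambda>i j. a j i) \<iota> i Y = Some X"
        using mphi_nonneg[OF sp, of i] unfolding mf_def phiY nfY by (simp add: Y_def)
      obtain mY where mY: "Y = Xvar s k - comb mY" "mdeg mY \<ge> 0" using PM_comb[OF Y] by (auto simp: Y_def)
      then have "X = Xvar s k - comb (mY + frag_of (n, i))" by (simp add: Y_def comb_simps algebra_simps)
      then have "m = mY + frag_of (n, i)" using less.prems(2) comb_inj by simp
      then have "nat (mdeg mY) < nat (mdeg m)" using mY(2) by (simp add: mdeg_simps)
      then have "Y \<in> MM s k" using less.hyps Y mY(1) by (auto simp: Y_def)
      then show ?thesis using mf by (rule monomials.step)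
    qed (simp add: monomials.base)
  qed
  then show ?thesis using PM_comb by blast
qed

text \<open>The closure demanded by \<open>PM_subset_MM\<close> is a negative action. It leads to an
  element of \<open>Xi\<close>, the hypothesis returns it to \<open>Xi_pos\<close>, and injectivity
  of \<open>Trop\<close> recovers the monomial.\<close>

lemma Trop_monomials:
  assumes s: "s \<ge> 1" and Xi: "Xi_pos a \<iota> s k = Xi a \<iota> s k"
  shows "Trop \<iota> ` MM (int s) k = Xi a \<iota> s k"
proof -
  have s': "int s \<ge> 1" using s by simp
  have "X + Am t i \<in> PM (int s) k"
    if X: "X \<in> PM (int s) k" and t: "t \<ge> 1" and neg: "Poly_Mapping.lookup X (t + 1, i) < 0" for X t i
  proof -
    note sp = supp_pos_PM[OF X s']
    define n where "n = nat t"
    have n: "t = int n" "n \<ge> 1" using t by (auto simp: n_def)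
    have "Trop \<iota> X \<in> Xi a \<iota> s k" using Trop_PM[OF s] X Xi by blast
    then have "Sop a \<iota> (pos \<iota> (Suc n) i) (Trop \<iota> X) \<in> Xi a \<iota> s k"
      by (rule Xi.step) (rule pos_props(1), simp)
    moreover have "Poly_Mapping.lookup (Trop \<iota> X) (pos \<iota> (Suc n) i) < 0"
      using lookup_Trop(1)[OF sp, of "Suc n" i] neg by (simp add: n add.commute)
    then have "Sop a \<iota> (pos \<iota> (Suc n) i) (Trop \<iota> X) = Trop \<iota> (X + Am t i)"
      using n by (simp add: Sop_def pred_occ_pos Trop_add sp supp_pos_Am Trop_Am)
    ultimately obtain Z where "Z \<in> PM (int s) k" "Trop \<iota> Z = Trop \<iota> (X + Am t i)"
      using Trop_PM[OF s] Xi by (metis imageE)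
    then show ?thesis using Trop_inj[of Z "X + Am t i"] supp_pos_PM s' sp t
      by (simp add: supp_pos_add supp_pos_Am)
  qed
  then have "MM (int s) k = PM (int s) k"
    using MM_subset_PM[OF s'] PM_subset_MM[OF s'] by blast
  then show ?thesis using Trop_PM[OF s] Xi by simp
qed

end

section \<open>The polyhedral realization\<close>

subsection \<open>Evaluation of linear forms\<close>

lemma lform_eval_superset:
  assumes "finite F" "Poly_Mapping.keys \<phi> \<subseteq> F"
  shows "lform_eval \<phi> x = (\<Sum>r\<in>F. Poly_Mapping.lookup \<phi> r * of_int (Poly_Mapping.lookup x r))"
  unfolding lform_eval_def by (rule sum.mono_neutral_left) (use assms in \<open>auto simp: in_keys_iff\<close>)

lemma lform_eval_add: "lform_eval (\<phi> + \<psi>) x = lform_eval \<phi> x + lform_eval \<psi> x"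
proof -
  let ?F = "Poly_Mapping.keys \<phi> \<union> Poly_Mapping.keys \<psi>"
  have "Poly_Mapping.keys (\<phi> + \<psi>) \<subseteq> ?F" by (rule Poly_Mapping.keys_add)
  then show ?thesis
    by (subst (1 2 3) lform_eval_superset[of ?F]) (auto simp: lookup_add distrib_right sum.distrib)
qed

lemma lform_eval_diff: "lform_eval (\<phi> - \<psi>) x = lform_eval \<phi> x - lform_eval \<psi> x"
  using lform_eval_add[of "\<phi> - \<psi>" \<psi> x] by simp

lemma lform_eval_single: "lform_eval (Poly_Mapping.single r c) x = c * of_int (Poly_Mapping.lookup x r)"
  by (subst lform_eval_superset[of "{r}"]) auto

lemma lform_eval_sum: "lform_eval (sum g A) x = (\<Sum>j\<in>A. lform_eval (g j) x)"
  by (induction A rule: infinite_finite_induct) (auto simp: lform_eval_add, auto simp: lform_eval_def)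

lemma lform_eval_add_point: "lform_eval \<phi> (x + y) = lform_eval \<phi> x + lform_eval \<phi> y"
  by (simp add: lform_eval_def lookup_add distrib_left sum.distrib)

lemma lform_eval_diff_point: "lform_eval \<phi> (x - y) = lform_eval \<phi> x - lform_eval \<phi> y"
  using lform_eval_add_point[of \<phi> "x - y" y] by simp

lemma lform_eval_single_point: "lform_eval \<phi> (Poly_Mapping.single r c) = Poly_Mapping.lookup \<phi> r * of_int c"
proof -
  have "lform_eval \<phi> (Poly_Mapping.single r c)
     = (\<Sum>s\<in>Poly_Mapping.keys \<phi>. if s = r then Poly_Mapping.lookup \<phi> r * of_int c else 0)"
    unfolding lform_eval_def by (rule sum.cong) (auto simp: lookup_single when_def)
  then show ?thesis by (simp add: in_keys_iff)
qed

lemma lform_eval_0_point [simp]: "lform_eval \<phi> 0 = 0"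
  by (simp add: lform_eval_def)

section \<open>The functions \<sigma> and the operators on integer vectors\<close>

lemma sig_superset:
  assumes "finite F" "Poly_Mapping.keys x \<subseteq> F"
  shows "sig a \<iota> r x = Poly_Mapping.lookup x r + (\<Sum>j | j \<in> F \<and> r < j. a (\<iota> r) (\<iota> j) * Poly_Mapping.lookup x j)"
  unfolding sig_def
  by (rule arg_cong2[where f = "(+)", OF refl], rule sum.mono_neutral_left) (use assms in \<open>auto simp: in_keys_iff\<close>)

lemma sig_diff_single:
  "sig a \<iota> r (x - Poly_Mapping.single q 1) =
     sig a \<iota> r x - (if r = q then 1 else if r < q then a (\<iota> r) (\<iota> q) else 0)"
proof -
  let ?F = "insert q (Poly_Mapping.keys x)"
  have k: "Poly_Mapping.keys (x - Poly_Mapping.single q 1) \<subseteq> ?F"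
    by (auto simp: in_keys_iff lookup_minus lookup_single when_def split: if_splits)
  have "(\<Sum>j | j \<in> ?F \<and> r < j. a (\<iota> r) (\<iota> j) * Poly_Mapping.lookup (x - Poly_Mapping.single q 1) j)
     = (\<Sum>j | j \<in> ?F \<and> r < j. a (\<iota> r) (\<iota> j) * Poly_Mapping.lookup x j - (if j = q then a (\<iota> r) (\<iota> q) else 0))"
    by (rule sum.cong) (auto simp: lookup_minus lookup_single when_def right_diff_distrib)
  also have "\<dots> = (\<Sum>j | j \<in> ?F \<and> r < j. a (\<iota> r) (\<iota> j) * Poly_Mapping.lookup x j) - (if r < q then a (\<iota> r) (\<iota> q) else 0)"
    unfolding sum_subtractf by (subst sum.delta) auto
  finally show ?thesis
    using sig_superset[of ?F "x - Poly_Mapping.single q 1" a \<iota> r] sig_superset[of ?F x a \<iota> r, OF _ subset_insertI] k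
    by (auto simp: lookup_minus lookup_single when_def)
qed

lemma lookup_eq_0_large: "\<exists>N::nat. \<forall>r\<ge>N. Poly_Mapping.lookup x r = 0"
proof -
  obtain N where "Poly_Mapping.keys x \<subseteq> {..<N}" using finite_nat_bounded[of "Poly_Mapping.keys x"] by auto
  then show ?thesis by (intro exI[of _ N]) (force simp: in_keys_iff)
qed

lemma sig_eq_0_large:
  assumes "\<forall>r\<ge>N. Poly_Mapping.lookup x r = 0" "r \<ge> N" shows "sig a \<iota> r x = 0"
proof -
  have "{j. j \<in> Poly_Mapping.keys x \<and> r < j} = {}"
  proof (rule equals0I)
    fix j assume "j \<in> {j. j \<in> Poly_Mapping.keys x \<and> r < j}"
    then show False using assms(1)[rule_format, of j] assms(2) by (simp add: in_keys_iff)
  qed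
  then show ?thesis using assms unfolding sig_def by simp
qed

context adapted_seq
begin

text \<open>Beyond the next occurrence r' both values of \<sigma> use row k, so these terms cancel.
  At r' the diagonal entry 2 minus the coefficient 1 leaves the last summand of \<beta>.\<close>

lemma eval_bform:
  assumes "t \<ge> 1"
  shows "lform_eval (bform a \<iota> (pos \<iota> t k)) x = of_int (sig a \<iota> (pos \<iota> t k) x - sig a \<iota> (pos \<iota> (Suc t) k) x)"
proof -
  define r r' where "r = pos \<iota> t k" and "r' = pos \<iota> (Suc t) k"
  have r: "r \<ge> 1" "\<iota> r = k" "\<iota> r' = k" "r < r'" "succ_occ \<iota> r = r'"
    using assms by (simp_all add: r_def r'_def pos_props pos_less_iff succ_occ_pos del: One_nat_def)
  let ?F = "Poly_Mapping.keys x \<union> {..r'}"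
  let ?g = "\<lambda>j. a k (\<iota> j) * Poly_Mapping.lookup x j"
  have split: "{j. j \<in> ?F \<and> r < j} = {j. r < j \<and> j < r'} \<union> insert r' {j. j \<in> ?F \<and> r' < j}" using r by auto
  have "(\<Sum>j | j \<in> ?F \<and> r < j. ?g j) = (\<Sum>j | r < j \<and> j < r'. ?g j) + (?g r' + (\<Sum>j | j \<in> ?F \<and> r' < j. ?g j))"
    unfolding split by (subst sum.union_disjoint) auto
  moreover have "sig a \<iota> r x = Poly_Mapping.lookup x r + (\<Sum>j | j \<in> ?F \<and> r < j. ?g j)"
    "sig a \<iota> r' x = Poly_Mapping.lookup x r' + (\<Sum>j | j \<in> ?F \<and> r' < j. ?g j)"
    using sig_superset[of ?F x a \<iota>] r by auto
  ultimately have "sig a \<iota> r x - sig a \<iota> r' x = 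
     Poly_Mapping.lookup x r + (\<Sum>j | r < j \<and> j < r'. ?g j) + Poly_Mapping.lookup x r'"
    using r by simp
  moreover have "lform_eval (bform a \<iota> r) x = of_int (Poly_Mapping.lookup x r + (\<Sum>j | r < j \<and> j < r'. ?g j) + Poly_Mapping.lookup x r')"
    using r by (simp add: bform_def lform_eval_add lform_eval_sum lform_eval_single xcoord_def)
  ultimately show ?thesis by (simp add: r_def r'_def)
qed

lemma sig_values_finite: "finite {sig a \<iota> r x |r. r \<ge> 1 \<and> \<iota> r = i}"
proof -
  obtain N where N: "\<forall>r\<ge>N. Poly_Mapping.lookup x r = 0" using lookup_eq_0_large by blast
  have "{sig a \<iota> r x |r. r \<ge> 1 \<and> \<iota> r = i} \<subseteq> insert 0 ((\<lambda>r. sig a \<iota> r x) ` {..<N})"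
    using sig_eq_0_large[OF N] by (force simp: not_less[symmetric])
  then show ?thesis by (rule finite_subset) simp
qed

lemma sig_le_sigmax: "r \<ge> 1 \<Longrightarrow> \<iota> r = i \<Longrightarrow> sig a \<iota> r x \<le> sigmax a \<iota> i x"
  unfolding sigmax_def by (rule Max_ge[OF sig_values_finite]) auto

lemma Mset_nonempty: "Mset a \<iota> i x \<noteq> {}"
proof -
  have "pos \<iota> 1 i \<ge> 1 \<and> \<iota> (pos \<iota> 1 i) = i" using pos_props[of 1 i] by blast
  then have "sigmax a \<iota> i x \<in> {sig a \<iota> r x |r. r \<ge> 1 \<and> \<iota> r = i}"
    unfolding sigmax_def by (intro Max_in[OF sig_values_finite]) blast
  then show ?thesis by (auto simp: Mset_def)
qed

lemma Mset_finite: "sigmax a \<iota> i x > 0 \<Longrightarrow> finite (Mset a \<iota> i x)"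
proof -
  assume pos: "sigmax a \<iota> i x > 0"
  obtain N where N: "\<forall>r\<ge>N. Poly_Mapping.lookup x r = 0" using lookup_eq_0_large by blast
  have "r < N" if "r \<in> Mset a \<iota> i x" for r
    using sig_eq_0_large[OF N, of r a \<iota>] that pos by (auto simp: Mset_def not_le[symmetric])
  then have "Mset a \<iota> i x \<subseteq> {..<N}" by blast
  then show ?thesis by (rule finite_subset) simp
qed

abbreviation fZ :: "'i \<Rightarrow> (nat \<Rightarrow>\<^sub>0 int) \<Rightarrow> (nat \<Rightarrow>\<^sub>0 int)" where
  "fZ i x \<equiv> the (ff (Zcrystal a \<iota>) i x)"

lemma fZ_eq: "fZ i x = x + Poly_Mapping.single (LEAST r. r \<in> Mset a \<iota> i x) 1"
  by (simp add: Zcrystal_def)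

text \<open>Lowering the entry at the last maximum q lowers \<sigma> by 1 at q and, as a i i = 2, by
  2 at earlier occurrences of i; later ones were already below the maximum. So q is the first
  maximum afterwards, which is where f i acts.\<close>

lemma fZ_eZ:
  assumes "sigmax a \<iota> i x > 0"
  shows "fZ i (x - Poly_Mapping.single (Max (Mset a \<iota> i x)) 1) = x"
proof -
  define q where "q = Max (Mset a \<iota> i x)"
  define y where "y = x - Poly_Mapping.single q 1"
  have "q \<in> Mset a \<iota> i x" unfolding q_def by (rule Max_in[OF Mset_finite[OF assms] Mset_nonempty])
  then have q: "q \<ge> 1" "\<iota> q = i" "sig a \<iota> q x = sigmax a \<iota> i x" by (auto simp: Mset_def)
  have le: "sig a \<iota> r y \<le> sigmax a \<iota> i x - 1" if r: "r \<ge> 1" "\<iota> r = i" for r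
  proof (cases "r \<le> q")
    case True
    then show ?thesis using sig_le_sigmax[OF r, of x] q r by (auto simp: y_def sig_diff_single)
  next
    case False
    then have "r \<notin> Mset a \<iota> i x" unfolding q_def using Max_ge[OF Mset_finite[OF assms], of r] by auto
    then have "sig a \<iota> r x < sigmax a \<iota> i x" using sig_le_sigmax[OF r, of x] r by (auto simp: Mset_def less_le)
    then show ?thesis using False by (simp add: y_def sig_diff_single)
  qed
  have yq: "sig a \<iota> q y = sigmax a \<iota> i x - 1" using q by (simp add: y_def sig_diff_single)
  have my: "sigmax a \<iota> i y = sigmax a \<iota> i x - 1"
    unfolding sigmax_def[of a \<iota> i y]
  proof (rule Max_eqI[OF sig_values_finite])
    show "sigmax a \<iota> i x - 1 \<in> {sig a \<iota> r y |r. r \<ge> 1 \<and> \<iota> r = i}"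
      using yq q(1,2) by (auto intro!: exI[of _ q])
  qed (use le in auto)
  have "(LEAST r. r \<in> Mset a \<iota> i y) = q"
  proof (rule Least_equality)
    show "q \<in> Mset a \<iota> i y" using q yq my by (simp add: Mset_def)
    fix r assume "r \<in> Mset a \<iota> i y"
    then have r: "r \<ge> 1" "\<iota> r = i" "sig a \<iota> r y = sigmax a \<iota> i x - 1" by (auto simp: Mset_def my)
    show "q \<le> r"
    proof (rule ccontr)
      assume "\<not> q \<le> r"
      then show False using r sig_le_sigmax[OF r(1,2), of x] q by (simp add: y_def sig_diff_single)
    qed
  qed
  then show ?thesis unfolding fZ_eq q_def[symmetric] y_def[symmetric] by (simp add: y_def)
qed

section \<open>The polyhedral set and its stability under the operators\<close>

definition polyhedral :: "(nat \<Rightarrow>\<^sub>0 int) set" where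
  "polyhedral = {x \<in> Zinf. \<forall>s\<ge>1. \<forall>k. \<forall>\<phi>\<in>Xi a \<iota> s k. lform_eval \<phi> x \<ge> 0}"

text \<open>Applying \<open>Sop\<close> at r = \<open>pos \<iota> t i\<close> n times brings the
  coefficient there down to 0 and shows that \<phi> minus n times the \<beta> of r lies in
  \<open>Xi\<close>, hence is nonnegative at x.\<close>

lemma Xi_eval_pos:
  assumes "x \<in> polyhedral" "s \<ge> 1" "\<phi> \<in> Xi a \<iota> s k" "t \<ge> 1"
    "Poly_Mapping.lookup \<phi> (pos \<iota> t i) = of_nat n"
  shows "lform_eval \<phi> x \<ge> of_nat n * of_int (sig a \<iota> (pos \<iota> t i) x - sig a \<iota> (pos \<iota> (Suc t) i) x)"
  using assms(3,5)
proof (induction n arbitrary: \<phi>)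
  case 0
  then show ?case using assms(1,2) by (auto simp: polyhedral_def)
next
  case (Suc n)
  let ?r = "pos \<iota> t i"
  have r: "?r \<ge> 1" by (rule pos_props[OF assms(4)])
  have r': "succ_occ \<iota> ?r \<noteq> ?r" using assms(4) by (simp add: succ_occ_pos pos_eq_iff)
  have S: "Sop a \<iota> ?r \<phi> = \<phi> - bform a \<iota> ?r" using Suc.prems(2) by (simp add: Sop_def)
  have "\<phi> - bform a \<iota> ?r \<in> Xi a \<iota> s k" using Xi.step[OF Suc.prems(1) r] by (simp only: S)
  moreover have "Poly_Mapping.lookup (\<phi> - bform a \<iota> ?r) ?r = of_nat n"
    using Suc.prems(2) r r' by (simp add: lookup_minus lookup_bform)
  ultimately have "lform_eval (\<phi> - bform a \<iota> ?r) x \<ge> of_nat n * of_int (sig a \<iota> ?r x - sig a \<iota> (pos \<iota> (Suc t) i) x)"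
    by (rule Suc.IH)
  then show ?case by (simp add: lform_eval_diff eval_bform[OF assms(4)] algebra_simps)
qed

text \<open>The mirror image: \<open>Sop\<close> at occurrence \<open>Suc t\<close> adds the \<beta>
  of its predecessor t, which raises the coefficient towards 0.\<close>

lemma Xi_eval_neg:
  assumes "x \<in> polyhedral" "s \<ge> 1" "\<phi> \<in> Xi a \<iota> s k" "t \<ge> 1"
    "Poly_Mapping.lookup \<phi> (pos \<iota> (Suc t) i) = - of_nat n"
  shows "lform_eval \<phi> x \<ge> of_nat n * of_int (sig a \<iota> (pos \<iota> (Suc t) i) x - sig a \<iota> (pos \<iota> t i) x)"
  using assms(3,5)
proof (induction n arbitrary: \<phi>)
  case 0
  then show ?case using assms(1,2) by (auto simp: polyhedral_def)
next
  case (Suc n)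
  let ?r = "pos \<iota> t i" and ?r' = "pos \<iota> (Suc t) i"
  have r: "?r \<ge> 1" "?r' \<ge> 1" by (rule pos_props, use assms(4) in simp)+
  have r': "?r' \<noteq> ?r" "succ_occ \<iota> ?r = ?r'" using assms(4) by (simp_all add: succ_occ_pos pos_eq_iff)
  have S: "Sop a \<iota> ?r' \<phi> = \<phi> + bform a \<iota> ?r"
    using Suc.prems(2) assms(4) by (simp add: Sop_def pred_occ_pos)
  have "\<phi> + bform a \<iota> ?r \<in> Xi a \<iota> s k" using Xi.step[OF Suc.prems(1) r(2)] by (simp only: S)
  moreover have "Poly_Mapping.lookup (\<phi> + bform a \<iota> ?r) ?r' = - of_nat n"
    using Suc.prems(2) r r' by (simp add: lookup_add lookup_bform)
  ultimately have "lform_eval (\<phi> + bform a \<iota> ?r) x \<ge> of_nat n * of_int (sig a \<iota> ?r' x - sig a \<iota> ?r x)"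
    by (rule Suc.IH)
  then show ?case by (simp add: lform_eval_add eval_bform[OF assms(4)] algebra_simps)
qed

context
  assumes Xi_pos_eq: "\<forall>s\<ge>1. \<forall>k. Xi_pos a \<iota> s k = Xi a \<iota> s k"
begin

text \<open>All three claims are read off from monomials, first occurrences being level 1. A
  negative coefficient there would defeat \<open>Xi_eval_neg\<close>, which needs a
  predecessor.\<close>

lemma Xi_coeffs:
  assumes "s \<ge> 1" "\<phi> \<in> Xi a \<iota> s k"
  shows "Poly_Mapping.lookup \<phi> r \<in> \<int>" "Poly_Mapping.lookup \<phi> (pos \<iota> 1 i) \<ge> 0" "Poly_Mapping.lookup \<phi> 0 = 0"
proof -
  obtain X where X: "X \<in> PM (int s) k" "\<phi> = Trop \<iota> X"
    using Trop_PM[OF assms(1), of k] assms Xi_pos_eq by blast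
  have sp: "supp_pos X" using supp_pos_PM[OF X(1)] assms(1) by simp
  show 0: "Poly_Mapping.lookup \<phi> 0 = 0" using lookup_Trop(2)[OF sp] X(2) by simp
  show "Poly_Mapping.lookup \<phi> (pos \<iota> 1 i) \<ge> 0"
    using first_exponent_nonneg[OF X(1), of i] lookup_Trop(1)[OF sp, of 1 i] X(2) by simp
  show "Poly_Mapping.lookup \<phi> r \<in> \<int>"
  proof (cases "r = 0")
    case False
    then obtain t where t: "t \<ge> 1" "r = pos \<iota> t (\<iota> r)" using pos_surj[of r] by auto
    then show ?thesis using lookup_Trop(1)[OF sp t(1), of "\<iota> r"] X(2) by (metis Ints_of_int)
  qed (simp add: 0)
qed

text \<open>Only a negative coefficient -n at r can do harm. As r is the first maximum of \<sigma>,
  its predecessor has a smaller value, and \<open>Xi_eval_neg\<close> gives at least n as the value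
  of \<phi> at x.\<close>

lemma polyhedral_fZ: assumes x: "x \<in> polyhedral" shows "fZ i x \<in> polyhedral"
proof -
  define r where "r = (LEAST r. r \<in> Mset a \<iota> i x)"
  have "r \<in> Mset a \<iota> i x" unfolding r_def using Mset_nonempty[of i x] by (meson LeastI ex_in_conv)
  then have r: "r \<ge> 1" "\<iota> r = i" "sig a \<iota> r x = sigmax a \<iota> i x" by (auto simp: Mset_def)
  have min: "r \<le> q" if "q \<in> Mset a \<iota> i x" for q unfolding r_def using that by (rule Least_le)
  have "lform_eval \<phi> (x + Poly_Mapping.single r 1) \<ge> 0" if s: "s \<ge> 1" and \<phi>: "\<phi> \<in> Xi a \<iota> s k" for s k \<phi>
  proof -
    obtain c where c: "Poly_Mapping.lookup \<phi> r = of_int c" using Xi_coeffs(1)[OF s \<phi>] by (meson Ints_cases)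
    have e: "lform_eval \<phi> (x + Poly_Mapping.single r 1) = lform_eval \<phi> x + of_int c"
      by (simp add: lform_eval_add_point lform_eval_single_point c)
    have p: "lform_eval \<phi> x \<ge> 0" using x s \<phi> by (auto simp: polyhedral_def)
    show ?thesis
    proof (cases "c \<ge> 0")
      case True
      then show ?thesis using e p by simp
    next
      case False
      obtain t where t: "t \<ge> 1" "r = pos \<iota> t i" using pos_surj[OF r(1)] r(2) by auto
      have "t \<noteq> 1" using Xi_coeffs(2)[OF s \<phi>, of i] False c t(2) by auto
      then obtain u where u: "t = Suc u" "u \<ge> 1" using t(1) by (cases t) auto
      let ?q = "pos \<iota> u i"
      have q: "?q \<ge> 1" "\<iota> ?q = i" "?q < r" using u t pos_props[OF u(2), of i] by (simp_all add: pos_less_iff)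
      then have "?q \<notin> Mset a \<iota> i x" using min by (meson not_le)
      then have "sig a \<iota> ?q x < sigmax a \<iota> i x"
        using sig_le_sigmax[OF q(1,2), of x] q by (auto simp: Mset_def less_le)
      then have d: "1 \<le> sig a \<iota> r x - sig a \<iota> ?q x" using r by simp
      have n: "Poly_Mapping.lookup \<phi> (pos \<iota> (Suc u) i) = - of_nat (nat (- c))"
        using False c t u by simp
      have "rat_of_nat (nat (- c)) * 1 \<le> of_nat (nat (- c)) * of_int (sig a \<iota> r x - sig a \<iota> ?q x)"
        using d by (intro mult_left_mono) (simp_all only: of_int_1_le_iff of_nat_0_le_iff)
      also have "\<dots> \<le> lform_eval \<phi> x" using Xi_eval_neg[OF x s \<phi> u(2) n] t u by simp
      finally show ?thesis using e False by simp
    qed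
  qed
  moreover have "x + Poly_Mapping.single r 1 \<in> Zinf"
    using x r(1) by (simp add: polyhedral_def Zinf_def lookup_add lookup_single when_def)
  ultimately show ?thesis unfolding fZ_eq r_def[symmetric] by (simp add: polyhedral_def)
qed

text \<open>Dual to the case of f i: the successor of the last maximum has a smaller \<sigma>, so
  \<open>Xi_eval_pos\<close> covers a positive coefficient. A successor always exists, so there is
  no boundary case.\<close>

lemma polyhedral_eZ:
  assumes x: "x \<in> polyhedral" and m: "sigmax a \<iota> i x > 0"
  shows "x - Poly_Mapping.single (Max (Mset a \<iota> i x)) 1 \<in> polyhedral"
proof -
  define r where "r = Max (Mset a \<iota> i x)"
  have "r \<in> Mset a \<iota> i x" unfolding r_def by (rule Max_in[OF Mset_finite[OF m] Mset_nonempty])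
  then have r: "r \<ge> 1" "\<iota> r = i" "sig a \<iota> r x = sigmax a \<iota> i x" by (auto simp: Mset_def)
  have max: "q \<le> r" if "q \<in> Mset a \<iota> i x" for q unfolding r_def using that Mset_finite[OF m] by simp
  have "lform_eval \<phi> (x - Poly_Mapping.single r 1) \<ge> 0" if s: "s \<ge> 1" and \<phi>: "\<phi> \<in> Xi a \<iota> s k" for s k \<phi>
  proof -
    obtain c where c: "Poly_Mapping.lookup \<phi> r = of_int c" using Xi_coeffs(1)[OF s \<phi>] by (meson Ints_cases)
    have e: "lform_eval \<phi> (x - Poly_Mapping.single r 1) = lform_eval \<phi> x - of_int c"
      by (simp add: lform_eval_diff_point lform_eval_single_point c)
    have p: "lform_eval \<phi> x \<ge> 0" using x s \<phi> by (auto simp: polyhedral_def)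
    show ?thesis
    proof (cases "c \<le> 0")
      case True
      then show ?thesis using e p by simp
    next
      case False
      obtain t where t: "t \<ge> 1" "r = pos \<iota> t i" using pos_surj[OF r(1)] r(2) by auto
      let ?q = "pos \<iota> (Suc t) i"
      have q: "?q \<ge> 1" "\<iota> ?q = i" "r < ?q" using t pos_props[of "Suc t" i] by (simp_all add: pos_less_iff)
      then have "?q \<notin> Mset a \<iota> i x" using max by (meson not_le)
      then have "sig a \<iota> ?q x < sigmax a \<iota> i x"
        using sig_le_sigmax[OF q(1,2), of x] q by (auto simp: Mset_def less_le)
      then have d: "1 \<le> sig a \<iota> r x - sig a \<iota> ?q x" using r by simp
      have n: "Poly_Mapping.lookup \<phi> (pos \<iota> t i) = of_nat (nat c)" using False c t by simp
      have "rat_of_nat (nat c) * 1 \<le> of_nat (nat c) * of_int (sig a \<iota> r x - sig a \<iota> ?q x)"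
        using d by (intro mult_left_mono) (simp_all only: of_int_1_le_iff of_nat_0_le_iff)
      also have "\<dots> \<le> lform_eval \<phi> x" using Xi_eval_pos[OF x s \<phi> t(1) n] t by simp
      finally show ?thesis using e False by simp
    qed
  qed
  moreover have "x - Poly_Mapping.single r 1 \<in> Zinf"
    using x r(1) by (simp add: polyhedral_def Zinf_def lookup_minus lookup_single when_def)
  ultimately show ?thesis unfolding r_def[symmetric] by (simp add: polyhedral_def)
qed

lemma polyhedral_nonneg: assumes "x \<in> polyhedral" shows "Poly_Mapping.lookup x r \<ge> 0"
proof (cases "r = 0")
  case True
  then show ?thesis using assms by (simp add: polyhedral_def Zinf_def)
next
  case False
  then obtain t where t: "t \<ge> 1" "r = pos \<iota> t (\<iota> r)" using pos_surj[of r] by auto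
  then have "xcoord r \<in> Xi a \<iota> t (\<iota> r)" using Xi.base by metis
  then have "lform_eval (xcoord r) x \<ge> 0" using assms t(1) by (auto simp: polyhedral_def)
  then show ?thesis by (simp add: xcoord_def lform_eval_single)
qed

text \<open>At the highest nonzero entry, \<sigma> is that entry, which is positive because the
  coordinate forms belong to \<open>Xi\<close>. So some e i applies to every nonzero vector of the
  set.\<close>

lemma polyhedral_sigmax:
  assumes "x \<in> polyhedral" "x \<noteq> 0" shows "\<exists>i. sigmax a \<iota> i x > 0"
proof -
  define r where "r = Max (Poly_Mapping.keys x)"
  have r: "r \<in> Poly_Mapping.keys x" unfolding r_def using assms(2) by (intro Max_in) auto
  then have "Poly_Mapping.lookup x r > 0"
    using polyhedral_nonneg[OF assms(1), of r] by (simp add: in_keys_iff)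
  moreover have E: "{j. j \<in> Poly_Mapping.keys x \<and> r < j} = {}"
    unfolding r_def by (auto simp: not_less[symmetric] dest: Max_ge[OF finite_keys])
  ultimately have "sig a \<iota> r x > 0" unfolding sig_def E by simp
  moreover have "r \<ge> 1"
    using assms(1) r by (cases r) (auto simp: polyhedral_def Zinf_def in_keys_iff)
  ultimately show ?thesis using sig_le_sigmax[of r "\<iota> r" x] by (metis less_le_trans)
qed

text \<open>Each e i lowers the sum of the entries, which stays nonnegative on the set; so the
  descent ends at 0, and \<open>fZ_eZ\<close> reverses it into a word.\<close>

lemma words_eq_polyhedral: "range (\<lambda>w. foldr fZ w 0) = polyhedral"
proof
  show "range (\<lambda>w. foldr fZ w 0) \<subseteq> polyhedral"
  proof clarify
    fix w show "foldr fZ w 0 \<in> polyhedral"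
      by (induction w) (simp_all add: polyhedral_fZ del: option.sel, simp add: polyhedral_def Zinf_def)
  qed
  have "\<exists>w. x = foldr fZ w 0" if "x \<in> polyhedral" for x
    using that
  proof (induction "nat (\<Sum>r\<in>Poly_Mapping.keys x. Poly_Mapping.lookup x r)" arbitrary: x rule: less_induct)
    case less
    show ?case
    proof (cases "x = 0")
      case True
      then show ?thesis by (intro exI[of _ "[]"]) simp
    next
      case False
      then obtain i where i: "sigmax a \<iota> i x > 0" using polyhedral_sigmax less.prems by blast
      define q where "q = Max (Mset a \<iota> i x)"
      define y where "y = x - Poly_Mapping.single q 1"
      have y: "y \<in> polyhedral" unfolding y_def q_def by (rule polyhedral_eZ[OF less.prems i])
      have xy: "x = y + Poly_Mapping.single q 1" by (simp add: y_def)
      let ?F = "insert q (Poly_Mapping.keys y \<union> Poly_Mapping.keys x)"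
      have "(\<Sum>r\<in>Poly_Mapping.keys x. Poly_Mapping.lookup x r) = (\<Sum>r\<in>?F. Poly_Mapping.lookup x r)"
        by (rule sum.mono_neutral_left) (auto simp: in_keys_iff)
      also have "\<dots> = (\<Sum>r\<in>?F. Poly_Mapping.lookup y r + (if r = q then 1 else 0))"
        by (rule sum.cong) (auto simp: xy lookup_add lookup_single when_def)
      also have "\<dots> = (\<Sum>r\<in>?F. Poly_Mapping.lookup y r) + 1"
        unfolding sum.distrib by (subst sum.delta) auto
      also have "(\<Sum>r\<in>?F. Poly_Mapping.lookup y r) = (\<Sum>r\<in>Poly_Mapping.keys y. Poly_Mapping.lookup y r)"
        by (rule sum.mono_neutral_right) (auto simp: in_keys_iff)
      moreover have "(\<Sum>r\<in>Poly_Mapping.keys y. Poly_Mapping.lookup y r) \<ge> 0"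
        using polyhedral_nonneg[OF y] by (intro sum_nonneg) auto
      ultimately obtain w where "y = foldr fZ w 0" using less.hyps[OF _ y] by force
      then have "x = foldr fZ (i # w) 0" using fZ_eZ[OF i] by (simp add: y_def q_def)
      then show ?thesis by blast
    qed
  qed
  then show "polyhedral \<subseteq> range (\<lambda>w. foldr fZ w 0)" by blast
qed

lemma polyhedral_eq_monomials:
  "polyhedral = {x \<in> Zinf. \<forall>\<phi> \<in> (\<Union>s\<in>{1..}. \<Union>k. Trop \<iota> ` MM s k). lform_eval \<phi> x \<ge> 0}"
proof -
  have "(\<Union>s\<in>{1..}. \<Union>k. Trop \<iota> ` MM s k) = (\<Union>s\<in>{1..}. \<Union>k. Xi a \<iota> s k)"
  proof -
    \<comment> \<open>Levels are integers for monomials and natural numbers for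
      \<open>Xi\<close>.\<close>
    have "x \<in> int ` {1..}" if "x \<ge> 1" for x
      using that by (intro image_eqI[of _ _ "nat x"]) auto
    then have "{1..} = int ` {1..}" by auto
    then have "(\<Union>s\<in>{1..}. \<Union>k. Trop \<iota> ` MM s k) = (\<Union>s\<in>{1..}. \<Union>k. Trop \<iota> ` MM (int s) k)"
      by (simp add: image_image)
    then show ?thesis using Trop_monomials Xi_pos_eq by simp
  qed
  then show ?thesis unfolding polyhedral_def by auto
qed

end
end

theorem theorem4p2:
  fixes a :: "'i::finite \<Rightarrow> 'i \<Rightarrow> int" and d :: "'i \<Rightarrow> nat" and \<iota> :: "nat \<Rightarrow> 'i"
    and \<Psi> :: "'i falg set set \<Rightarrow> (nat \<Rightarrow>\<^sub>0 int)"
  assumes "gen_cartan_matrix a" and "symmetrizer a d"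
    and "index_sequence \<iota>" and "adapted a \<iota>"
    and "strict_embedding (Binf a d) (Zcrystal a \<iota>) \<Psi>" and "\<Psi> (uinf a d) = 0"
    and "\<forall>s\<ge>1. \<forall>k. Xi_pos a \<iota> s k = Xi a \<iota> s k"
  shows "\<Psi> ` elts (Binf a d) =
    {x \<in> Zinf. \<forall>\<phi> \<in> (\<Union>s\<in>{1..}. \<Union>k. Trop \<iota> ` monomials (\<lambda>i j. a j i) \<iota> s k).
       lform_eval \<phi> x \<ge> 0}"
proof -
  interpret adapted_seq \<iota> a using assms(1,3,4) by unfold_locales
  show ?thesis
    using embedded_image_eq_words[OF assms(1,2,5,6)] words_eq_polyhedral[OF assms(7)]
      polyhedral_eq_monomials[OF assms(7)] by simp
qed

end
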